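(* Let $\mathbf{k}$ be a field, and suppose $S=\mathbf{k}[x_0,\dots,x_n]$ is positively graded by an abelian group $A$. Let $M$ be an $A$-graded $S$-module that is generated in a single degree $d\in A$, and let $F$ be the minimal free resolution of $M$. (1) $\mathbf{L}(K_d(M))$ is a strongly linear, quasi-split subcomplex of $F$. (2) Any strongly linear, quasi-split subcomplex of $F$ is isomorphic to a quasi-split subcomplex of $\mathbf{L}(K_d(M))$. Thus, $\mathbf{L}(K_d(M))$ is the unique maximal strongly linear, quasi-split subcomplex of $F$. In particular, if $F$ is strongly linear, then $F\cong\mathbf{L}(K_d(M))$.
   Context: Positive grading: $S$ is $A$-graded with each $x_i$ homogeneous, $S_{\mathbf 0}=\mathbf{k}$ (where $\mathbf 0$ is the identity of $A$), and there is a homomorphism $\theta:A\to\mathbb{Z}$ with $\theta(\deg(x_i))>0$ for all $i$. Twists: $M(a)_b=M_{a+b}$. A complex $C$ of free $A$-graded $S$-modules is strongly linear if there is a choice of basis of $C$ with respect to which its differentials are matrices whose entries are $\mathbf{k}$-linear combinations of the variables $x_0,\dots,x_n$. A subcomplex $C'$ of a complex $C$ of $A$-graded $S$-modules is quasi-split if $C'$ is a summand of $C$ as an $S$-module (not necessarily as a complex). $E=\Lambda_{\mathbf{k}}(e_0,\dots,e_n)$ is the exterior algebra with $A\oplus\mathbb{Z}$-grading $\deg(e_i)=(-\deg(x_i);-1)$; the $\mathbb{Z}$-component is the auxiliary degree $\mathrm{aux}$. $E$-modules are $A\oplus\mathbb{Z}$-graded right modules, viewed also as left modules via $em=(-1)^{\mathrm{aux}(e)\mathrm{aux}(m)}me$.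 $\omega_E=\underline{\mathrm{Hom}}_{\mathbf{k}}(E,\mathbf{k})$ is the graded $\mathbf{k}$-dual of $E$, with $(fe)(e')=f(ee')$. For an $A$-graded $S$-module $M$, $\mathbf{R}(M)=\bigoplus_{a\in A}M_a\otimes_{\mathbf{k}}\omega_E(-a;0)$ with differential $\partial_{\mathbf{R}(M)}(m\otimes f)=\sum_{i=0}^n x_im\otimes e_if$, and for $a\in A$, $K_a(M)=\ker\big(M_a\otimes_{\mathbf{k}}\omega_E(-a;0)\xrightarrow{\partial_{\mathbf{R}(M)}}\mathbf{R}(M)\big)$. For an $E$-module $N$ (with trivial differential), $\mathbf{L}(N)$ is the complex of $A$-graded $S$-modules with $\mathbf{L}(N)_j=\bigoplus_{a\in A}S(-a)\otimes_{\mathbf{k}}N_{(a;j)}$ in homological degree $j$ and differential $s\otimes y\mapsto\sum_{i=0}^n x_is\otimes e_iy$. *)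

theory Defs
  imports
    Complex_Main
    "HOL-Library.Poly_Mapping"
    "HOL-Library.Function_Algebras"
    "HOL-Library.Product_Plus"
begin

abbreviation (input) keys where "keys \<equiv> Poly_Mapping.keys"
abbreviation (input) lookup where "lookup \<equiv> Poly_Mapping.lookup"
abbreviation (input) single where "single \<equiv> Poly_Mapping.single"


section \<open>The polynomial ring\<close>

text \<open>The variables are indexed by a finite (hence nonempty) type \<open>'v\<close> in place of \<open>{0,...,n}\<close>; its
  linear order only serves to fix signs in the monomial basis of the exterior algebra.\<close>

type_synonym 'v mono = "'v \<Rightarrow>\<^sub>0 nat"
type_synonym ('v, 'k) mpol = "('v \<Rightarrow>\<^sub>0 nat) \<Rightarrow>\<^sub>0 'k"

definition Var :: "'v \<Rightarrow> ('v, 'k::field) mpol"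
  where "Var i = single (single i 1) 1"

definition Const :: "'k \<Rightarrow> ('v, 'k::field) mpol"
  where "Const c = single 0 c"

definition linear_forms :: "('v, 'k::field) mpol set"
  where "linear_forms = module.span (\<lambda>c s. Const c * s) (range Var)"


section \<open>Gradings\<close>

text \<open>A family \<open>G\<close> of subsets of an abelian group is treated as a graded group when its members are
  subgroups whose sum is direct; the underlying group is then that sum, \<open>carr G\<close>.\<close>

definition carr :: "('a \<Rightarrow> 'm::ab_group_add set) \<Rightarrow> 'm set"
  where "carr G = {\<Sum>a\<in>keys f. lookup f a | f. \<forall>a. lookup f a \<in> G a}"

definition is_grading :: "('a \<Rightarrow> 'm::ab_group_add set) \<Rightarrow> bool"
  where "is_grading G \<longleftrightarrow>
    (\<forall>a. 0 \<in> G a \<and> (\<forall>x\<in>G a. \<forall>y\<in>G a. x + y \<in> G a) \<and> (\<forall>x\<in>G a. - x \<in> G a)) \<and>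
    (\<forall>f. (\<forall>a. lookup f a \<in> G a) \<and> (\<Sum>a\<in>keys f. lookup f a) = 0 \<longrightarrow> f = 0)"

definition twist :: "('a::ab_group_add \<Rightarrow> 'm set) \<Rightarrow> 'a \<Rightarrow> 'a \<Rightarrow> 'm set"
  where "twist G a b = G (a + b)"

definition graded_ring :: "('a::ab_group_add \<Rightarrow> 's::comm_ring_1 set) \<Rightarrow> bool"
  where "graded_ring Sg \<longleftrightarrow>
    is_grading Sg \<and> carr Sg = UNIV \<and> 1 \<in> Sg 0 \<and>
    (\<forall>a b. \<forall>s\<in>Sg a. \<forall>t\<in>Sg b. s * t \<in> Sg (a + b))"

text \<open>\<open>w i\<close> is the degree of the \<open>i\<close>-th variable.\<close>

definition positively_graded ::
  "('a::ab_group_add \<Rightarrow> ('v, 'k::field) mpol set) \<Rightarrow> ('v \<Rightarrow> 'a) \<Rightarrow> bool"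
  where "positively_graded Sg w \<longleftrightarrow>
    graded_ring Sg \<and> (\<forall>i. Var i \<in> Sg (w i)) \<and> Sg 0 = range Const \<and>
    (\<exists>\<theta> :: 'a \<Rightarrow> int. additive \<theta> \<and> (\<forall>i. \<theta> (w i) > 0))"


section \<open>Graded modules\<close>

text \<open>The underlying set of the module is \<open>carr (pt M)\<close>, a submodule of the module formed by the
  whole type \<open>'m\<close> under \<open>sc M\<close>.\<close>

record ('a, 's, 'm) gmod =
  sc :: "'s \<Rightarrow> 'm \<Rightarrow> 'm"
  pt :: "'a \<Rightarrow> 'm set"

abbreviation mcarr :: "('a, 's, 'm::ab_group_add) gmod \<Rightarrow> 'm set"
  where "mcarr M \<equiv> carr (pt M)"

definition graded_module ::
  "('a::ab_group_add \<Rightarrow> 's::comm_ring_1 set) \<Rightarrow> ('a, 's, 'm::ab_group_add) gmod \<Rightarrow> bool"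
  where "graded_module Sg M \<longleftrightarrow>
    module (sc M) \<and> is_grading (pt M) \<and>
    (\<forall>a b. \<forall>s\<in>Sg a. \<forall>x\<in>pt M b. sc M s x \<in> pt M (a + b))"

definition generated_in_degree :: "('a, 's::comm_ring_1, 'm::ab_group_add) gmod \<Rightarrow> 'a \<Rightarrow> bool"
  where "generated_in_degree M d \<longleftrightarrow> module.span (sc M) (pt M d) = mcarr M"

definition linear_on ::
  "('a, 's, 'm::ab_group_add) gmod \<Rightarrow> ('a, 's, 'n::ab_group_add) gmod \<Rightarrow> ('m \<Rightarrow> 'n) \<Rightarrow> bool"
  where "linear_on M N f \<longleftrightarrow>
    (\<forall>x\<in>mcarr M. \<forall>y\<in>mcarr M. f (x + y) = f x + f y) \<and>
    (\<forall>s. \<forall>x\<in>mcarr M. f (sc M s x) = sc N s (f x))"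

definition graded_hom ::
  "('a, 's, 'm::ab_group_add) gmod \<Rightarrow> ('a, 's, 'n::ab_group_add) gmod \<Rightarrow> ('m \<Rightarrow> 'n) \<Rightarrow> bool"
  where "graded_hom M N f \<longleftrightarrow> linear_on M N f \<and> (\<forall>a. f ` pt M a \<subseteq> pt N a)"

definition homogeneous_basis :: "('a, 's::comm_ring_1, 'm::ab_group_add) gmod \<Rightarrow> 'm set \<Rightarrow> bool"
  where "homogeneous_basis M B \<longleftrightarrow>
    B \<subseteq> (\<Union>a. pt M a) \<and> \<not> module.dependent (sc M) B \<and> module.span (sc M) B = mcarr M"

definition graded_free :: "('a, 's::comm_ring_1, 'm::ab_group_add) gmod \<Rightarrow> bool"
  where "graded_free M \<longleftrightarrow> (\<exists>B. homogeneous_basis M B)"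


section \<open>Complexes of graded modules\<close>

text \<open>Homological indexing: \<open>df C j\<close> is the differential from \<open>md C j\<close> to \<open>md C (j - 1)\<close>; its values
  off \<open>mcarr (md C j)\<close> are irrelevant.\<close>

record ('a, 's, 'm) cplx =
  md :: "int \<Rightarrow> ('a, 's, 'm) gmod"
  df :: "int \<Rightarrow> 'm \<Rightarrow> 'm"

definition graded_complex ::
  "('a::ab_group_add \<Rightarrow> 's::comm_ring_1 set) \<Rightarrow> ('a, 's, 'm::ab_group_add) cplx \<Rightarrow> bool"
  where "graded_complex Sg C \<longleftrightarrow> (\<forall>j.
    graded_module Sg (md C j) \<and>
    graded_hom (md C j) (md C (j - 1)) (df C j) \<and>
    (\<forall>x\<in>mcarr (md C j). df C (j - 1) (df C j x) = 0))"

definition complex_iso ::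
  "('a, 's, 'm::ab_group_add) cplx \<Rightarrow> ('a, 's, 'n::ab_group_add) cplx \<Rightarrow> bool"
  where "complex_iso C D \<longleftrightarrow> (\<exists>\<phi> :: int \<Rightarrow> 'm \<Rightarrow> 'n. \<forall>j.
    graded_hom (md C j) (md D j) (\<phi> j) \<and>
    (\<forall>a. bij_betw (\<phi> j) (pt (md C j) a) (pt (md D j) a)) \<and>
    bij_betw (\<phi> j) (mcarr (md C j)) (mcarr (md D j)) \<and>
    (\<forall>x\<in>mcarr (md C j). \<phi> (j - 1) (df C j x) = df D j (\<phi> j x)))"

text \<open>\<open>module.representation\<close> gives the matrix entries of the differentials.\<close>

definition strongly_linear ::
  "('a::ab_group_add \<Rightarrow> ('v, 'k::field) mpol set) \<Rightarrow>
    ('a, ('v, 'k) mpol, 'm::ab_group_add) cplx \<Rightarrow> bool"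
  where "strongly_linear Sg C \<longleftrightarrow> graded_complex Sg C \<and>
    (\<exists>B. \<forall>j. homogeneous_basis (md C j) (B j) \<and>
      (\<forall>b\<in>B j. \<forall>b'\<in>B (j - 1).
        module.representation (sc (md C (j - 1))) (B (j - 1)) (df C j b) b' \<in> linear_forms))"

definition subcomplex ::
  "('a::ab_group_add \<Rightarrow> 's::comm_ring_1 set) \<Rightarrow>
    ('a, 's, 'm::ab_group_add) cplx \<Rightarrow> ('a, 's, 'm) cplx \<Rightarrow> bool"
  where "subcomplex Sg C' C \<longleftrightarrow> graded_complex Sg C' \<and> df C' = df C \<and>
    (\<forall>j. sc (md C' j) = sc (md C j) \<and> (\<forall>a. pt (md C' j) a \<subseteq> pt (md C j) a))"

text \<open>The complement \<open>D\<close> is neither required to be graded nor to be compatible with the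
  differentials.\<close>

definition quasi_split ::
  "('a::ab_group_add \<Rightarrow> 's::comm_ring_1 set) \<Rightarrow>
    ('a, 's, 'm::ab_group_add) cplx \<Rightarrow> ('a, 's, 'm) cplx \<Rightarrow> bool"
  where "quasi_split Sg C' C \<longleftrightarrow> subcomplex Sg C' C \<and>
    (\<forall>j. \<exists>D. module.subspace (sc (md C j)) D \<and>
      mcarr (md C' j) \<inter> D = {0} \<and>
      {x + y | x y. x \<in> mcarr (md C' j) \<and> y \<in> D} = mcarr (md C j))"

definition slqs ::
  "('a::ab_group_add \<Rightarrow> ('v, 'k::field) mpol set) \<Rightarrow>
    ('a, ('v, 'k) mpol, 'm::ab_group_add) cplx \<Rightarrow> ('a, ('v, 'k) mpol, 'm) cplx \<Rightarrow> bool"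
  where "slqs Sg C F \<longleftrightarrow> strongly_linear Sg C \<and> quasi_split Sg C F"

definition maximal_slqs ::
  "('a::ab_group_add \<Rightarrow> ('v, 'k::field) mpol set) \<Rightarrow>
    ('a, ('v, 'k) mpol, 'm::ab_group_add) cplx \<Rightarrow> ('a, ('v, 'k) mpol, 'm) cplx \<Rightarrow> bool"
  where "maximal_slqs Sg C F \<longleftrightarrow> slqs Sg C F \<and>
    (\<forall>D. slqs Sg D F \<and> subcomplex Sg C D \<longrightarrow> subcomplex Sg D C)"

definition minimal_free_resolution ::
  "('a::ab_group_add \<Rightarrow> ('v, 'k::field) mpol set) \<Rightarrow>
    ('a, ('v, 'k) mpol, 'f::ab_group_add) cplx \<Rightarrow>
    ('a, ('v, 'k) mpol, 'm::ab_group_add) gmod \<Rightarrow> bool"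
  where "minimal_free_resolution Sg F M \<longleftrightarrow>
    graded_complex Sg F \<and>
    (\<forall>j. graded_free (md F j)) \<and>
    (\<forall>j<0. mcarr (md F j) = {0}) \<and>
    (\<forall>j>0. {x \<in> mcarr (md F j). df F j x = 0} = df F (j + 1) ` mcarr (md F (j + 1))) \<and>
    (\<exists>\<epsilon>. graded_hom (md F 0) M \<epsilon> \<and> \<epsilon> ` mcarr (md F 0) = mcarr M \<and>
      {x \<in> mcarr (md F 0). \<epsilon> x = 0} = df F 1 ` mcarr (md F 1)) \<and>
    (\<forall>j. df F j ` mcarr (md F j) \<subseteq>
      module.span (sc (md F (j - 1)))
        {sc (md F (j - 1)) (Var i) x | i x. x \<in> mcarr (md F (j - 1))})"


section \<open>The exterior algebra and its dual\<close>

text \<open>\<open>f :: ('v, 'k) ext\<close> is the element \<open>\<Sum>I. f I \<cdot> e\<^sub>I\<close> of \<open>E\<close>, with \<open>e\<^sub>I\<close> the product of the \<open>e\<^sub>i\<close>,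
  \<open>i \<in> I\<close>, in increasing order. The instance of \<open>(*)\<close> on functions is pointwise and is not the
  product of \<open>E\<close>, which is \<open>ext_mult\<close>.\<close>

type_synonym ('v, 'k) ext = "'v set \<Rightarrow> 'k"

definition ext_basis :: "'v set \<Rightarrow> ('v, 'k::field) ext"
  where "ext_basis I = (\<lambda>J. if J = I then 1 else 0)"

definition ext_sign :: "'v::linorder set \<Rightarrow> 'v set \<Rightarrow> 'k::field"
  where "ext_sign I J = (- 1) ^ card {(i, j). i \<in> I \<and> j \<in> J \<and> j < i}"

definition ext_mult ::
  "('v::{finite, linorder}, 'k::field) ext \<Rightarrow> ('v, 'k) ext \<Rightarrow> ('v, 'k) ext"
  where "ext_mult f g = (\<lambda>K. \<Sum>I\<in>Pow K. ext_sign I (K - I) * f I * g (K - I))"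

definition ext_gr ::
  "('v::finite \<Rightarrow> 'a::ab_group_add) \<Rightarrow> 'a \<times> int \<Rightarrow> ('v, 'k::field) ext set"
  where "ext_gr w c =
    {f. \<forall>I. f I \<noteq> 0 \<longrightarrow> c = (\<Sum>i\<in>I. (- w i, - 1))}"

text \<open>Right \<open>E\<close>-modules. \<open>ksc\<close> is the action of the ground field, which is needed to form tensor
  products over it.\<close>

record ('a, 'v, 'k, 'n) emod =
  ksc :: "'k \<Rightarrow> 'n \<Rightarrow> 'n"
  ract :: "'n \<Rightarrow> ('v, 'k) ext \<Rightarrow> 'n"
  gr :: "'a \<times> int \<Rightarrow> 'n set"

text \<open>The left action \<open>e y = (-1)\<^bsup>aux(e) aux(y)\<^esup> y e\<close> derived from a right action \<open>r\<close>, for \<open>e\<close> and \<open>y\<close>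
  of auxiliary degrees \<open>p\<close> and \<open>q\<close>.\<close>

definition lact ::
  "('n \<Rightarrow> ('v, 'k) ext \<Rightarrow> 'n) \<Rightarrow> int \<Rightarrow> int \<Rightarrow> ('v, 'k) ext \<Rightarrow> 'n::ab_group_add \<Rightarrow> 'n"
  where "lact r p q e y = (if even (p * q) then r y e else - r y e)"

definition omega_ract ::
  "(('v::{finite, linorder}, 'k::field) ext \<Rightarrow> 'k) \<Rightarrow> ('v, 'k) ext \<Rightarrow> (('v, 'k) ext \<Rightarrow> 'k)"
  where "omega_ract f e = (\<lambda>e'. f (ext_mult e e'))"

definition omega_gr ::
  "('v::finite \<Rightarrow> 'a::ab_group_add) \<Rightarrow> 'a \<times> int \<Rightarrow> (('v, 'k::field) ext \<Rightarrow> 'k) set"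
  where "omega_gr w c =
    {f. module_hom (\<lambda>c e I. c * e I) (*) f \<and>
      (\<forall>b. b \<noteq> - c \<longrightarrow> (\<forall>e\<in>ext_gr w b. f e = 0))}"

definition dual_basis :: "'v set \<Rightarrow> (('v, 'k) ext \<Rightarrow> 'k)"
  where "dual_basis I = (\<lambda>e. e I)"


section \<open>\<open>\<^bold>R(M)\<close> and \<open>K\<^sub>a(M)\<close>\<close>

text \<open>Elements of \<open>M \<otimes>\<^sub>k \<omega>\<^sub>E\<close> are uniquely \<open>\<Sum>I. g I \<otimes> e\<^sub>I\<^sup>*\<close>, with \<open>e\<^sub>I\<^sup>* = dual_basis I\<close>, and are
  represented by \<open>g :: 'v set \<Rightarrow> 'm\<close>.\<close>

definition tens_omega ::
  "('a, ('v, 'k::field) mpol, 'm) gmod \<Rightarrow> 'm \<Rightarrow> (('v, 'k) ext \<Rightarrow> 'k) \<Rightarrow> ('v set \<Rightarrow> 'm)"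
  where "tens_omega M m f = (\<lambda>I. sc M (Const (f (ext_basis I))) m)"

definition R_diff ::
  "('a, ('v::{finite, linorder}, 'k::field) mpol, 'm::ab_group_add) gmod \<Rightarrow>
    ('v set \<Rightarrow> 'm) \<Rightarrow> ('v set \<Rightarrow> 'm)"
  where "R_diff M g = (\<Sum>I\<in>UNIV. \<Sum>i\<in>UNIV.
    tens_omega M (sc M (Var i) (g I))
      (lact omega_ract (- 1) (int (card I)) (ext_basis {i}) (dual_basis I)))"

text \<open>The summand \<open>M\<^sub>a \<otimes>\<^sub>k \<omega>\<^sub>E(-a; 0)\<close> of \<open>\<^bold>R(M)\<close>, with \<open>(m \<otimes> f) e = m \<otimes> f e\<close>.\<close>

definition R_summand ::
  "('v::{finite, linorder} \<Rightarrow> 'a::ab_group_add) \<Rightarrow>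
    ('a, ('v, 'k::field) mpol, 'm::ab_group_add) gmod \<Rightarrow> 'a \<Rightarrow> ('a, 'v, 'k, 'v set \<Rightarrow> 'm) emod"
  where "R_summand w M a =
    \<lparr>ksc = (\<lambda>c g I. sc M (Const c) (g I)),
     ract = (\<lambda>g e. \<Sum>I\<in>UNIV. tens_omega M (g I) (omega_ract (dual_basis I) e)),
     gr = (\<lambda>b. module.span (\<lambda>c g I. sc M (Const c) (g I))
       {tens_omega M m f | m f. m \<in> pt M a \<and> f \<in> twist (omega_gr w) (- a, 0) b})\<rparr>"

definition K_module ::
  "('v::{finite, linorder} \<Rightarrow> 'a::ab_group_add) \<Rightarrow>
    ('a, ('v, 'k::field) mpol, 'm::ab_group_add) gmod \<Rightarrow> 'a \<Rightarrow> ('a, 'v, 'k, 'v set \<Rightarrow> 'm) emod"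
  where "K_module w M a =
    (R_summand w M a)\<lparr>gr := (\<lambda>b. {g \<in> gr (R_summand w M a) b. R_diff M g = 0})\<rparr>"


section \<open>\<open>\<^bold>L(N)\<close>\<close>

text \<open>Elements of \<open>S \<otimes>\<^sub>k N\<close> are uniquely \<open>\<Sum>\<alpha>. x\<^sup>\<alpha> \<otimes> y\<^sub>\<alpha>\<close> over the monomials \<open>x\<^sup>\<alpha>\<close>, and are represented by
  the finitely supported function \<open>\<alpha> \<mapsto> y\<^sub>\<alpha>\<close>.\<close>

definition tens_S ::
  "('a, 'v, 'k::field, 'n::ab_group_add) emod \<Rightarrow> ('v, 'k) mpol \<Rightarrow> 'n \<Rightarrow> ('v mono \<Rightarrow>\<^sub>0 'n)"
  where "tens_S N s y = (\<Sum>\<alpha>\<in>keys s. single \<alpha> (ksc N (lookup s \<alpha>) y))"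

definition tens_S_scale ::
  "('a, 'v, 'k::field, 'n::ab_group_add) emod \<Rightarrow>
    ('v, 'k) mpol \<Rightarrow> ('v mono \<Rightarrow>\<^sub>0 'n) \<Rightarrow> ('v mono \<Rightarrow>\<^sub>0 'n)"
  where "tens_S_scale N s p =
    (\<Sum>\<alpha>\<in>keys p. tens_S N (s * single \<alpha> 1) (lookup p \<alpha>))"

definition L_diff ::
  "('a, 'v::finite, 'k::field, 'n::ab_group_add) emod \<Rightarrow>
    int \<Rightarrow> ('v mono \<Rightarrow>\<^sub>0 'n) \<Rightarrow> ('v mono \<Rightarrow>\<^sub>0 'n)"
  where "L_diff N j p = (\<Sum>\<alpha>\<in>keys p. \<Sum>i\<in>UNIV.
    tens_S N (Var i * single \<alpha> 1)
      (lact (ract N) (- 1) j (ext_basis {i}) (lookup p \<alpha>)))"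

text \<open>In homological degree \<open>j\<close>: \<open>\<Oplus>\<^sub>b S(-b) \<otimes>\<^sub>k N\<^bsub>(b;j)\<^esub>\<close>.\<close>

definition L_complex ::
  "('a::ab_group_add \<Rightarrow> ('v::finite, 'k::field) mpol set) \<Rightarrow>
    ('a, 'v, 'k, 'n::ab_group_add) emod \<Rightarrow> ('a, ('v, 'k) mpol, 'v mono \<Rightarrow>\<^sub>0 'n) cplx"
  where "L_complex Sg N =
    \<lparr>md = (\<lambda>j.
       \<lparr>sc = tens_S_scale N,
        pt = (\<lambda>c. module.span (\<lambda>k. tens_S_scale N (Const k))
          {tens_S N s y | s y b. s \<in> twist Sg (- b) c \<and> y \<in> gr N (b, j)})\<rparr>),
     df = L_diff N\<rparr>"


section \<open>Compatibility of the coordinate definitions with the formulas on pure tensors\<close>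

lemma sum_apply: "(\<Sum>x\<in>A. h x) J = (\<Sum>x\<in>A. (h x J :: _ :: comm_monoid_add))"
  by (induction A rule: infinite_finite_induct) auto

lemma ext_basis_mult: "ext_mult (ext_basis I) (ext_basis J) = (if I \<inter> J = {} then (\<lambda>K. ext_sign I J * ext_basis (I \<union> J) K) else 0)"
proof
  fix K
  have "ext_mult (ext_basis I) (ext_basis J) K = (\<Sum>I'\<in>Pow K. if I' = I then ext_sign I (K-I) * (if K - I = J then 1 else 0) else 0)"
    unfolding ext_mult_def ext_basis_def by (rule sum.cong) auto
  also have "\<dots> = (if I \<subseteq> K \<and> K - I = J then ext_sign I J else 0)"
    by (subst sum.delta) auto
  also have "\<dots> = (if I \<inter> J = {} then (\<lambda>K. ext_sign I J * ext_basis (I \<union> J) K) else 0) K"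
    by (auto simp: ext_basis_def)
  finally show "ext_mult (ext_basis I) (ext_basis J) K = (if I \<inter> J = {} then (\<lambda>K. ext_sign I J * ext_basis (I \<union> J) K) else 0) K" .
qed

lemma sgn_e[simp]: "ext_sign {} J = 1" "ext_sign J {} = 1" by (simp_all add: ext_sign_def)
lemma ext_unit: "ext_mult (ext_basis {}) f = f" "ext_mult f (ext_basis {}) = f"
proof -
  show "ext_mult (ext_basis {}) f = f"
  proof
    fix K
    have "ext_mult (ext_basis {}) f K = (\<Sum>I'\<in>Pow K. if I' = {} then f K else 0)"
      unfolding ext_mult_def ext_basis_def by (rule sum.cong) (auto simp: ext_sign_def)
    also have "\<dots> = f K" by (subst sum.delta) auto
    finally show "ext_mult (ext_basis {}) f K = f K" .
  qed
  show "ext_mult f (ext_basis {}) = f"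
  proof
    fix K
    have "ext_mult f (ext_basis {}) K = (\<Sum>I'\<in>Pow K. if I' = K then f K else 0)"
      unfolding ext_mult_def ext_basis_def by (rule sum.cong) (auto)
    also have "\<dots> = f K" by (subst sum.delta) auto
    finally show "ext_mult f (ext_basis {}) K = f K" .
  qed
qed

lemma ext_sq: "ext_mult (ext_basis {i}) (ext_basis {i}) = 0"
  by (simp add: ext_basis_mult)

lemma ext_anti: "i \<noteq> j \<Longrightarrow> ext_mult (ext_basis {i}) (ext_basis {j}) = - ext_mult (ext_basis {j}) (ext_basis {i})"
proof -
  assume "i \<noteq> j"
  have *: "{(a,b). a = x \<and> b = y \<and> b < a} = (if y < x then {(x,y)} else {})" for x y :: 'a
    by auto
  show ?thesis using \<open>i \<noteq> j\<close>
    by (auto simp: ext_basis_mult ext_sign_def * fun_eq_iff insert_commute not_less)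
qed

lemma sgn_Un1: "I \<inter> J = {} \<Longrightarrow> ext_sign (I \<union> J) (K::'v::{finite,linorder} set) = ext_sign I K * (ext_sign J K :: 'k::field)"
proof -
  assume "I \<inter> J = {}"
  have "{(i, j). i \<in> I \<union> J \<and> j \<in> K \<and> j < i} = {(i, j). i \<in> I \<and> j \<in> K \<and> j < i} \<union> {(i, j). i \<in> J \<and> j \<in> K \<and> j < i}" by auto
  then show ?thesis unfolding ext_sign_def power_add[symmetric]
    using \<open>I \<inter> J = {}\<close> by (subst card_Un_disjoint[symmetric]) auto
qed
lemma sgn_Un2: "I \<inter> J = {} \<Longrightarrow> ext_sign K (I \<union> J) = ext_sign (K::'v::{finite,linorder} set) I * (ext_sign K J :: 'k::field)"
proof -
  assume "I \<inter> J = {}"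
  have "{(i, j). i \<in> K \<and> j \<in> I \<union> J \<and> j < i} = {(i, j). i \<in> K \<and> j \<in> I \<and> j < i} \<union> {(i, j). i \<in> K \<and> j \<in> J \<and> j < i}" by auto
  then show ?thesis unfolding ext_sign_def power_add[symmetric]
    using \<open>I \<inter> J = {}\<close> by (subst card_Un_disjoint[symmetric]) auto
qed

lemma ext_assoc: "ext_mult (ext_mult f g) h = ext_mult f (ext_mult g h)"
proof
  fix K :: "'a set"
  let ?T = "\<lambda>I J L. ext_sign I J * ext_sign I L * ext_sign J L * f I * g J * h L"
  have "ext_mult (ext_mult f g) h K = (\<Sum>U\<in>Pow K. \<Sum>I\<in>Pow U. ?T I (U-I) (K-U))"
    unfolding ext_mult_def
  proof (rule sum.cong[OF refl])
    fix U assume "U \<in> Pow K"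
    show "ext_sign U (K - U) * (\<Sum>I\<in>Pow U. ext_sign I (U - I) * f I * g (U - I)) * h (K - U) = (\<Sum>I\<in>Pow U. ?T I (U-I) (K-U))"
      unfolding sum_distrib_left sum_distrib_right
    proof (rule sum.cong[OF refl])
      fix I assume "I \<in> Pow U"
      then have "ext_sign U (K-U) = ext_sign I (K-U) * (ext_sign (U-I) (K-U) :: 'b)"
        using sgn_Un1[of I "U-I" "K-U"] by (simp add: Un_absorb1)
      then show "ext_sign U (K - U) * (ext_sign I (U - I) * f I * g (U - I)) * h (K - U) = ?T I (U-I) (K-U)" by simp
    qed
  qed
  also have "\<dots> = (\<Sum>(U,I)\<in>Sigma (Pow K) Pow. ?T I (U-I) (K-U))" by (simp add: sum.Sigma)
  also have "\<dots> = (\<Sum>(I,J)\<in>Sigma (Pow K) (\<lambda>I. Pow (K - I)). ?T I J (K-I-J))"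
    by (rule sum.reindex_bij_witness[where i="\<lambda>(I,J). (I \<union> J, I)" and j="\<lambda>(U,I). (I,U-I)"])
       (auto, (subgoal_tac "K - b - (a - b) = K - a", simp, blast)?)
  also have "\<dots> = (\<Sum>I\<in>Pow K. \<Sum>J\<in>Pow (K - I). ?T I J (K-I-J))" by (simp add: sum.Sigma)
  also have "\<dots> = ext_mult f (ext_mult g h) K"
    unfolding ext_mult_def
  proof (rule sum.cong[OF refl])
    fix I assume "I \<in> Pow K"
    show "(\<Sum>J\<in>Pow (K - I). ?T I J (K-I-J)) = ext_sign I (K - I) * f I * (\<Sum>J\<in>Pow (K-I). ext_sign J (K - I - J) * g J * h (K - I - J))"
      unfolding sum_distrib_left
    proof (rule sum.cong[OF refl])
      fix J assume "J \<in> Pow (K-I)"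
      then have "ext_sign I (K-I) = ext_sign I J * (ext_sign I (K-I-J) :: 'b)"
        using sgn_Un2[of J "K-I-J" I] by (simp add: Un_absorb1)
      then show "?T I J (K-I-J) = ext_sign I (K - I) * f I * (ext_sign J (K - I - J) * g J * h (K - I - J))" by simp
    qed
  qed
  finally show "ext_mult (ext_mult f g) h K = ext_mult f (ext_mult g h) K" .
qed

context fixes N :: "('a, 'v::finite, 'k::field, 'n::ab_group_add) emod"
  assumes ksc: "vector_space (ksc N)"
begin
interpretation V: vector_space "ksc N" by (rule ksc)

lemma tS_super: "finite A \<Longrightarrow> keys s \<subseteq> A \<Longrightarrow> tens_S N s y = (\<Sum>\<alpha>\<in>A. single \<alpha> (ksc N (lookup s \<alpha>) y))"
  unfolding tens_S_def by (rule sum.mono_neutral_left) (auto simp: in_keys_iff)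
lemma tS_add: "tens_S N (s+t) y = tens_S N s y + tens_S N t y"
  apply (subst (1 2 3) tS_super[of "keys s \<union> keys t"])
  by (auto simp: sum.distrib[symmetric] lookup_add V.scale_left_distrib single_add dest: subsetD[OF Poly_Mapping.keys_add])
lemma tS_sum: "tens_S N (\<Sum>a\<in>A. s a) y = (\<Sum>a\<in>A. tens_S N (s a) y)"
  by (induction A rule: infinite_finite_induct) (auto simp: tS_add, auto simp: tens_S_def)
lemma tS_lookup: "lookup (tens_S N s y) \<alpha> = ksc N (lookup s \<alpha>) y"
  unfolding tens_S_def lookup_sum lookup_single
  by (auto simp: when_def sum.delta' in_keys_iff)

lemma lookup_C: "lookup (single 0 c * p) \<alpha> = c * lookup (p::('v,'k) mpol) \<alpha>"
proof -
  have "p = (\<Sum>\<beta>\<in>keys p. single \<beta> (lookup p \<beta>))"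
    by (rule poly_mapping_eqI) (auto simp: lookup_sum lookup_single when_def sum.delta' in_keys_iff)
  then have "lookup (single 0 c * p) \<alpha> = lookup (\<Sum>\<beta>\<in>keys p. single \<beta> (c * lookup p \<beta>)) \<alpha>"
    by (metis (no_types, lifting) mult_single add_0 sum.cong sum_distrib_left)
  also have "\<dots> = c * lookup p \<alpha>" 
    by (auto simp: lookup_sum lookup_single when_def sum.delta' in_keys_iff)
  finally show ?thesis .
qed
lemma tS_scale: "tens_S N (s * single \<alpha> 1) (ksc N c y) = tens_S N (s * single \<alpha> c) y"
proof (rule poly_mapping_eqI)
  fix b
  have "s * single \<alpha> c = single 0 c * (s * single \<alpha> 1)"
    by (subst mult.left_commute) (simp add: mult_single)
  then show "lookup (tens_S N (s * single \<alpha> 1) (ksc N c y)) b = lookup (tens_S N (s * single \<alpha> c) y) b"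
    by (simp only: tS_lookup lookup_C V.scale_scale mult.commute[of c])
qed
lemma tS_0: "tens_S N s 0 = 0" by (simp add: tens_S_def)
lemma keys_tS: "keys (tens_S N s y) \<subseteq> keys s"
  by (auto simp: in_keys_iff tS_lookup)
lemma sum_single: "(\<Sum>\<beta>\<in>keys p. single \<beta> (lookup p \<beta>)) = (p :: ('v,'k) mpol)"
    by (rule poly_mapping_eqI) (auto simp: lookup_sum lookup_single when_def sum.delta' in_keys_iff)

lemma tS_comb: assumes g: "\<And>c y. g (ksc N c y) = ksc N c (g y)"
  shows "(\<Sum>\<alpha>\<in>keys (tens_S N s y). tens_S N (t * single \<alpha> 1) (g (lookup (tens_S N s y) \<alpha>))) = tens_S N (t * s) (g y)"
proof -
  have g0: "g 0 = 0" using g[of 0 0] by simp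
  have "(\<Sum>\<alpha>\<in>keys (tens_S N s y). tens_S N (t * single \<alpha> 1) (g (lookup (tens_S N s y) \<alpha>))) =
    (\<Sum>\<alpha>\<in>keys s. tens_S N (t * single \<alpha> 1) (g (lookup (tens_S N s y) \<alpha>)))"
    by (rule sum.mono_neutral_left) (use keys_tS in \<open>auto simp: in_keys_iff g0 tS_0\<close>)
  also have "\<dots> = (\<Sum>\<alpha>\<in>keys s. tens_S N (t * single \<alpha> (lookup s \<alpha>)) (g y))"
    by (simp add: tS_lookup g tS_scale)
  also have "\<dots> = tens_S N (t * s) (g y)"
    by (simp add: tS_sum[symmetric] sum_distrib_left[symmetric] sum_single)
  finally show ?thesis .
qed

lemma tens_S_scale_tens: "tens_S_scale N t (tens_S N s y) = tens_S N (t * s) y"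
  unfolding tens_S_scale_def using tS_comb[of "\<lambda>x. x"] by simp

lemma L_diff_tens: assumes r: "\<And>c y e. ract N (ksc N c y) e = ksc N c (ract N y e)"
  shows "L_diff N j (tens_S N s y) = (\<Sum>i\<in>UNIV. tens_S N (Var i * s) (lact (ract N) (-1) j (ext_basis {i}) y))"
  unfolding L_diff_def
  by (subst sum.swap, rule sum.cong[OF refl], rule tS_comb) (auto simp: lact_def r)
end

lemma R_diff_tens:
  fixes M :: "('a::ab_group_add, ('v::{finite,linorder}, 'k::field) mpol, 'm::ab_group_add) gmod"
  assumes M: "module (sc M)" and f: "f \<in> omega_gr w (b, j)"
  shows "R_diff M (tens_omega M m f) = (\<Sum>i\<in>UNIV. tens_omega M (sc M (Var i) m) (lact omega_ract (- 1) j (ext_basis {i}) f))"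
proof -
  interpret module "sc M" by fact
  from f have lin: "module_hom (\<lambda>c e I. c * e I) (*) f" by (simp add: omega_gr_def)
  interpret f: module_hom "\<lambda>c (e::('v,'k) ext) I. c * e I" "(*)" f by (rule lin)
  have C: "Const (a + b) = Const a + Const b" "Const (a * b) = Const a * Const b" "Const 0 = 0"  "Const (-a) = - Const a" for a b :: 'k
    by (simp_all add: Const_def single_add mult_single single_uminus)
  have Csum: "Const (sum h A) = (\<Sum>x\<in>A. Const (h x))" for h :: "'v set \<Rightarrow> 'k" and A
    by (induction A rule: infinite_finite_induct) (auto simp: C)
  have exp: "f e = (\<Sum>I\<in>UNIV. f (ext_basis I) * e I)" for e
  proof -
    have "e = (\<Sum>I\<in>UNIV. (\<lambda>J. e I * ext_basis I J))"
      by (auto simp: fun_eq_iff ext_basis_def sum_apply if_distrib cong: if_cong)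
    then have "f e = (\<Sum>I\<in>UNIV. f (\<lambda>J. e I * ext_basis I J))" by (metis f.sum)
    then show ?thesis by (simp add: f.scale mult.commute)
  qed
  have z: "f (ext_basis I) = 0" if "int (card I) \<noteq> j" for I
  proof -
    have s: "(\<Sum>i\<in>I. (- w i, - 1::int)) = (\<Sum>i\<in>I. - w i, - int (card I))" 
      by (induction I rule: infinite_finite_induct) (auto simp: zero_prod_def)
    have "ext_basis I \<in> ext_gr w (\<Sum>i\<in>I. - w i, - int (card I))"
      by (auto simp: ext_gr_def ext_basis_def s)
    then show ?thesis using f that unfolding omega_gr_def by (force simp: uminus_prod_def)
  qed
  have "R_diff M (tens_omega M m f) J = (\<Sum>i\<in>UNIV. tens_omega M (sc M (Var i) m) (lact omega_ract (- 1) j (ext_basis {i}) f)) J" for J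
  proof -
    have "R_diff M (tens_omega M m f) J = (\<Sum>i\<in>UNIV. \<Sum>I\<in>UNIV. sc M (Const (lact omega_ract (- 1) (int (card I)) (ext_basis {i}) (dual_basis I) (ext_basis J))) (sc M (Var i) (sc M (Const (f (ext_basis I))) m)))"
      unfolding R_diff_def by (subst sum.swap) (simp add: sum_apply tens_omega_def)
    also have "\<dots> = (\<Sum>i\<in>UNIV. \<Sum>I\<in>UNIV. sc M (Const (f (ext_basis I) * lact omega_ract (- 1) j (ext_basis {i}) (dual_basis I) (ext_basis J))) (sc M (Var i) m))"
      by (intro sum.cong refl, case_tac "int (card xa) = j") (auto simp: z C ac_simps)
    also have "\<dots> = (\<Sum>i\<in>UNIV. sc M (Const (\<Sum>I\<in>UNIV. f (ext_basis I) * lact omega_ract (- 1) j (ext_basis {i}) (dual_basis I) (ext_basis J))) (sc M (Var i) m))"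
      by (simp add: Csum scale_sum_left sum_distrib_right)
    also have "\<dots> = (\<Sum>i\<in>UNIV. sc M (Const (lact omega_ract (- 1) j (ext_basis {i}) f (ext_basis J))) (sc M (Var i) m))"
      by (rule sum.cong[OF refl]) (auto simp: lact_def omega_ract_def dual_basis_def exp[of "ext_mult _ _"] sum_negf)
    finally show ?thesis by (simp add: sum_apply tens_omega_def)
  qed
  then show ?thesis by blast
qed

end

theory Submission
  imports Defs
begin

text \<open>
  Write \<open>K\<close> for \<open>K\<^sub>d(M)\<close> and \<open>\<mm>\<close> for the ideal of the variables. The map \<open>y \<mapsto> (e\<^sub>i y)\<^sub>i\<close> identifies
  \<open>K\<^bsub>j+1\<^esub>\<close> with the families \<open>(z\<^sub>i)\<close> in \<open>K\<^sub>j\<close> for which \<open>\<Sum> x\<^sub>i \<otimes> z\<^sub>i\<close> is a cycle of \<open>\<^bold>L(K)\<close> (for \<open>j = 0\<close>: has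
  image \<open>0\<close> in \<open>M\<close>), so a chain map \<open>\<phi> : \<^bold>L(K) \<rightarrow> F\<close> over the identity of \<open>M\<^sub>d\<close> can be built one degree at a
  time. It is injective modulo \<open>\<mm>\<close>: if \<open>\<phi>(y) \<in> \<mm>F\<close>, then \<open>\<partial>\<phi>(y) = \<Sum> x\<^sub>i \<phi>(e\<^sub>i y)\<close> lies in \<open>\<mm>\<^sup>2F\<close> by minimality,
  hence every \<open>\<phi>(e\<^sub>i y)\<close> lies in \<open>\<mm>F\<close>, and inductively \<open>e\<^sub>i y = 0\<close> for all \<open>i\<close>, so \<open>y = 0\<close>. By the graded
  Nakayama lemma \<open>\<phi>\<close> is a split injection.

  Let \<open>C\<close> be a strongly linear, quasi-split subcomplex. The differential of a basis element \<open>c\<close> of \<open>C\<close> is a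
  linear cycle in \<open>\<phi>(\<^bold>L(K))\<close>, hence equals \<open>\<phi>(\<partial>y)\<close> for a unique \<open>y \<in> K\<close>, and \<open>\<phi>(y) = c\<close> is an admissible
  choice. So \<open>C\<close> is contained in the image of a suitable \<open>\<phi>\<close>. If the images of two such maps are nested, then
  the maps agree modulo \<open>\<mm>\<close> by the same argument as above, and the images coincide by Nakayama. Therefore these
  images are exactly the maximal strongly linear, quasi-split subcomplexes.
\<close>

section \<open>Gradings\<close>

text \<open>The map \<phi> is not canonical: every homological degree involves a choice of
  homogeneous lifts, and different choices may have different images in F. Prescribing the values on
  a set \<open>W\<close> is what steers the image, and uniqueness of the maximal subcomplex is
  uniqueness up to isomorphism. M need not be finitely generated, so bases may be infinite. What
  makes the Nakayama arguments terminate is a lower bound: \<theta> is at least \<theta>(d) on all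
  degrees of basis elements of F and on all degrees in which K is nonzero. Computations modulo \<mm>
  and \<mm>^2 are done on coefficients with respect to a fixed homogeneous basis of each term of F:
  the constant coefficients decide membership in \<mm>F, those of total degree at most 1 decide
  membership in \<mm>^2F. The comparison with F uses K only through the properties collected in the
  locale \<open>strand\<close>; the sign computations in the exterior algebra are confined to their
  verification.\<close>

lemma carrE:
  assumes "x \<in> carr G"
  obtains A h where "finite A" "\<And>a. h a \<in> G a" "\<And>a. a \<notin> A \<Longrightarrow> h a = 0" "x = (\<Sum>a\<in>A. h a)"
proof -
  obtain f where "x = (\<Sum>a\<in>keys f. lookup f a)" "\<forall>a. lookup f a \<in> G a"
    using assms unfolding carr_def by blast
  then show ?thesis using that[of "keys f" "lookup f"] by (auto simp: in_keys_iff)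
qed

lemma sum_single_family:
  fixes h :: "'a \<Rightarrow> 'm::ab_group_add"
  assumes "finite A"
  defines "f \<equiv> (\<Sum>a\<in>A. single a (h a))"
  shows "lookup f a = (if a \<in> A then h a else 0)" "(\<Sum>a\<in>keys f. lookup f a) = (\<Sum>a\<in>A. h a)"
proof -
  show l: "lookup f a = (if a \<in> A then h a else 0)" for a
    using assms(1) unfolding f_def by (auto simp: lookup_sum lookup_single when_def sum.delta)
  have "keys f \<subseteq> A" by (auto simp: in_keys_iff l split: if_splits)
  then have "(\<Sum>a\<in>keys f. lookup f a) = (\<Sum>a\<in>A. lookup f a)"
    by (intro sum.mono_neutral_left assms) (auto simp: in_keys_iff)
  also have "\<dots> = (\<Sum>a\<in>A. h a)" by (simp add: l)
  finally show "(\<Sum>a\<in>keys f. lookup f a) = (\<Sum>a\<in>A. h a)" .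
qed

lemma carr_sumI:
  assumes "finite A" "\<And>a. 0 \<in> G a" "\<And>a. a \<in> A \<Longrightarrow> h a \<in> G a"
  shows "(\<Sum>a\<in>A. h a) \<in> carr G"
  unfolding carr_def using assms sum_single_family[OF assms(1), of h]
  by (intro CollectI exI[of _ "\<Sum>a\<in>A. single a (h a)"]) auto

lemma in_carrI:
  assumes "\<And>a. 0 \<in> G a" "x \<in> G a"
  shows "x \<in> carr G"
  using carr_sumI[of "{a}" G "\<lambda>_. x"] assms by auto

lemma carr_mono:
  assumes "\<And>a. G a \<subseteq> H a"
  shows "carr G \<subseteq> carr H"
  using assms unfolding carr_def by blast

lemma carr_add:
  assumes "\<And>a. 0 \<in> G a" "\<And>a x y. x \<in> G a \<Longrightarrow> y \<in> G a \<Longrightarrow> x + y \<in> G a"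
    and "x \<in> carr G" "y \<in> carr G"
  shows "x + y \<in> carr G"
proof -
  obtain A h where A: "finite A" "\<And>a. h a \<in> G a" "\<And>a. a \<notin> A \<Longrightarrow> h a = 0" "x = (\<Sum>a\<in>A. h a)"
    using carrE[OF assms(3)] by metis
  obtain B k where B: "finite B" "\<And>a. k a \<in> G a" "\<And>a. a \<notin> B \<Longrightarrow> k a = 0" "y = (\<Sum>a\<in>B. k a)"
    using carrE[OF assms(4)] by metis
  have "x = (\<Sum>a\<in>A \<union> B. h a)" "y = (\<Sum>a\<in>A \<union> B. k a)"
    unfolding A(4) B(4) using A B by (auto intro!: sum.mono_neutral_left)
  then have "x + y = (\<Sum>a\<in>A \<union> B. h a + k a)" by (simp add: sum.distrib)
  then show ?thesis using A B assms by (auto intro!: carr_sumI)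
qed

lemma carr_sum:
  assumes "\<And>a. 0 \<in> G a" "\<And>a x y. x \<in> G a \<Longrightarrow> y \<in> G a \<Longrightarrow> x + y \<in> G a"
    and "\<And>x. x \<in> A \<Longrightarrow> f x \<in> carr G"
  shows "(\<Sum>x\<in>A. f x) \<in> carr G"
proof (use assms(3) in \<open>induction A rule: infinite_finite_induct\<close>)
  case (insert x F)
  then show ?case by (auto intro!: carr_add assms(1,2))
qed (auto intro: in_carrI assms(1))

lemma carr_map:
  assumes "\<And>a. 0 \<in> H a" "\<And>a x y. x \<in> H a \<Longrightarrow> y \<in> H a \<Longrightarrow> x + y \<in> H a"
    and "x \<in> carr G" "f 0 = 0"
    and "\<And>A h. finite A \<Longrightarrow> (\<And>a. h a \<in> G a) \<Longrightarrow> f (\<Sum>a\<in>A. h a) = (\<Sum>a\<in>A. f (h a))"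
    and "\<And>a x. x \<in> G a \<Longrightarrow> f x \<in> carr H"
  shows "f x \<in> carr H"
proof -
  obtain A h where A: "finite A" "\<And>a. h a \<in> G a" "\<And>a. a \<notin> A \<Longrightarrow> h a = 0" "x = (\<Sum>a\<in>A. h a)"
    using carrE[OF assms(3)] by metis
  show ?thesis unfolding A(4) assms(5)[OF A(1,2)]
    by (rule carr_sum) (use assms(1,2,6) A(2) in blast)+
qed

locale grading =
  fixes G :: "'a \<Rightarrow> 'm::ab_group_add set"
  assumes is_grading: "is_grading G"
begin

lemma zero [simp, intro]: "0 \<in> G a"
  using is_grading by (auto simp: is_grading_def)

lemma add [intro]: "x \<in> G a \<Longrightarrow> y \<in> G a \<Longrightarrow> x + y \<in> G a"
  using is_grading by (auto simp: is_grading_def)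

lemma neg [intro]: "x \<in> G a \<Longrightarrow> - x \<in> G a"
  using is_grading by (auto simp: is_grading_def)

lemma diff [intro]: "x \<in> G a \<Longrightarrow> y \<in> G a \<Longrightarrow> x - y \<in> G a"
  using add[of x a "- y"] neg by auto

lemma sum [intro]: "(\<And>x. x \<in> A \<Longrightarrow> f x \<in> G a) \<Longrightarrow> (\<Sum>x\<in>A. f x) \<in> G a"
  by (induction A rule: infinite_finite_induct) auto

lemma carrI: "x \<in> G a \<Longrightarrow> x \<in> carr G"
  by (rule in_carrI) auto

lemma carr_zero [simp]: "0 \<in> carr G"
  using carrI zero by blast

lemma carr_add: "x \<in> carr G \<Longrightarrow> y \<in> carr G \<Longrightarrow> x + y \<in> carr G"
  by (rule carr_add) auto

lemma carr_sum: "(\<And>x. x \<in> A \<Longrightarrow> f x \<in> carr G) \<Longrightarrow> (\<Sum>x\<in>A. f x) \<in> carr G"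
  by (rule carr_sum) auto

lemma carr_neg: "x \<in> carr G \<Longrightarrow> - x \<in> carr G"
  by (rule carr_map[where G = G and H = G and f = uminus]) (auto simp: sum_negf intro: carrI)

lemma carr_diff: "x \<in> carr G \<Longrightarrow> y \<in> carr G \<Longrightarrow> x - y \<in> carr G"
  using carr_add[of x "- y"] carr_neg by auto

lemma direct:
  assumes "finite A" "\<And>a. a \<in> A \<Longrightarrow> h a \<in> G a" "(\<Sum>a\<in>A. h a) = 0" "a \<in> A"
  shows "h a = 0"
proof -
  let ?f = "\<Sum>a\<in>A. single a (h a)"
  have "\<forall>a. lookup ?f a \<in> G a" using assms sum_single_family[OF assms(1), of h] by auto
  then have "?f = 0"
    using is_grading assms(3) sum_single_family(2)[OF assms(1), of h] unfolding is_grading_def by metis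
  then show ?thesis using sum_single_family(1)[OF assms(1), of h a] assms(4) by auto
qed

lemma disjoint: "x \<in> G a \<Longrightarrow> x \<in> G b \<Longrightarrow> a \<noteq> b \<Longrightarrow> x = 0"
  using direct[of "{a, b}" "\<lambda>c. if c = a then x else - x" a] neg by fastforce

end

text \<open>Directness of the target is what counts: the degree-\<open>b\<close> part of any
  decomposition of \<open>x\<close> already maps to \<open>f x\<close>. The family \<open>G\<close>
  may be a family of spans whose sum is not yet known to be direct. The main use is to replace
  preimages by homogeneous ones.\<close>

lemma graded_component:
  assumes "grading H" "\<And>a. 0 \<in> G a"
    and "\<And>x y. x \<in> carr G \<Longrightarrow> y \<in> carr G \<Longrightarrow> f (x + y) = f x + f y"
    and "\<And>a x y. x \<in> G a \<Longrightarrow> y \<in> G a \<Longrightarrow> x + y \<in> G a"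
    and "\<And>a x. x \<in> G a \<Longrightarrow> f x \<in> H a"
    and "x \<in> carr G" "f x \<in> H b"
  obtains x' where "x' \<in> G b" "f x' = f x"
proof -
  interpret H: grading H by fact
  have c0: "0 \<in> carr G" using assms(2) in_carrI by metis
  have f0: "f 0 = 0" using assms(3)[OF c0 c0] by simp
  obtain A h where A: "finite A" "\<And>a. h a \<in> G a" "\<And>a. a \<notin> A \<Longrightarrow> h a = 0" "x = (\<Sum>a\<in>A. h a)"
    using carrE[OF assms(6)] by metis
  have fs: "f (\<Sum>a\<in>C. h a) = (\<Sum>a\<in>C. f (h a))" if "finite C" for C
    using that
  proof (induction C rule: finite_induct)
    case (insert a C)
    then show ?case using assms(2) A by (simp add: assms(3) carr_sumI in_carrI[of G, OF assms(2) A(2)])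
  qed (simp add: f0)
  \<comment> \<open>Subtracting \<open>f x\<close> in degree \<open>b\<close> turns the
    decomposition of \<open>f x\<close> into a vanishing sum of homogeneous elements of
    \<open>H\<close>, so each summand is zero.\<close>
  let ?k = "\<lambda>a. if a = b then f (h b) - f x else f (h a)"
  have x: "x = (\<Sum>a\<in>insert b A. h a)"
    unfolding A(4) using A by (intro sum.mono_neutral_left) auto
  have "(\<Sum>a\<in>insert b A. ?k a) = f (h b) - f x + (\<Sum>a\<in>A - {b}. f (h a))"
    using A(1) by (subst sum.insert_remove) (auto intro: sum.cong)
  also have "\<dots> = (\<Sum>a\<in>insert b A. f (h a)) - f x"
    using A(1) by (subst sum.insert_remove) auto
  also have "\<dots> = 0" using fs[of "insert b A"] A(1) x by simp
  finally have "?k b = 0"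
    by (intro H.direct[of "insert b A" ?k]) (use A assms in auto)
  then show ?thesis using that[of "h b"] A by simp
qed

lemma graded_preimage:
  assumes "grading H" "grading G"
    and "\<And>x y. x \<in> carr G \<Longrightarrow> y \<in> carr G \<Longrightarrow> f (x + y) = f x + f y"
    and "\<And>a x. x \<in> G a \<Longrightarrow> f x \<in> H a"
    and "\<And>x. x \<in> carr G \<Longrightarrow> f x = 0 \<Longrightarrow> x = 0"
    and "x \<in> carr G" "f x \<in> H b"
  shows "x \<in> G b"
proof -
  interpret G: grading G by fact
  obtain x' where x': "x' \<in> G b" "f x' = f x"
    by (rule graded_component[where G = G and H = H and f = f and x = x and b = b]) (use assms in auto)
  have d: "x - x' \<in> carr G" using assms(6) G.carrI[OF x'(1)] by (rule G.carr_diff)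
  have "f ((x - x') + x') = f (x - x') + f x'"
    using d G.carrI[OF x'(1)] by (rule assms(3))
  then have "f (x - x') = 0" using x' by simp
  with d have "x - x' = 0" by (rule assms(5))
  then show ?thesis using x' by simp
qed

text \<open>The case \<open>f = id\<close>. This is how homogeneous components are determined below:
  an explicit family \<open>G\<close> inside the grading \<open>H\<close> is shown to be closed
  under addition and to decompose \<open>x\<close>, and directness of \<open>H\<close> then forces a
  homogeneous \<open>x\<close> into its own member of \<open>G\<close>.\<close>

lemma graded_refine:
  assumes "grading H" and sub: "\<And>a. G a \<subseteq> H a" and zero: "\<And>a. 0 \<in> G a"
    and add: "\<And>a x y. x \<in> G a \<Longrightarrow> y \<in> G a \<Longrightarrow> x + y \<in> G a"
    and x: "x \<in> carr G" "x \<in> H b"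
  shows "x \<in> G b"
proof -
  obtain x' where "x' \<in> G b" "id x' = id x"
  proof (rule graded_component[where G = G and H = H and f = id and x = x and b = b])
    show "x + y \<in> G a" if "x \<in> G a" "y \<in> G a" for a x y using that by (rule add)
    show "id x \<in> H a" if "x \<in> G a" for a x using that sub by auto
  qed (use x zero assms(1) in simp_all)
  then show ?thesis by simp
qed

section \<open>Positively graded polynomial rings\<close>

lemma poly_expand: "(\<Sum>\<alpha>\<in>keys p. single \<alpha> (lookup p \<alpha>)) = p"
  by (rule poly_mapping_eqI) (auto simp: lookup_sum lookup_single when_def sum.delta' in_keys_iff)

lemma sum_keys_super:
  assumes "finite A" "keys p \<subseteq> A" "\<And>\<alpha>. h \<alpha> 0 = 0"
  shows "(\<Sum>\<alpha>\<in>keys p. h \<alpha> (lookup p \<alpha>)) = (\<Sum>\<alpha>\<in>A. h \<alpha> (lookup p \<alpha>))"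
  using assms by (intro sum.mono_neutral_left) (auto simp: in_keys_iff)

lemma sum_keys_add:
  assumes "\<And>\<alpha>. h \<alpha> 0 = 0" "\<And>\<alpha> x y. h \<alpha> (x + y) = h \<alpha> x + h \<alpha> y"
  shows "(\<Sum>\<alpha>\<in>keys (p + q). h \<alpha> (lookup (p + q) \<alpha>)) =
    (\<Sum>\<alpha>\<in>keys p. h \<alpha> (lookup p \<alpha>)) + (\<Sum>\<alpha>\<in>keys q. h \<alpha> (lookup q \<alpha>))"
proof -
  let ?A = "keys p \<union> keys q"
  have k: "keys (p + q) \<subseteq> ?A" "keys p \<subseteq> ?A" "keys q \<subseteq> ?A" "finite ?A"
    using Poly_Mapping.keys_add[of p q] by auto
  show ?thesis
    unfolding k(1-3)[THEN sum_keys_super[OF k(4), where h = h, OF _ assms(1)]]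
    by (simp add: lookup_add assms(2) sum.distrib)
qed

lemma lookup_single_mult:
  fixes p :: "('v \<Rightarrow>\<^sub>0 nat) \<Rightarrow>\<^sub>0 'k::field"
  shows "lookup (single \<alpha> c * p) \<gamma> = (\<Sum>\<beta>\<in>keys p. if \<alpha> + \<beta> = \<gamma> then c * lookup p \<beta> else 0)"
proof -
  have "single \<alpha> c * p = (\<Sum>\<beta>\<in>keys p. single (\<alpha> + \<beta>) (c * lookup p \<beta>))"
    by (subst poly_expand[of p, symmetric]) (simp add: sum_distrib_left mult_single)
  then show ?thesis by (simp add: lookup_sum lookup_single when_def)
qed

lemma lookup_single_mult_plus [simp]:
  fixes p :: "('v \<Rightarrow>\<^sub>0 nat) \<Rightarrow>\<^sub>0 'k::field"
  shows "lookup (single \<alpha> c * p) (\<alpha> + \<gamma>) = c * lookup p \<gamma>"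
  by (auto simp: lookup_single_mult sum.delta in_keys_iff)

lemma lookup_single_mult_0 [simp]:
  fixes p :: "('v \<Rightarrow>\<^sub>0 nat) \<Rightarrow>\<^sub>0 'k::field"
  shows "lookup (single 0 c * p) \<gamma> = c * lookup p \<gamma>"
  using lookup_single_mult_plus[of 0 c p \<gamma>] by simp

lemma lookup_mult_nonzeroE:
  fixes p q :: "('v \<Rightarrow>\<^sub>0 nat) \<Rightarrow>\<^sub>0 'k::field"
  assumes "lookup (p * q) \<gamma> \<noteq> 0"
  obtains \<alpha> \<beta> where "\<gamma> = \<alpha> + \<beta>" "lookup p \<alpha> \<noteq> 0" "lookup q \<beta> \<noteq> 0"
  using assms keys_mult[of p q] by (fastforce simp: in_keys_iff[symmetric])

definition tdeg :: "('v::finite \<Rightarrow>\<^sub>0 nat) \<Rightarrow> nat"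
  where "tdeg \<alpha> = (\<Sum>i\<in>UNIV. lookup \<alpha> i)"

lemma tdeg_plus [simp]: "tdeg (\<alpha> + \<beta>) = tdeg \<alpha> + tdeg \<beta>"
  by (simp add: tdeg_def lookup_add sum.distrib)

lemma tdeg_zero_iff [simp]: "tdeg \<alpha> = 0 \<longleftrightarrow> \<alpha> = 0"
  by (auto simp: tdeg_def intro: poly_mapping_eqI)

lemma tdeg_0 [simp]: "tdeg 0 = 0"
  by simp

lemma tdeg_single [simp]: "tdeg (single i n) = n"
  by (simp add: tdeg_def lookup_single when_def)

lemma mono_cases:
  fixes \<alpha> :: "'v \<Rightarrow>\<^sub>0 nat"
  assumes "\<alpha> \<noteq> 0"
  obtains i \<beta> where "\<alpha> = single i 1 + \<beta>"
proof -
  obtain i where "lookup \<alpha> i \<noteq> 0" using assms by (metis lookup_zero poly_mapping_eqI)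
  then have "\<alpha> = single i 1 + (\<alpha> - single i 1)"
    by (intro poly_mapping_eqI) (auto simp: lookup_add lookup_minus lookup_single when_def)
  then show ?thesis using that by blast
qed

text \<open>The degree of a monomial. The inner sum is a natural multiple of \<open>w i\<close>, as
  the grading group is just an abelian group.\<close>

definition wt :: "('v::finite \<Rightarrow> 'a::ab_group_add) \<Rightarrow> ('v \<Rightarrow>\<^sub>0 nat) \<Rightarrow> 'a"
  where "wt w \<alpha> = (\<Sum>i\<in>UNIV. \<Sum>k<lookup \<alpha> i. w i)"

lemma sum_const_plus: "(\<Sum>k<m + n. c) = (\<Sum>k<m. c) + (\<Sum>k<n. c :: 'a::ab_group_add)" for m n :: nat
  by (induction n) (auto simp: algebra_simps)

lemma wt_plus [simp]: "wt w (\<alpha> + \<beta>) = wt w \<alpha> + wt w \<beta>"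
  by (simp add: wt_def lookup_add sum_const_plus sum.distrib)

lemma wt_0 [simp]: "wt w 0 = 0"
  by (simp add: wt_def)

lemma wt_single [simp]: "wt w (single i (Suc 0)) = w i"
proof -
  have "wt w (single i (Suc 0)) = (\<Sum>j\<in>UNIV. if i = j then w i else 0)"
    unfolding wt_def by (rule sum.cong) (auto simp: lookup_single when_def)
  then show ?thesis by simp
qed

lemma Const_simps [simp]:
  "Const 0 = 0" "Const 1 = 1" "Const (a + b) = Const a + Const b" "Const (a * b) = Const a * Const b"
  "Const (- a) = - Const a" "Const (a - b) = Const a - Const b"
  by (simp_all add: Const_def single_add mult_single single_uminus single_diff)

lemma lookup_Const_mult [simp]: "lookup (Const c * p) \<alpha> = c * lookup (p :: ('v, 'k::field) mpol) \<alpha>"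
  by (simp add: Const_def)

lemma Var_mult_single: "Var i * single \<alpha> c = single (single i (Suc 0) + \<alpha>) c"
  by (simp add: Var_def mult_single)

lemma lookup_Var_mult_single: "lookup (Var i * single \<alpha> c :: ('v, 'k::field) mpol) \<beta> = (if \<beta> = single i 1 + \<alpha> then c else 0)"
  by (simp add: Var_mult_single lookup_single when_def)

lemma single_plus_eq: "single i 1 = single (l :: 'v::finite) (1::nat) + \<alpha> \<longleftrightarrow> l = i \<and> \<alpha> = 0"
proof
  assume *: "single i 1 = single l 1 + \<alpha>"
  then have "tdeg (single i (1::nat)) = tdeg (single l 1 + \<alpha>)" by (rule arg_cong)
  then have "\<alpha> = 0" by simp
  with * have "lookup (single i (1::nat)) l = lookup (single l 1) l" by simp
  then show "l = i \<and> \<alpha> = 0" using \<open>\<alpha> = 0\<close> by (auto simp: lookup_single when_def split: if_splits)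
qed auto

lemma linear_forms_cases:
  assumes "s \<in> (linear_forms :: ('v::finite, 'k::field) mpol set)"
  obtains l where "s = (\<Sum>i\<in>UNIV. Const (l i) * Var i)"
proof -
  interpret module "\<lambda>c (s :: ('v, 'k) mpol). Const c * s"
    by unfold_locales (auto simp: algebra_simps)
  have "finite (range (Var :: 'v \<Rightarrow> ('v, 'k) mpol))" by simp
  have "\<exists>l. s = (\<Sum>i\<in>UNIV. Const (l i) * Var i)"
    using assms unfolding linear_forms_def
  proof (induction rule: span_induct_alt)
    case base
    show ?case by (rule exI[of _ "\<lambda>_. 0"]) simp
  next
    case (step c x y)
    then obtain i l where "x = Var i" "y = (\<Sum>i\<in>UNIV. Const (l i) * Var i)" by auto
    moreover have "(\<Sum>j\<in>UNIV. Const (if i = j then c else 0) * Var j) = Const c * (Var i :: ('v,'k) mpol)"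
      by (simp add: if_distrib if_distribR cong: if_cong)
    ultimately show ?case
      by (intro exI[of _ "\<lambda>j. (if i = j then c else 0) + l j"]) (simp only: Const_simps distrib_right sum.distrib)
  qed
  then show ?thesis using that by blast
qed

lemma linear_formsI: "(\<Sum>i\<in>UNIV. Const (l i) * Var i) \<in> (linear_forms :: ('v::finite, 'k::field) mpol set)"
proof -
  interpret module "\<lambda>c (s :: ('v, 'k) mpol). Const c * s"
    by unfold_locales (auto simp: algebra_simps)
  show ?thesis unfolding linear_forms_def by (intro span_sum span_scale span_base) auto
qed

locale posgr =
  fixes Sg :: "'a::ab_group_add \<Rightarrow> ('v::finite, 'k::field) mpol set"
    and w :: "'v \<Rightarrow> 'a" and \<theta> :: "'a \<Rightarrow> int"
  assumes graded_ring: "graded_ring Sg"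
    and Var_in: "Var i \<in> Sg (w i)"
    and Sg_0: "Sg 0 = range Const"
    and additive_\<theta>: "additive \<theta>"
    and \<theta>_pos: "\<theta> (w i) > 0"
begin

sublocale S: grading Sg
  using graded_ring by unfold_locales (auto simp: graded_ring_def)

lemma \<theta>_simps [simp]: "\<theta> (a + b) = \<theta> a + \<theta> b" "\<theta> 0 = 0" "\<theta> (- a) = - \<theta> a" "\<theta> (a - b) = \<theta> a - \<theta> b"
  using additive_\<theta> by (simp_all add: additive.add additive.zero additive.minus additive.diff)

lemma Sg_mult: "s \<in> Sg a \<Longrightarrow> t \<in> Sg b \<Longrightarrow> s * t \<in> Sg (a + b)"
  using graded_ring by (auto simp: graded_ring_def)

lemma Const_in: "Const c \<in> Sg 0"
  by (simp add: Sg_0)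

lemma single_in: "single \<alpha> c \<in> Sg (wt w \<alpha>)"
proof (induction "tdeg \<alpha>" arbitrary: \<alpha>)
  case 0
  then show ?case using Const_in[of c] by (simp add: Const_def)
next
  case (Suc n)
  then have "\<alpha> \<noteq> 0" by auto
  then obtain i \<beta> where \<alpha>: "\<alpha> = single i 1 + \<beta>" using mono_cases by blast
  then have "n = tdeg \<beta>" using Suc(2) by simp
  then have "single \<beta> c \<in> Sg (wt w \<beta>)" by (rule Suc(1))
  then show ?case using Sg_mult[OF Var_in] by (simp add: \<alpha> Var_mult_single[symmetric])
qed

text \<open>Monomials are homogeneous because the variables and constants are, and they span S.
  Hence the abstractly given grading has no freedom left and is the monomial grading by
  \<open>wt\<close>.\<close>

lemma Sg_iff: "s \<in> Sg a \<longleftrightarrow> (\<forall>\<alpha>. lookup s \<alpha> \<noteq> 0 \<longrightarrow> wt w \<alpha> = a)"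
proof
  assume a: "\<forall>\<alpha>. lookup s \<alpha> \<noteq> 0 \<longrightarrow> wt w \<alpha> = a"
  have "(\<Sum>\<alpha>\<in>keys s. single \<alpha> (lookup s \<alpha>)) \<in> Sg a"
    using a single_in by (intro S.sum) (auto simp: in_keys_iff)
  then show "s \<in> Sg a" by (simp add: poly_expand)
next
  assume s: "s \<in> Sg a"
  let ?G = "\<lambda>a. {s \<in> Sg a. \<forall>\<alpha>. lookup s \<alpha> \<noteq> 0 \<longrightarrow> wt w \<alpha> = a}"
  have cl: "x + y \<in> ?G a" if "x \<in> ?G a" "y \<in> ?G a" for x y a
    using that by (auto simp: lookup_add) (metis add_0)
  have "(\<Sum>\<alpha>\<in>keys s. single \<alpha> (lookup s \<alpha>)) \<in> carr ?G"
  proof (rule carr_sum)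
    show "0 \<in> ?G a" for a by simp
    show "x + y \<in> ?G a" if "x \<in> ?G a" "y \<in> ?G a" for a x y using that by (rule cl)
    fix \<alpha>
    have "single \<alpha> (lookup s \<alpha>) \<in> ?G (wt w \<alpha>)"
      using single_in by (auto simp: lookup_single when_def)
    then show "single \<alpha> (lookup s \<alpha>) \<in> carr ?G"
      by (rule in_carrI[rotated]) simp
  qed
  then have c: "s \<in> carr ?G" by (simp add: poly_expand)
  have "s \<in> ?G a"
    by (rule graded_refine[OF S.grading_axioms _ _ cl c s]) auto
  then show "\<forall>\<alpha>. lookup s \<alpha> \<noteq> 0 \<longrightarrow> wt w \<alpha> = a" by simp
qed

lemma \<theta>_sum: "\<theta> (\<Sum>x\<in>A. f x) = (\<Sum>x\<in>A. \<theta> (f x))"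
  by (induction A rule: infinite_finite_induct) auto

lemma \<theta>_wt: "\<theta> (wt w \<alpha>) = (\<Sum>i\<in>UNIV. int (lookup \<alpha> i) * \<theta> (w i))"
  by (simp add: wt_def \<theta>_sum)

lemma \<theta>_wt_nonneg: "\<theta> (wt w \<alpha>) \<ge> 0"
  unfolding \<theta>_wt using \<theta>_pos by (intro sum_nonneg) (simp add: less_imp_le)

lemma \<theta>_wt_pos: "\<alpha> \<noteq> 0 \<Longrightarrow> \<theta> (wt w \<alpha>) > 0"
proof -
  assume "\<alpha> \<noteq> 0"
  then obtain i \<beta> where "\<alpha> = single i 1 + \<beta>" using mono_cases by blast
  then show ?thesis using \<theta>_wt_nonneg[of \<beta>] \<theta>_pos[of i] by simp
qed

end

section \<open>Graded modules\<close>

text \<open>Any other factorisation of the monomial \<alpha> would use a monomial of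
  \<open>p\<close> of smaller total degree. This isolates the lowest part of a relation.\<close>

lemma lookup_mult_lead:
  fixes p q :: "('v::finite, 'k::field) mpol"
  assumes "\<And>\<beta>. tdeg \<beta> < tdeg \<alpha> \<Longrightarrow> lookup p \<beta> = 0"
  shows "lookup (p * q) \<alpha> = lookup p \<alpha> * lookup q 0"
proof -
  have c: "lookup (single \<beta> (lookup p \<beta>) * q) \<alpha> = (if \<beta> = \<alpha> then lookup p \<alpha> * lookup q 0 else 0)"
    if "\<beta> \<in> keys p" for \<beta>
  proof (cases "\<beta> = \<alpha>")
    case True
    then show ?thesis using lookup_single_mult_plus[of \<alpha> "lookup p \<alpha>" q 0] by simp
  next
    case False
    have "lookup (single \<beta> (lookup p \<beta>) * q) \<alpha> = 0"
    proof (rule ccontr)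
      assume "lookup (single \<beta> (lookup p \<beta>) * q) \<alpha> \<noteq> 0"
      then obtain a b where *: "\<alpha> = a + b" "lookup (single \<beta> (lookup p \<beta>)) a \<noteq> 0"
        using lookup_mult_nonzeroE by blast
      then have "\<alpha> = \<beta> + b" by (auto simp: lookup_single when_def split: if_splits)
      with False have "tdeg \<beta> < tdeg \<alpha>" by (cases "b = 0") (auto simp: zero_less_iff_neq_zero)
      with assms that show False by (auto simp: in_keys_iff)
    qed
    with False show ?thesis by simp
  qed
  have "lookup (p * q) \<alpha> = (\<Sum>\<beta>\<in>keys p. lookup (single \<beta> (lookup p \<beta>) * q) \<alpha>)"
    by (subst poly_expand[of p, symmetric]) (simp only: sum_distrib_right lookup_sum)
  also have "\<dots> = (\<Sum>\<beta>\<in>keys p. if \<beta> = \<alpha> then lookup p \<alpha> * lookup q 0 else 0)"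
    by (rule sum.cong) (simp_all add: c)
  also have "\<dots> = lookup p \<alpha> * lookup q 0" by (auto simp: in_keys_iff)
  finally show ?thesis .
qed

lemma single_Suc_0_nonzero: "single i (Suc 0) \<noteq> 0"
  by (metis lookup_single_eq lookup_zero nat.distinct(1))

context vector_space
begin

text \<open>The hypothesis concerns the family \<open>f\<close> on \<open>W\<close> rather than the
  image as a set, since only then does it exclude coincidences: \<open>f x = f y\<close> is a
  relation with coefficients 1 and -1.\<close>

lemma independent_image:
  assumes W: "\<And>U l. finite U \<Longrightarrow> U \<subseteq> W \<Longrightarrow> (\<Sum>c\<in>U. scale (l c) (f c)) = 0 \<Longrightarrow> \<forall>c\<in>U. l c = 0"
  shows "inj_on f W" "independent (f ` W)"
proof -
  show inj: "inj_on f W"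
  proof (rule inj_onI, rule ccontr)
    fix x y assume *: "x \<in> W" "y \<in> W" "f x = f y" "x \<noteq> y"
    have "(\<Sum>c\<in>{x, y}. scale (if c = x then 1 else -1) (f c)) = 0" using * by simp
    from W[OF _ _ this] * have "(if x = x then 1 else -1 :: 'a) = 0" by blast
    then show False by simp
  qed
  show "independent (f ` W)"
    unfolding independent_explicit_module
  proof (intro allI impI)
    fix T u v assume T: "finite T" "T \<subseteq> f ` W" and u: "(\<Sum>v\<in>T. scale (u v) v) = 0" and v: "v \<in> T"
    obtain U where U: "U \<subseteq> W" "finite U" "T = f ` U" using finite_subset_image[OF T] by metis
    have "(\<Sum>v\<in>T. scale (u v) v) = (\<Sum>c\<in>U. scale (u (f c)) (f c))"
      unfolding U(3) by (rule sum.reindex_cong[where l = f]) (auto intro: inj_on_subset[OF inj U(1)])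
    then have "(\<Sum>c\<in>U. scale (u (f c)) (f c)) = 0" using u by simp
    from W[OF U(2,1) this] v U(3) show "u v = 0" by auto
  qed
qed

end

locale gmod = posgr Sg w \<theta>
  for Sg :: "'a::ab_group_add \<Rightarrow> ('v::finite, 'k::field) mpol set" and w \<theta> +
  fixes F :: "('a, ('v, 'k) mpol, 'f::ab_group_add) gmod"
  assumes graded_module: "graded_module Sg F"
begin

sublocale F: module "sc F"
  using graded_module by (simp add: graded_module_def)

sublocale P: grading "pt F"
  using graded_module by unfold_locales (simp add: graded_module_def)

sublocale K: vector_space "\<lambda>c. sc F (Const c)"
  by unfold_locales (simp_all add: F.scale_left_distrib F.scale_right_distrib)

lemma scale_in: "s \<in> Sg a \<Longrightarrow> x \<in> pt F b \<Longrightarrow> sc F s x \<in> pt F (a + b)"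
  using graded_module by (auto simp: graded_module_def)

lemma Var_scale_in: "x \<in> pt F b \<Longrightarrow> sc F (Var i) x \<in> pt F (w i + b)"
  by (rule scale_in[OF Var_in])

lemma Const_scale_in: "x \<in> pt F b \<Longrightarrow> sc F (Const c) x \<in> pt F b"
  using scale_in[OF Const_in, of x b c] by simp

lemma scale_expand: "sc F s x = (\<Sum>\<alpha>\<in>keys s. sc F (single \<alpha> 1) (sc F (Const (lookup s \<alpha>)) x))"
proof -
  have "sc F s x = sc F (\<Sum>\<alpha>\<in>keys s. single \<alpha> (lookup s \<alpha>)) x" by (simp add: poly_expand)
  also have "\<dots> = (\<Sum>\<alpha>\<in>keys s. sc F (single \<alpha> (lookup s \<alpha>)) x)" by (rule F.scale_sum_left)
  also have "\<dots> = (\<Sum>\<alpha>\<in>keys s. sc F (single \<alpha> 1) (sc F (Const (lookup s \<alpha>)) x))"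
    by (simp add: Const_def mult_single)
  finally show ?thesis .
qed

lemma carr_scale_pt: "x \<in> pt F b \<Longrightarrow> sc F s x \<in> mcarr F"
  by (subst scale_expand) (rule P.carr_sum, rule P.carrI, rule scale_in[OF single_in Const_scale_in])

lemma carr_scale: "x \<in> mcarr F \<Longrightarrow> sc F s x \<in> mcarr F"
  by (rule carr_map[where f = "sc F s" and G = "pt F"])
     (auto simp: F.scale_sum_right carr_scale_pt)

lemma subspace_carr: "F.subspace (mcarr F)"
  by (intro F.subspaceI) (auto intro: P.carr_add carr_scale)

text \<open>The submodule \<open>\<mm> F\<close>, where \<open>\<mm>\<close> is the ideal of the variables.\<close>

definition mm :: "'f set"
  where "mm = F.span {sc F (Var i) x | i x. x \<in> mcarr F}"

lemma mm_subset: "mm \<subseteq> mcarr F"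
  unfolding mm_def by (intro F.span_minimal subspace_carr) (auto intro: carr_scale)

lemma scale_mm:
  assumes "lookup s 0 = 0" "x \<in> mcarr F"
  shows "sc F s x \<in> mm"
  unfolding mm_def
proof (subst scale_expand, rule F.span_sum)
  fix \<alpha> assume "\<alpha> \<in> keys s"
  then have "\<alpha> \<noteq> 0" using assms by (auto simp: in_keys_iff)
  then obtain i \<beta> where \<alpha>: "\<alpha> = single i 1 + \<beta>" using mono_cases by blast
  show "sc F (single \<alpha> 1) (sc F (Const (lookup s \<alpha>)) x) \<in> F.span {sc F (Var i) x |i x. x \<in> mcarr F}"
    by (rule F.span_base, intro CollectI exI[of _ i] exI[of _ "sc F (single \<beta> (lookup s \<alpha>)) x"] conjI carr_scale assms)
       (simp add: \<alpha> Const_def mult_single Var_def)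
qed

text \<open>Collecting the generators by variable leaves one multiplier per variable. In this form
  elements of \<mm>F can be projected along a complement and expanded in coefficients.\<close>

lemma mm_alt:
  assumes "x \<in> mm"
  obtains u where "\<And>i. u i \<in> mcarr F" "x = (\<Sum>i\<in>UNIV. sc F (Var i) (u i))"
proof -
  have "\<exists>u. (\<forall>i. u i \<in> mcarr F) \<and> x = (\<Sum>i\<in>UNIV. sc F (Var i) (u i))"
    using assms unfolding mm_def
  proof (induction rule: F.span_induct_alt)
    case base
    show ?case by (rule exI[of _ "\<lambda>_. 0"]) simp
  next
    case (step s x y)
    then obtain j v u where u: "x = sc F (Var j) v" "v \<in> mcarr F" "\<And>i. u i \<in> mcarr F"
       "y = (\<Sum>i\<in>UNIV. sc F (Var i) (u i))" by auto
    have "sc F s x = (\<Sum>i\<in>UNIV. sc F (Var i) (if j = i then sc F s v else 0))"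
      by (simp add: u if_distrib mult.commute cong: if_cong)
    then show ?case
      using u by (intro exI[of _ "\<lambda>i. (if j = i then sc F s v else 0) + u i"])
        (auto simp: F.scale_right_distrib sum.distrib intro!: P.carr_add carr_scale)
  qed
  then show ?thesis using that by blast
qed

lemma span_subset_carr:
  assumes "G \<subseteq> mcarr F"
  shows "F.span G \<subseteq> mcarr F"
  by (intro F.span_minimal subspace_carr assms)

end

section \<open>Graded free modules\<close>

locale gfree = gmod Sg w \<theta> F
  for Sg :: "'a::ab_group_add \<Rightarrow> ('v::finite, 'k::field) mpol set" and w \<theta>
    and F :: "('a, ('v, 'k) mpol, 'f::ab_group_add) gmod" +
  fixes B
  assumes homogeneous_basis: "homogeneous_basis F B"
begin

lemma B_pt: "B \<subseteq> (\<Union>a. pt F a)" and indep: "F.independent B" and span_B: "F.span B = mcarr F"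
  using homogeneous_basis by (auto simp: homogeneous_basis_def)

lemma B_carr: "b \<in> B \<Longrightarrow> b \<in> mcarr F"
  using span_B F.span_base by auto

definition deg :: "'f \<Rightarrow> 'a" where "deg b = (SOME a. b \<in> pt F a)"

lemma deg: "b \<in> B \<Longrightarrow> b \<in> pt F (deg b)"
  unfolding deg_def using B_pt by (auto intro: someI)

lemma B_nonzero: "0 \<notin> B"
  using indep F.dependent_zero by blast

abbreviation rep :: "'f \<Rightarrow> 'f \<Rightarrow> ('v, 'k) mpol"
  where "rep \<equiv> F.representation B"

text \<open>\<open>coef \<alpha> b x\<close> is the coefficient of \<open>x\<^sup>\<alpha> b\<close> in the expansion of \<open>x\<close>.\<close>

definition coef :: "('v \<Rightarrow>\<^sub>0 nat) \<Rightarrow> 'f \<Rightarrow> 'f \<Rightarrow> 'k"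
  where "coef \<alpha> b x = lookup (rep x b) \<alpha>"

lemma rep_scale: "x \<in> mcarr F \<Longrightarrow> rep (sc F s x) b = s * rep x b"
  using F.representation_scale[OF indep, of x s] span_B by simp

lemma rep_sum: "(\<And>i. i \<in> A \<Longrightarrow> f i \<in> mcarr F) \<Longrightarrow> rep (\<Sum>i\<in>A. f i) b = (\<Sum>i\<in>A. rep (f i) b)"
  using F.representation_sum[OF indep, of A f] span_B by simp

lemma coef_zero [simp]: "coef \<alpha> b 0 = 0"
  by (simp add: coef_def F.representation_zero)

lemma coef_add: "x \<in> mcarr F \<Longrightarrow> y \<in> mcarr F \<Longrightarrow> coef \<alpha> b (x + y) = coef \<alpha> b x + coef \<alpha> b y"
  using F.representation_add[OF indep, of y x] span_B by (simp add: coef_def lookup_add add.commute)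

lemma coef_diff: "x \<in> mcarr F \<Longrightarrow> y \<in> mcarr F \<Longrightarrow> coef \<alpha> b (x - y) = coef \<alpha> b x - coef \<alpha> b y"
  using F.representation_diff[OF indep, of y x] span_B by (simp add: coef_def lookup_minus)

lemma coef_sum: "(\<And>i. i \<in> A \<Longrightarrow> f i \<in> mcarr F) \<Longrightarrow> coef \<alpha> b (\<Sum>i\<in>A. f i) = (\<Sum>i\<in>A. coef \<alpha> b (f i))"
  by (simp add: coef_def rep_sum lookup_sum)

lemma coef_Const: "x \<in> mcarr F \<Longrightarrow> coef \<alpha> b (sc F (Const c) x) = c * coef \<alpha> b x"
  by (simp add: coef_def rep_scale)

lemma coef_scale: "x \<in> mcarr F \<Longrightarrow> coef \<alpha> b (sc F s x) = lookup (s * rep x b) \<alpha>"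
  by (simp add: coef_def rep_scale)

lemma coef_scale_zero: "x \<in> mcarr F \<Longrightarrow> coef 0 b (sc F s x) = lookup s 0 * coef 0 b x"
  unfolding coef_def by (subst rep_scale, assumption, rule lookup_mult_lead) simp

lemma coef_B: "b \<in> B \<Longrightarrow> coef \<alpha> b' b = (if \<alpha> = 0 \<and> b' = b then 1 else 0)"
  using F.representation_basis[OF indep, of b]
  by (auto simp: coef_def single_one[symmetric] lookup_single when_def simp del: single_one)

lemma coef_notin: "b \<notin> B \<Longrightarrow> coef \<alpha> b x = 0"
  using F.representation_ne_zero[of B x b] by (metis coef_def lookup_zero)

lemma expand:
  assumes "x \<in> mcarr F"
  obtains U where "finite U" "U \<subseteq> B" "x = (\<Sum>b\<in>U. sc F (rep x b) b)" "\<And>b. b \<in> U \<longleftrightarrow> rep x b \<noteq> 0"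
proof
  show "finite {b. rep x b \<noteq> 0}" by (rule F.finite_representation)
  show "{b. rep x b \<noteq> 0} \<subseteq> B" using F.representation_ne_zero by auto
  show "x = (\<Sum>b | rep x b \<noteq> 0. sc F (rep x b) b)"
    using F.sum_nonzero_representation_eq[OF indep, of x] assms span_B by simp
qed auto

lemma coef_eq_0:
  assumes "x \<in> mcarr F" "\<And>\<alpha> b. b \<in> B \<Longrightarrow> coef \<alpha> b x = 0"
  shows "x = 0"
proof -
  have "rep x b = 0" for b
    using assms(2) coef_notin by (intro poly_mapping_eqI) (metis coef_def lookup_zero)
  then show ?thesis using expand[OF assms(1)] by auto
qed

lemma mm_coef: "x \<in> mm \<Longrightarrow> coef 0 b x = 0"
proof (elim mm_alt)
  fix u assume u: "\<And>i. u i \<in> mcarr F" and x: "x = (\<Sum>i\<in>UNIV. sc F (Var i) (u i))"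
  show "coef 0 b x = 0"
    unfolding x by (subst coef_sum) (auto simp: u carr_scale coef_scale_zero Var_def lookup_single when_def single_Suc_0_nonzero)
qed

text \<open>The expansion in \<open>B\<close> consists of terms x^\<alpha> b, each homogeneous of
  degree \<open>wt w \<alpha> + deg b\<close>; directness of the grading leaves only the terms of
  degree \<open>a\<close>.\<close>

lemma coef_pt:
  assumes x: "x \<in> pt F a" and nz: "coef \<alpha> b x \<noteq> 0"
  shows "wt w \<alpha> + deg b = a"
proof -
  let ?G = "\<lambda>a. {x \<in> pt F a. \<forall>\<alpha> b. coef \<alpha> b x \<noteq> 0 \<longrightarrow> wt w \<alpha> + deg b = a}"
  have cl: "x + y \<in> ?G a" if "x \<in> ?G a" "y \<in> ?G a" for x y a
    using that by (auto simp: coef_add P.carrI) (metis add_0)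
  have z: "0 \<in> ?G a" for a by simp
  have xc: "x \<in> mcarr F" using x by (rule P.carrI)
  obtain U where U: "finite U" "U \<subseteq> B" "x = (\<Sum>b\<in>U. sc F (rep x b) b)"
    using expand[OF xc] by metis
  have "sc F s b \<in> carr ?G" if b: "b \<in> B" for s b
  proof (subst scale_expand, rule carr_sum[OF z cl])
    fix \<alpha>
    have "sc F (single \<alpha> 1) (sc F (Const (lookup s \<alpha>)) b) \<in> ?G (wt w \<alpha> + deg b)"
    proof (intro CollectI conjI allI impI scale_in single_in Const_scale_in deg b)
      fix \<alpha>' b'
      assume "coef \<alpha>' b' (sc F (single \<alpha> 1) (sc F (Const (lookup s \<alpha>)) b)) \<noteq> 0"
      then have *: "lookup (single \<alpha> (lookup s \<alpha>) * rep b b') \<alpha>' \<noteq> 0"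
        using b by (simp add: Const_def mult_single coef_scale B_carr)
      then have "b' = b"
        using F.representation_basis[OF indep b] by (auto split: if_splits)
      with * show "wt w \<alpha>' + deg b' = wt w \<alpha> + deg b"
        using F.representation_basis[OF indep b] by (auto simp: lookup_single when_def split: if_splits)
    qed
    then show "sc F (single \<alpha> 1) (sc F (Const (lookup s \<alpha>)) b) \<in> carr ?G"
      by (rule in_carrI[rotated]) simp
  qed assumption+
  then have "(\<Sum>b\<in>U. sc F (rep x b) b) \<in> carr ?G"
    by (intro carr_sum[OF z cl]) (use U in auto)
  then have c: "x \<in> carr ?G" using U by simp
  have "x \<in> ?G a"
    by (rule graded_refine[OF P.grading_axioms _ z cl c x]) auto
  then show ?thesis using nz by simp
qed

lemma pt_bounded:
  assumes "\<And>b. b \<in> B \<Longrightarrow> t \<le> \<theta> (deg b)" "x \<in> pt F a" "x \<noteq> 0"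
  shows "t \<le> \<theta> a"
proof -
  obtain \<alpha> b where *: "b \<in> B" "coef \<alpha> b x \<noteq> 0" using coef_eq_0[of x] assms(2,3) P.carrI by blast
  then have "a = wt w \<alpha> + deg b" using coef_pt assms(2) by metis
  then show ?thesis using \<theta>_wt_nonneg[of \<alpha>] assms(1)[OF *(1)] by simp
qed

text \<open>This is \<mm> \<mm>F \<subseteq> \<mm>^2F on coefficients: a term of the product
  combines two nonconstant monomials and so has total degree at least 2.\<close>

lemma coef_low:
  assumes "lookup s 0 = 0" "x \<in> mcarr F" "coef 0 b x = 0" "tdeg \<alpha> \<le> 1"
  shows "coef \<alpha> b (sc F s x) = 0"
proof (rule ccontr)
  assume "coef \<alpha> b (sc F s x) \<noteq> 0"
  then obtain \<beta> \<gamma> where *: "\<alpha> = \<beta> + \<gamma>" "lookup s \<beta> \<noteq> 0" "lookup (rep x b) \<gamma> \<noteq> 0"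
    using lookup_mult_nonzeroE assms(2) by (metis coef_scale)
  then have "\<beta> \<noteq> 0" "\<gamma> \<noteq> 0" using assms by (auto simp: coef_def)
  then have "tdeg \<beta> > 0" "tdeg \<gamma> > 0" by (simp_all add: zero_less_iff_neq_zero)
  then show False using *(1) assms(4) by simp
qed

text \<open>Linear independence over the ground field modulo \<open>\<mm> F\<close>.\<close>

definition indep_mod :: "'f set \<Rightarrow> bool"
  where "indep_mod X \<longleftrightarrow> X \<subseteq> mcarr F \<and> (\<forall>U l. finite U \<longrightarrow> U \<subseteq> X \<longrightarrow>
    (\<forall>b\<in>B. coef 0 b (\<Sum>x\<in>U. sc F (Const (l x)) x) = 0) \<longrightarrow> (\<forall>x\<in>U. l x = 0))"

text \<open>The coefficients of a relation vanish by induction on total degree: once all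
  coefficients of smaller degree are zero, the part of the relation at x^\<alpha> is a relation over
  the ground field modulo \<mm>.\<close>

lemma indep_mod_independent:
  assumes "indep_mod X"
  shows "F.independent X"
  unfolding F.independent_explicit_module
proof (intro allI impI)
  fix U s v
  assume U: "finite U" "U \<subseteq> X" and s: "(\<Sum>x\<in>U. sc F (s x) x) = 0" and v: "v \<in> U"
  have Uc: "x \<in> mcarr F" if "x \<in> U" for x using assms U that by (auto simp: indep_mod_def)
  have "\<forall>x\<in>U. lookup (s x) \<alpha> = 0" for \<alpha>
  proof (induction "tdeg \<alpha>" arbitrary: \<alpha> rule: less_induct)
    case less
    have "coef 0 b (\<Sum>x\<in>U. sc F (Const (lookup (s x) \<alpha>)) x) = 0" for b
    proof -
      have "coef 0 b (\<Sum>x\<in>U. sc F (Const (lookup (s x) \<alpha>)) x) = (\<Sum>x\<in>U. lookup (s x) \<alpha> * lookup (rep x b) 0)"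
        using Uc by (subst coef_sum) (auto simp: carr_scale coef_Const, simp add: coef_def)
      also have "\<dots> = (\<Sum>x\<in>U. coef \<alpha> b (sc F (s x) x))"
        by (rule sum.cong) (auto simp: coef_scale Uc less lookup_mult_lead)
      also have "\<dots> = coef \<alpha> b (\<Sum>x\<in>U. sc F (s x) x)"
        by (subst coef_sum) (auto simp: carr_scale Uc)
      finally show ?thesis using s by simp
    qed
    moreover have "\<And>l. \<forall>b\<in>B. coef 0 b (\<Sum>x\<in>U. sc F (Const (l x)) x) = 0 \<Longrightarrow> \<forall>x\<in>U. l x = 0"
      using assms U unfolding indep_mod_def by blast
    ultimately have "\<forall>x\<in>U. (\<lambda>x. lookup (s x) \<alpha>) x = 0" by fastforce
    then show ?case by simp
  qed
  then show "s v = 0" using v by (auto intro: poly_mapping_eqI)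
qed

text \<open>A homogeneous set that is independent modulo the variables spans a direct summand: it can be
  extended by elements of \<open>B\<close> to a basis modulo the variables, which is a basis by the graded
  Nakayama lemma.\<close>

lemma indep_mod_split:
  assumes X: "indep_mod X" "X \<subseteq> (\<Union>a. pt F a)" and bd: "\<And>b. b \<in> B \<Longrightarrow> t \<le> \<theta> (deg b)"
  obtains D where "F.subspace D" "F.span X \<inter> D = {0}" "{x + y | x y. x \<in> F.span X \<and> y \<in> D} = mcarr F"
proof -
  interpret V: vector_space "\<lambda>(c::'k) (g :: 'f \<Rightarrow> 'k) b. c * g b"
    by unfold_locales (auto simp: fun_eq_iff algebra_simps)
  \<comment> \<open>The quotient map F \<rightarrow> F/\<mm>F in the coordinates given by
    \<open>B\<close>; it sends \<open>B\<close> to unit vectors.\<close>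
  define \<pi> where "\<pi> x = (\<lambda>b. coef 0 b x)" for x
  have \<pi>_sum: "\<pi> (\<Sum>x\<in>U. sc F (Const (l x)) x) = (\<Sum>x\<in>U. (\<lambda>b. l x * \<pi> x b))" if "U \<subseteq> mcarr F" for U l
    using that by (auto simp: \<pi>_def fun_eq_iff coef_sum carr_scale coef_Const subset_iff sum_apply)
  have \<pi>_B: "\<pi> b = (\<lambda>b'. if b' = b then 1 else 0)" if "b \<in> B" for b
    using that by (auto simp: \<pi>_def coef_B)
  have inj_B: "inj_on \<pi> B" by (rule inj_onI) (metis \<pi>_B zero_neq_one)
  have Xc: "X \<subseteq> mcarr F" using X(1) by (auto simp: indep_mod_def)
  have XD: "\<forall>x\<in>U. l x = 0" if "finite U" "U \<subseteq> X" "\<pi> (\<Sum>x\<in>U. sc F (Const (l x)) x) = 0" for U l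
    using X(1) that unfolding indep_mod_def \<pi>_def fun_eq_iff zero_fun_def by blast
  have ker: "\<forall>x\<in>U. l x = 0" if "finite U" "U \<subseteq> X" "(\<Sum>x\<in>U. (\<lambda>b. l x * \<pi> x b)) = 0" for U l
    using XD[OF that(1,2), of l] \<pi>_sum[of U l] that(2,3) Xc by auto
  have inj_X: "inj_on \<pi> X"
    by (rule V.independent_image(1)[where f = \<pi> and W = X]) (rule ker)
  have indep_X: "V.independent (\<pi> ` X)"
    by (rule V.independent_image(2)[where f = \<pi> and W = X]) (rule ker)
  obtain Bs where Bs: "\<pi> ` X \<subseteq> Bs" "Bs \<subseteq> \<pi> ` X \<union> \<pi> ` B" "V.independent Bs" "\<pi> ` X \<union> \<pi> ` B \<subseteq> V.span Bs"
    using V.maximal_independent_subset_extend[OF _ indep_X, of "\<pi> ` X \<union> \<pi> ` B"] by auto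
  define T where "T = {b \<in> B. \<pi> b \<in> Bs \<and> \<pi> b \<notin> \<pi> ` X}"
  have Tc: "T \<subseteq> mcarr F" using B_carr by (auto simp: T_def)
  have img: "\<pi> ` (X \<union> T) = Bs" using Bs(1,2) unfolding T_def by blast
  have inj: "inj_on \<pi> (X \<union> T)"
  proof -
    have inj_T: "inj_on \<pi> T" by (rule inj_on_subset[OF inj_B]) (auto simp: T_def)
    have no: "\<pi> x \<noteq> \<pi> t" if "x \<in> X" "t \<in> T" for x t
    proof -
      have "\<pi> t \<notin> \<pi> ` X" using that(2) by (simp add: T_def)
      with imageI[OF that(1), of \<pi>] show ?thesis by metis
    qed
    have "\<pi> ` (X - T) \<inter> \<pi> ` (T - X) = {}" by (intro equals0I, elim IntE imageE DiffE) (metis no)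
    then show ?thesis unfolding inj_on_Un using inj_X inj_T by blast
  qed
  have "indep_mod (X \<union> T)"
    unfolding indep_mod_def
  proof (intro conjI allI impI)
    show "X \<union> T \<subseteq> mcarr F" using Xc Tc by auto
    fix U l assume U: "finite U" "U \<subseteq> X \<union> T" and z: "\<forall>b\<in>B. coef 0 b (\<Sum>x\<in>U. sc F (Const (l x)) x) = 0"
    have Uc: "U \<subseteq> mcarr F" using U Xc Tc by auto
    have iU: "inj_on \<pi> U" using inj U(2) inj_on_subset by blast
    have "\<pi> (\<Sum>x\<in>U. sc F (Const (l x)) x) = 0"
    proof
      show "\<pi> (\<Sum>x\<in>U. sc F (Const (l x)) x) b = 0 b" for b
        using z coef_notin[of b] by (cases "b \<in> B") (simp_all add: \<pi>_def)
    qed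
    then have "(\<Sum>x\<in>U. (\<lambda>b. l x * \<pi> x b)) = 0" using \<pi>_sum[OF Uc] by simp
    also have "(\<Sum>x\<in>U. (\<lambda>b. l x * \<pi> x b)) = (\<Sum>v\<in>\<pi> ` U. (\<lambda>b. l (the_inv_into U \<pi> v) * v b))"
      by (subst sum.reindex[OF iU]) (auto intro!: sum.cong simp: the_inv_into_f_f[OF iU])
    finally have "\<And>v. v \<in> \<pi> ` U \<Longrightarrow> l (the_inv_into U \<pi> v) = 0"
      by (rule V.independentD[OF Bs(3), where t = "\<pi> ` U" and u = "\<lambda>v. l (the_inv_into U \<pi> v)", rotated 2])
        (use U img in auto)
    then show "\<forall>x\<in>U. l x = 0" using the_inv_into_f_f[OF iU] by (metis imageI)
  qed
  then have ind: "F.independent (X \<union> T)" by (rule indep_mod_independent)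
  have disj: "X \<inter> T = {}"
    unfolding T_def using imageI[of _ X \<pi>] by (intro equals0I, elim IntE CollectE conjE) metis
  have XT: "X \<union> T \<subseteq> mcarr F" using Xc Tc by auto
  \<comment> \<open>Nakayama as an induction on \<open>\<theta> (deg b)\<close>, bounded below by
    \<open>t\<close>: after correcting \<open>b\<close> by elements of \<open>X \<union> T\<close>
    all constant coefficients vanish, and only basis elements of smaller degree remain.\<close>
  have "b \<in> F.span (X \<union> T)" if "b \<in> B" for b
    using that
  proof (induction "nat (\<theta> (deg b) - t)" arbitrary: b rule: less_induct)
    case less
    have "\<pi> b \<in> V.span (\<pi> ` (X \<union> T))"
      unfolding img using Bs(4) less.prems by (metis UnI2 imageI subsetD)
    then obtain T' u where T': "finite T'" "T' \<subseteq> \<pi> ` (X \<union> T)" "\<pi> b = (\<Sum>v\<in>T'. (\<lambda>b. u v * v b))"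
      unfolding V.span_explicit by auto
    obtain U where U: "U \<subseteq> X \<union> T" "finite U" "T' = \<pi> ` U"
      using finite_subset_image[OF T'(1,2)] by metis
    have "(\<Sum>v\<in>T'. (\<lambda>b. u v * v b)) = (\<Sum>x\<in>U. (\<lambda>b. u (\<pi> x) * \<pi> x b))"
      unfolding U(3) by (rule sum.reindex_cong[where l = \<pi>]) (auto intro: inj_on_subset[OF inj U(1)])
    with T'(3) have "\<pi> b = (\<Sum>x\<in>U. (\<lambda>b. u (\<pi> x) * \<pi> x b))" by (rule trans)
    from fun_cong[OF this] have \<pi>b: "\<pi> b b' = (\<Sum>x\<in>U. u (\<pi> x) * \<pi> x b')" for b'
      by (simp only: sum_apply)
    \<comment> \<open>Keeping only the summands of degree \<open>deg b\<close> makes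
      \<open>x\<close> homogeneous. The discarded summands have no constant coefficient at basis
      elements of that degree, so the correction modulo \<mm> is unaffected.\<close>
    define U' where "U' = {z \<in> U. z \<in> pt F (deg b)}"
    define x where "x = b - (\<Sum>z\<in>U'. sc F (Const (u (\<pi> z))) z)"
    have xpt: "x \<in> pt F (deg b)"
      unfolding x_def using less.prems by (intro P.diff deg P.sum Const_scale_in) (auto simp: U'_def)
    have Uc: "U \<subseteq> mcarr F" using U(1) XT by auto
    have coef0: "coef 0 b' x = 0" for b'
    proof (cases "b' \<in> B \<and> deg b' = deg b")
      case False
      then show ?thesis using coef_pt[OF xpt, of 0 b'] coef_notin[of b'] by auto
    next
      case True
      have "u (\<pi> z) * \<pi> z b' = 0" if z: "z \<in> U - U'" for z
      proof -
        have "T \<subseteq> B" by (simp add: T_def)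
        then obtain c where c: "z \<in> pt F c" using z U(1) X(2) B_pt by blast
        then have "c \<noteq> deg b" using z by (auto simp: U'_def)
        then have "\<pi> z b' = 0" using coef_pt[OF c, of 0 b'] True by (auto simp: \<pi>_def)
        then show ?thesis by simp
      qed
      then have "(\<Sum>z\<in>U'. u (\<pi> z) * \<pi> z b') = (\<Sum>z\<in>U. u (\<pi> z) * \<pi> z b')"
        using U(2) by (intro sum.mono_neutral_left) (auto simp: U'_def)
      moreover have "coef 0 b' (\<Sum>z\<in>U'. sc F (Const (u (\<pi> z))) z) = (\<Sum>z\<in>U'. u (\<pi> z) * \<pi> z b')"
        using Uc by (subst coef_sum) (auto simp: U'_def \<pi>_def carr_scale coef_Const subset_iff)
      moreover have "(\<Sum>z\<in>U'. sc F (Const (u (\<pi> z))) z) \<in> mcarr F"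
        by (intro P.carr_sum carr_scale) (use Uc in \<open>auto simp: U'_def\<close>)
      ultimately show ?thesis
        unfolding x_def using less.prems \<pi>b[of b'] by (subst coef_diff) (auto simp: B_carr \<pi>_def)
    qed
    obtain W where W: "finite W" "W \<subseteq> B" "x = (\<Sum>b\<in>W. sc F (rep x b) b)" "\<And>b. b \<in> W \<longleftrightarrow> rep x b \<noteq> 0"
      by (rule expand[OF P.carrI[OF xpt]], rule that)
    have "b' \<in> F.span (X \<union> T)" if b': "b' \<in> W" for b'
    proof -
      obtain \<alpha> where \<alpha>: "coef \<alpha> b' x \<noteq> 0"
        using W(4) b' by (metis coef_def lookup_zero poly_mapping_eqI)
      then have "\<alpha> \<noteq> 0" using coef0 by auto
      moreover have "deg b = wt w \<alpha> + deg b'" using coef_pt[OF xpt \<alpha>] by simp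
      ultimately have "\<theta> (deg b') < \<theta> (deg b)" using \<theta>_wt_pos by simp
      moreover have "b' \<in> B" using W(2) b' by auto
      ultimately show ?thesis using bd[of b'] by (intro less.hyps) auto
    qed
    then have "x \<in> F.span (X \<union> T)"
      by (subst W(3)) (intro F.span_sum F.span_scale)
    moreover have "(\<Sum>z\<in>U'. sc F (Const (u (\<pi> z))) z) \<in> F.span (X \<union> T)"
      by (intro F.span_sum F.span_scale F.span_base) (use U in \<open>auto simp: U'_def\<close>)
    ultimately have "x + (\<Sum>z\<in>U'. sc F (Const (u (\<pi> z))) z) \<in> F.span (X \<union> T)"
      by (rule F.span_add)
    then show ?case by (simp add: x_def)
  qed
  then have "F.span B \<subseteq> F.span (X \<union> T)" by (intro F.span_minimal) auto
  then have span: "F.span (X \<union> T) = mcarr F" using span_subset_carr[OF XT] span_B by auto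
  show ?thesis
  proof
    show "F.subspace (F.span T)" by simp
    show "F.span X \<inter> F.span T = {0}"
    proof (intro equalityI subsetI)
      fix v assume v: "v \<in> F.span X \<inter> F.span T"
      then have "F.representation X v = F.representation T v"
        using F.representation_extend[OF ind, of v X] F.representation_extend[OF ind, of v T] by simp
      then have "F.representation X v b = 0" for b
        using F.representation_ne_zero[of X v b] F.representation_ne_zero[of T v b] disj by auto
      then show "v \<in> {0}"
        using F.sum_nonzero_representation_eq[of X v] v F.independent_mono[OF ind] by auto
    qed (auto simp: F.span_zero)
    show "{x + y | x y. x \<in> F.span X \<and> y \<in> F.span T} = mcarr F"
      using span F.span_Un[of X T] by simp
  qed
qed

end

section \<open>The complexes \<open>\<^bold>L(N)\<close>\<close>

text \<open>What is required of an E-module to form L(N): an action that is linear over the ground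
  field and, in each auxiliary degree, a direct decomposition over the grading group. The relations
  between the e_i enter through \<open>strand\<close>.\<close>

locale egr = posgr Sg w \<theta>
  for Sg :: "'a::ab_group_add \<Rightarrow> ('v::finite, 'k::field) mpol set" and w \<theta> +
  fixes N :: "('a, 'v, 'k, 'n::ab_group_add) emod"
  assumes ksc: "vector_space (ksc N)"
    and ract_hom: "module_hom (ksc N) (ksc N) (\<lambda>y. ract N y e)"
    and gr_grading: "is_grading (\<lambda>b. gr N (b, j))"
    and gr_ksc: "y \<in> gr N c \<Longrightarrow> ksc N t y \<in> gr N c"
begin

sublocale N: vector_space "ksc N" by (rule ksc)

definition KK :: "int \<Rightarrow> 'n set" where "KK j = carr (\<lambda>b. gr N (b, j))"

definition e :: "int \<Rightarrow> 'v \<Rightarrow> 'n \<Rightarrow> 'n"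
  where "e j i y = lact (ract N) (- 1) j (ext_basis {i}) y"

lemma G: "grading (\<lambda>b. gr N (b, j))"
  by unfold_locales (rule gr_grading)

lemma KK_add: "x \<in> KK j \<Longrightarrow> y \<in> KK j \<Longrightarrow> x + y \<in> KK j"
  unfolding KK_def by (rule grading.carr_add[OF G])

lemma KK_diff: "x \<in> KK j \<Longrightarrow> y \<in> KK j \<Longrightarrow> x - y \<in> KK j"
  unfolding KK_def by (rule grading.carr_diff[OF G])

lemma KK_sum: "(\<And>x. x \<in> A \<Longrightarrow> f x \<in> KK j) \<Longrightarrow> sum f A \<in> KK j"
  unfolding KK_def by (rule grading.carr_sum[OF G])

lemma KK_0 [simp]: "0 \<in> KK j"
  unfolding KK_def by (rule grading.carr_zero[OF G])

lemma KK_I: "y \<in> gr N (b, j) \<Longrightarrow> y \<in> KK j"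
  unfolding KK_def by (rule grading.carrI[OF G])

lemma KK_ksc: "y \<in> KK j \<Longrightarrow> ksc N c y \<in> KK j"
  unfolding KK_def
  by (rule carr_map[where G = "\<lambda>b. gr N (b, j)" and f = "ksc N c"])
     (auto intro: grading.zero[OF G] grading.add[OF G] gr_ksc grading.carrI[OF G] simp: N.scale_sum_right)

lemma e_hom: "module_hom (ksc N) (ksc N) (e j i)"
proof -
  interpret r: module_hom "ksc N" "ksc N" "\<lambda>y. ract N y (ext_basis {i})" by (rule ract_hom)
  show ?thesis
    by unfold_locales (auto simp: e_def lact_def r.add r.scale N.scale_minus_right)
qed

lemmas e_add = module_hom.add[OF e_hom]
lemmas e_scale = module_hom.scale[OF e_hom]
lemmas e_sum = module_hom.sum[OF e_hom]

lemma e_0 [simp]: "e j i 0 = 0"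
  using module_hom.zero[OF e_hom] by simp

lemma KK_basis:
  obtains Y where "Y \<subseteq> (\<Union>b. gr N (b, j))" "N.independent Y" "N.span Y = KK j"
proof -
  obtain Y where Y: "Y \<subseteq> (\<Union>b. gr N (b, j))" "N.independent Y" "(\<Union>b. gr N (b, j)) \<subseteq> N.span Y"
    using N.maximal_independent_subset by metis
  have "N.span Y = KK j"
  proof
    have "Y \<subseteq> KK j" using Y(1) KK_I by blast
    then show "N.span Y \<subseteq> KK j"
      by (rule N.span_minimal) (rule N.subspaceI, simp_all add: KK_add KK_ksc)
    show "KK j \<subseteq> N.span Y"
    proof
      fix y assume "y \<in> KK j"
      then obtain A h where "\<And>a. h a \<in> gr N (a, j)" "y = (\<Sum>a\<in>A. h a)" unfolding KK_def using carrE by metis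
      then show "y \<in> N.span Y" using Y(3) by (auto intro!: N.span_sum)
    qed
  qed
  then show ?thesis using that Y by blast
qed

abbreviation tens :: "('v, 'k) mpol \<Rightarrow> 'n \<Rightarrow> 'v mono \<Rightarrow>\<^sub>0 'n"
  where "tens \<equiv> tens_S N"

lemmas lookup_tens = tS_lookup[OF ksc]

lemma tens_add_right: "tens s (x + y) = tens s x + tens s y"
  by (rule poly_mapping_eqI) (simp add: lookup_tens lookup_add N.scale_right_distrib)

lemma tens_sum_right: "tens s (\<Sum>x\<in>A. f x) = (\<Sum>x\<in>A. tens s (f x))"
  by (rule poly_mapping_eqI) (simp add: lookup_tens lookup_sum N.scale_sum_right)

lemma tens_S_scale_add: "tens_S_scale N s (p + q) = tens_S_scale N s p + tens_S_scale N s q"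
  unfolding tens_S_scale_def by (rule sum_keys_add) (simp_all add: tS_0[OF ksc] tens_add_right)

lemma tens_S_scale_0: "tens_S_scale N s 0 = 0"
  by (simp add: tens_S_scale_def)

lemma tens_S_scale_sum: "tens_S_scale N s (\<Sum>x\<in>A. f x) = (\<Sum>x\<in>A. tens_S_scale N s (f x))"
  by (induction A rule: infinite_finite_induct) (auto simp: tens_S_scale_add tens_S_scale_0)

lemma tens_expand: "p = (\<Sum>\<alpha>\<in>keys p. tens (single \<alpha> 1) (lookup p \<alpha>))"
proof (rule poly_mapping_eqI)
  fix \<beta>
  have "lookup (\<Sum>\<alpha>\<in>keys p. tens (single \<alpha> 1) (lookup p \<alpha>)) \<beta> =
    (\<Sum>\<alpha>\<in>keys p. if \<beta> = \<alpha> then lookup p \<beta> else 0)"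
    unfolding lookup_sum lookup_tens by (rule sum.cong) (auto simp: lookup_single when_def)
  then show "lookup p \<beta> = lookup (\<Sum>\<alpha>\<in>keys p. tens (single \<alpha> 1) (lookup p \<alpha>)) \<beta>"
    by (auto simp: in_keys_iff)
qed

lemma tens_S_scale_scale: "tens_S_scale N s (tens_S_scale N t p) = tens_S_scale N (s * t) p"
  by (subst (1 2) tens_expand[of p])
     (simp add: tens_S_scale_sum tens_S_scale_tens[OF ksc] mult.assoc)

lemma tens_S_module: "module (tens_S_scale N)"
proof
  show "tens_S_scale N (s + t) p = tens_S_scale N s p + tens_S_scale N t p" for s t p
    by (simp add: tens_S_scale_def distrib_right tS_add[OF ksc] sum.distrib)
  show "tens_S_scale N 1 p = p" for p
    by (subst (2) tens_expand[of p]) (simp add: tens_S_scale_def)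
qed (rule tens_S_scale_add tens_S_scale_scale)+

lemma lookup_tens_S_scale_Const: "lookup (tens_S_scale N (Const c) p) \<alpha> = ksc N c (lookup p \<alpha>)"
proof -
  have "lookup (tens_S_scale N (Const c) p) \<alpha> = (\<Sum>\<beta>\<in>keys p. if \<alpha> = \<beta> then ksc N c (lookup p \<alpha>) else 0)"
    unfolding tens_S_scale_def lookup_sum lookup_tens
    by (rule sum.cong) (auto simp: lookup_single when_def)
  then show ?thesis by (auto simp: in_keys_iff)
qed

abbreviation L where "L \<equiv> L_complex Sg N"

abbreviation Lcarr where "Lcarr j \<equiv> mcarr (md L j)"

abbreviation Lpt where "Lpt j \<equiv> pt (md L j)"

lemma sc_L: "sc (md L j) = tens_S_scale N" and df_L: "df L = L_diff N"
  by (simp_all add: L_complex_def)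

text \<open>In degree \<open>c\<close> a tensor s \<otimes> y with y of degree b lives on monomials
  of weight \<open>c - b\<close>. So the span can be described one monomial at a time, which makes
  membership a condition on the separate coefficients.\<close>

lemma pt_L: "Lpt j c = {p. \<forall>\<alpha>. lookup p \<alpha> \<in> gr N (c - wt w \<alpha>, j)}"
proof -
  interpret T: module "tens_S_scale N" by (rule tens_S_module)
  interpret V: vector_space "\<lambda>k. tens_S_scale N (Const k)"
    by unfold_locales (simp_all add: T.scale_left_distrib T.scale_right_distrib)
  interpret G: grading "\<lambda>b. gr N (b, j)" by (rule G)
  let ?X = "{tens s y | s y b. s \<in> twist Sg (- b) c \<and> y \<in> gr N (b, j)}"
  have "V.span ?X = {p. \<forall>\<alpha>. lookup p \<alpha> \<in> gr N (c - wt w \<alpha>, j)}"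
  proof
    show "V.span ?X \<subseteq> {p. \<forall>\<alpha>. lookup p \<alpha> \<in> gr N (c - wt w \<alpha>, j)}"
    proof (rule V.span_minimal)
      show "?X \<subseteq> {p. \<forall>\<alpha>. lookup p \<alpha> \<in> gr N (c - wt w \<alpha>, j)}"
      proof clarsimp
        fix s y b \<alpha> assume s: "s \<in> twist Sg (- b) c" and y: "y \<in> gr N (b, j)"
        show "lookup (tens s y) \<alpha> \<in> gr N (c - wt w \<alpha>, j)"
        proof (cases "lookup s \<alpha> = 0")
          case False
          then have "wt w \<alpha> = - b + c" using s by (auto simp: twist_def Sg_iff)
          then have "c - wt w \<alpha> = b" by simp
          then show ?thesis using y by (simp add: lookup_tens gr_ksc)
        qed (simp add: lookup_tens)
      qed
      show "V.subspace {p. \<forall>\<alpha>. lookup p \<alpha> \<in> gr N (c - wt w \<alpha>, j)}"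
        by (rule V.subspaceI) (auto simp: lookup_add lookup_tens_S_scale_Const gr_ksc)
    qed
    show "{p. \<forall>\<alpha>. lookup p \<alpha> \<in> gr N (c - wt w \<alpha>, j)} \<subseteq> V.span ?X"
    proof clarify
      fix p assume p: "\<forall>\<alpha>. lookup p \<alpha> \<in> gr N (c - wt w \<alpha>, j)"
      have "(\<Sum>\<alpha>\<in>keys p. tens (single \<alpha> 1) (lookup p \<alpha>)) \<in> V.span ?X"
        using p single_in
        by (intro V.span_sum V.span_base CollectI exI conjI refl) (auto simp: twist_def)
      then show "p \<in> V.span ?X" using tens_expand[of p] by simp
    qed
  qed
  then show ?thesis by (simp add: L_complex_def)
qed

lemma pt_L_zero: "0 \<in> Lpt j c"
  using grading.zero[OF G] by (auto simp: pt_L)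

lemma pt_L_add: "p \<in> Lpt j c \<Longrightarrow> q \<in> Lpt j c \<Longrightarrow> p + q \<in> Lpt j c"
  using grading.add[OF G] by (auto simp: pt_L lookup_add)

lemma pt_L_neg: "p \<in> Lpt j c \<Longrightarrow> - p \<in> Lpt j c"
  using grading.neg[OF G] by (auto simp: pt_L)

lemma pt_L_carr: "p \<in> Lpt j c \<Longrightarrow> p \<in> Lcarr j"
  by (rule in_carrI[where G = "Lpt j"]) (rule pt_L_zero)

lemma tens_single_pt: "y \<in> gr N (b, j) \<Longrightarrow> tens (single \<alpha> c) y \<in> Lpt j (b + wt w \<alpha>)"
  using grading.zero[OF G] gr_ksc by (auto simp: pt_L lookup_tens lookup_single when_def)

lemma mcarr_L: "Lcarr j = {p. \<forall>\<alpha>. lookup p \<alpha> \<in> KK j}"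
proof (intro equalityI subsetI CollectI allI)
  fix p \<alpha> assume "p \<in> Lcarr j"
  then show "lookup p \<alpha> \<in> KK j"
    unfolding KK_def
    by (rule carr_map[rotated 2])
       (auto simp: lookup_sum pt_L intro: grading.zero[OF G] grading.add[OF G] grading.carrI[OF G])
next
  fix p :: "'v mono \<Rightarrow>\<^sub>0 'n" assume p: "p \<in> {p. \<forall>\<alpha>. lookup p \<alpha> \<in> KK j}"
  have "tens (single \<alpha> 1) y \<in> Lcarr j" if "y \<in> KK j" for y \<alpha>
    using that unfolding KK_def
    by (rule carr_map[rotated 2])
       (auto simp: tS_0[OF ksc] tens_sum_right intro: pt_L_zero pt_L_add pt_L_carr[OF tens_single_pt])
  then have "(\<Sum>\<alpha>\<in>keys p. tens (single \<alpha> 1) (lookup p \<alpha>)) \<in> Lcarr j"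
    using p by (intro carr_sum pt_L_zero pt_L_add) auto
  then show "p \<in> Lcarr j" using tens_expand[of p] by simp
qed

lemma mcarr_L_add: "p \<in> Lcarr j \<Longrightarrow> q \<in> Lcarr j \<Longrightarrow> p + q \<in> Lcarr j"
  by (simp add: mcarr_L lookup_add KK_add)

lemma mcarr_L_diff: "p \<in> Lcarr j \<Longrightarrow> q \<in> Lcarr j \<Longrightarrow> p - q \<in> Lcarr j"
  by (simp add: mcarr_L lookup_minus KK_diff)

lemma mcarr_L_sum: "(\<And>x. x \<in> A \<Longrightarrow> f x \<in> Lcarr j) \<Longrightarrow> sum f A \<in> Lcarr j"
  by (simp add: mcarr_L lookup_sum KK_sum)

lemma tens_mcarr: "y \<in> KK j \<Longrightarrow> tens s y \<in> Lcarr j"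
  by (simp add: mcarr_L lookup_tens KK_ksc)

lemma mcarr_L_scale: "p \<in> Lcarr j \<Longrightarrow> tens_S_scale N s p \<in> Lcarr j"
  unfolding tens_S_scale_def by (intro mcarr_L_sum tens_mcarr) (simp add: mcarr_L)

lemma pt_L_scale: "s \<in> Sg a \<Longrightarrow> p \<in> Lpt j b \<Longrightarrow> tens_S_scale N s p \<in> Lpt j (a + b)"
proof -
  assume s: "s \<in> Sg a" and p: "p \<in> Lpt j b"
  have "tens (s * single \<alpha> 1) (lookup p \<alpha>) \<in> Lpt j (a + b)" for \<alpha>
    unfolding pt_L
  proof (intro CollectI allI)
    fix \<beta>
    have st: "s * single \<alpha> 1 \<in> Sg (a + wt w \<alpha>)" by (rule Sg_mult[OF s single_in])
    show "lookup (tens (s * single \<alpha> 1) (lookup p \<alpha>)) \<beta> \<in> gr N (a + b - wt w \<beta>, j)"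
    proof (cases "lookup (s * single \<alpha> 1) \<beta> = 0")
      case False
      then have "wt w \<beta> = a + wt w \<alpha>" using st by (auto simp: Sg_iff)
      then have *: "a + b - wt w \<beta> = b - wt w \<alpha>" by simp
      show ?thesis unfolding * using p by (simp add: lookup_tens gr_ksc pt_L)
    qed (simp add: lookup_tens grading.zero[OF G])
  qed
  then have "(\<Sum>\<alpha>\<in>A. tens (s * single \<alpha> 1) (lookup p \<alpha>)) \<in> Lpt j (a + b)" for A
    by (induction A rule: infinite_finite_induct) (auto intro: pt_L_add pt_L_zero)
  then show ?thesis by (simp add: tens_S_scale_def)
qed

lemma L_diff_add: "L_diff N j (p + q) = L_diff N j p + L_diff N j q"
  unfolding L_diff_def e_def[symmetric]
  by (rule sum_keys_add) (simp_all add: tS_0[OF ksc] e_add tens_add_right sum.distrib)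

lemma L_diff_0 [simp]: "L_diff N j 0 = 0"
  by (simp add: L_diff_def)

lemma L_diff_sum: "L_diff N j (\<Sum>x\<in>A. f x) = (\<Sum>x\<in>A. L_diff N j (f x))"
  by (induction A rule: infinite_finite_induct) (auto simp: L_diff_add)

lemma L_diff_tens': "L_diff N j (tens s y) = (\<Sum>i\<in>UNIV. tens (Var i * s) (e j i y))"
  unfolding e_def
  by (rule L_diff_tens[OF ksc]) (rule module_hom.scale[OF ract_hom])

lemma L_diff_scale: "L_diff N j (tens_S_scale N s p) = tens_S_scale N s (L_diff N j p)"
  by (subst (1 2) tens_expand[of p])
     (simp add: tens_S_scale_sum tens_S_scale_tens[OF ksc] L_diff_sum L_diff_tens' mult.left_commute)

text \<open>The monomial x_i arises only as x_i times the constant monomial. Thus the linear part of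
  a differential records e_i of the constant term, which is how vanishing modulo \<mm>^2 becomes e_i
  y = 0.\<close>

lemma lookup_L_diff: "lookup (L_diff N j p) (single i 1) = e j i (lookup p 0)"
proof -
  have "lookup (L_diff N j p) (single i 1) =
    (\<Sum>\<alpha>\<in>keys p. \<Sum>l\<in>UNIV. if l = i then (if \<alpha> = 0 then e j i (lookup p 0) else 0) else 0)"
    unfolding L_diff_def e_def[symmetric] lookup_sum lookup_tens
    by (intro sum.cong refl) (auto simp: lookup_Var_mult_single single_plus_eq simp del: One_nat_def)
  also have "\<dots> = (\<Sum>\<alpha>\<in>keys p. if \<alpha> = 0 then e j i (lookup p 0) else 0)"
    by (intro sum.cong refl) simp
  also have "\<dots> = e j i (lookup p 0)" by (auto simp: in_keys_iff)
  finally show ?thesis .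
qed

end

section \<open>Linear maps out of \<open>S \<otimes> N\<close>\<close>

text \<open>The S-linear extension of \<open>f\<close> to S \<otimes> N, in the monomial coordinates
  of the tensor product.\<close>

definition lin_ext :: "('a, ('v, 'k::field) mpol, 'f::ab_group_add) gmod \<Rightarrow> ('n::zero \<Rightarrow> 'f) \<Rightarrow> ('v mono \<Rightarrow>\<^sub>0 'n) \<Rightarrow> 'f"
  where "lin_ext F f p = (\<Sum>\<alpha>\<in>keys p. sc F (single \<alpha> 1) (f (lookup p \<alpha>)))"

locale kmap = egr Sg w \<theta> N + gmod Sg w \<theta> F
  for Sg :: "'a::ab_group_add \<Rightarrow> ('v::finite, 'k::field) mpol set" and w \<theta>
    and N :: "('a, 'v, 'k, 'n::ab_group_add) emod"
    and F :: "('a, ('v, 'k) mpol, 'f::ab_group_add) gmod" +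
  fixes j :: int and f :: "'n \<Rightarrow> 'f"
  assumes f_hom: "module_hom (ksc N) (\<lambda>c. sc F (Const c)) f"
    and f_gr: "y \<in> gr N (b, j) \<Longrightarrow> f y \<in> pt F b"
begin

sublocale f: module_hom "ksc N" "\<lambda>c. sc F (Const c)" f by (rule f_hom)

abbreviation \<phi> where "\<phi> \<equiv> lin_ext F f"

lemma \<phi>_add: "\<phi> (p + q) = \<phi> p + \<phi> q"
  unfolding lin_ext_def by (rule sum_keys_add) (simp_all add: f.add F.scale_right_distrib)

lemma \<phi>_tens: "\<phi> (tens s y) = sc F s (f y)"
proof -
  have "\<phi> (tens s y) = (\<Sum>\<alpha>\<in>keys s. sc F (single \<alpha> 1) (f (lookup (tens s y) \<alpha>)))"
    unfolding lin_ext_def by (rule sum_keys_super) (simp_all add: keys_tS[OF ksc])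
  also have "\<dots> = sc F s (f y)"
    by (subst (2) scale_expand) (simp add: lookup_tens f.scale)
  finally show ?thesis .
qed

lemma \<phi>_0 [simp]: "\<phi> 0 = 0" by (simp add: lin_ext_def)

lemma \<phi>_sum: "\<phi> (\<Sum>x\<in>A. h x) = (\<Sum>x\<in>A. \<phi> (h x))"
  by (induction A rule: infinite_finite_induct) (auto simp: \<phi>_add)

lemma \<phi>_diff: "\<phi> (p - q) = \<phi> p - \<phi> q"
  using \<phi>_add[of "p - q" q] by (simp add: algebra_simps)

lemma \<phi>_scale: "\<phi> (tens_S_scale N s p) = sc F s (\<phi> p)"
  by (subst (1 2) tens_expand[of p])
     (simp add: tens_S_scale_sum tens_S_scale_tens[OF ksc] \<phi>_sum \<phi>_tens F.scale_sum_right)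

lemma \<phi>_hom: "module_hom (tens_S_scale N) (sc F) \<phi>"
proof -
  interpret T: module "tens_S_scale N" by (rule tens_S_module)
  show ?thesis by unfold_locales (simp_all add: \<phi>_add \<phi>_scale)
qed

lemma f_carr: "y \<in> KK j \<Longrightarrow> f y \<in> mcarr F"
  unfolding KK_def
  by (rule carr_map[where G = "\<lambda>b. gr N (b, j)" and H = "pt F" and f = f])
    (auto simp: f.sum intro: P.carrI f_gr)

lemma \<phi>_pt: "p \<in> Lpt j c \<Longrightarrow> \<phi> p \<in> pt F c"
proof -
  assume p: "p \<in> Lpt j c"
  have "sc F (single \<alpha> 1) (f (lookup p \<alpha>)) \<in> pt F (wt w \<alpha> + (c - wt w \<alpha>))" for \<alpha>
    using p by (intro scale_in single_in f_gr) (simp add: pt_L)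
  then show ?thesis unfolding lin_ext_def by (intro P.sum) simp
qed

lemma \<phi>_carr: "p \<in> Lcarr j \<Longrightarrow> \<phi> p \<in> mcarr F"
  unfolding lin_ext_def by (intro P.carr_sum carr_scale f_carr) (simp add: mcarr_L)

end

text \<open>\<open>inj_mod\<close> says that N_j \<rightarrow> F/\<mm>F is injective. This is the
  invariant carried through the construction; injectivity of the S-linear extension and splitting of
  its image both follow from it.\<close>

locale kmap_free = kmap Sg w \<theta> N F j f + gfree Sg w \<theta> F B
  for Sg :: "'a::ab_group_add \<Rightarrow> ('v::finite, 'k::field) mpol set" and w \<theta>
    and N :: "('a, 'v, 'k, 'n::ab_group_add) emod"
    and F :: "('a, ('v, 'k) mpol, 'f::ab_group_add) gmod" and j f B +
  assumes inj_mod: "y \<in> KK j \<Longrightarrow> (\<And>b. b \<in> B \<Longrightarrow> coef 0 b (f y) = 0) \<Longrightarrow> y = 0"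
begin

text \<open>At a monomial \<alpha> of smallest degree in \<open>p\<close>, the coefficient of
  \<open>\<phi> p\<close> is the constant coefficient of \<open>f (lookup p \<alpha>)\<close>, so
  \<open>inj_mod\<close> transfers vanishing up to degree \<open>t\<close> from
  \<open>\<phi> p\<close> back to \<open>p\<close>. The case \<open>t = 0\<close> is a statement
  modulo \<mm>, \<open>t = 1\<close> one modulo \<mm>^2, and all \<open>t\<close> together give
  injectivity.\<close>

lemma \<phi>_low:
  assumes p: "p \<in> Lcarr j" and low: "\<And>\<beta> b. tdeg \<beta> \<le> t \<Longrightarrow> b \<in> B \<Longrightarrow> coef \<beta> b (\<phi> p) = 0"
  shows "tdeg \<alpha> \<le> t \<Longrightarrow> lookup p \<alpha> = 0"
proof (induction "tdeg \<alpha>" arbitrary: \<alpha> rule: less_induct)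
  case less
  have pk: "lookup p \<beta> \<in> KK j" for \<beta> using p by (simp add: mcarr_L)
  show ?case
  proof (rule ccontr)
    assume nz: "lookup p \<alpha> \<noteq> 0"
    have "coef 0 b (f (lookup p \<alpha>)) = 0" if b: "b \<in> B" for b
    proof -
      \<comment> \<open>A contribution from \<beta> \<noteq> \<alpha> would need x^\<beta> to be a
        proper divisor of x^\<alpha>, hence of smaller degree, where \<open>p\<close> vanishes by
        induction.\<close>
      have c: "coef \<alpha> b (sc F (single \<beta> 1) (f (lookup p \<beta>))) = (if \<beta> = \<alpha> then coef 0 b (f (lookup p \<alpha>)) else 0)"
        if \<beta>: "\<beta> \<in> keys p" for \<beta>
      proof (cases "\<beta> = \<alpha>")
        case True
        then show ?thesis
          using lookup_single_mult_plus[of \<alpha> 1 "rep (f (lookup p \<alpha>)) b" 0]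
          by (simp add: coef_scale f_carr pk) (simp add: coef_def)
      next
        case False
        have "\<not> tdeg \<beta> < tdeg \<alpha>"
        proof
          assume "tdeg \<beta> < tdeg \<alpha>"
          then have "lookup p \<beta> = 0" using less by (intro less.hyps) auto
          with \<beta> show False by (simp add: in_keys_iff)
        qed
        moreover have "tdeg \<beta> < tdeg \<alpha>" if nz: "lookup (single \<beta> 1 * rep (f (lookup p \<beta>)) b) \<alpha> \<noteq> 0"
        proof -
          obtain \<delta> \<gamma> where *: "\<alpha> = \<delta> + \<gamma>" "lookup (single \<beta> (1::'k)) \<delta> \<noteq> 0" using lookup_mult_nonzeroE[OF nz] by metis
          then have "\<delta> = \<beta>" by (auto simp: lookup_single when_def split: if_splits)
          with * False have "\<gamma> \<noteq> 0" by auto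
          then have "tdeg \<gamma> > 0" by (simp add: zero_less_iff_neq_zero)
          with * \<open>\<delta> = \<beta>\<close> show ?thesis by simp
        qed
        ultimately have "lookup (single \<beta> 1 * rep (f (lookup p \<beta>)) b) \<alpha> = 0" by blast
        with False show ?thesis by (simp add: coef_scale f_carr pk)
      qed
      have "0 = coef \<alpha> b (\<phi> p)" using low less.prems b by simp
      also have "\<dots> = (\<Sum>\<beta>\<in>keys p. if \<beta> = \<alpha> then coef 0 b (f (lookup p \<alpha>)) else 0)"
        unfolding lin_ext_def by (subst coef_sum) (auto simp: carr_scale f_carr pk c)
      also have "\<dots> = coef 0 b (f (lookup p \<alpha>))" using nz by (simp add: in_keys_iff)
      finally show ?thesis by simp
    qed
    then have "lookup p \<alpha> = 0" using inj_mod pk by blast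
    with nz show False by simp
  qed
qed

lemma \<phi>_inj: "p \<in> Lcarr j \<Longrightarrow> \<phi> p = 0 \<Longrightarrow> p = 0"
proof (rule poly_mapping_eqI)
  fix \<alpha> assume "p \<in> Lcarr j" "\<phi> p = 0"
  then show "lookup p \<alpha> = lookup 0 \<alpha>" using \<phi>_low[of p "tdeg \<alpha>" \<alpha>] by simp
qed

lemma \<phi>_inj_on: "inj_on \<phi> (Lcarr j)"
proof (rule inj_onI)
  fix p q assume "p \<in> Lcarr j" "q \<in> Lcarr j" "\<phi> p = \<phi> q"
  then have "p - q = 0" by (intro \<phi>_inj mcarr_L_diff) (auto simp: \<phi>_diff)
  then show "p = q" by simp
qed

lemma coef_\<phi>_0:
  assumes p: "p \<in> Lcarr j"
  shows "coef 0 b (\<phi> p) = coef 0 b (f (lookup p 0))"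
proof -
  have pk: "lookup p \<beta> \<in> KK j" for \<beta> using p by (simp add: mcarr_L)
  have "coef 0 b (\<phi> p) = (\<Sum>\<alpha>\<in>keys p. if \<alpha> = 0 then coef 0 b (f (lookup p 0)) else 0)"
    unfolding lin_ext_def
  proof (subst coef_sum)
    show "(\<Sum>\<alpha>\<in>keys p. coef 0 b (sc F (single \<alpha> 1) (f (lookup p \<alpha>)))) =
      (\<Sum>\<alpha>\<in>keys p. if \<alpha> = 0 then coef 0 b (f (lookup p 0)) else 0)"
      by (rule sum.cong) (auto simp: f_carr pk coef_scale_zero lookup_single when_def)
  qed (simp_all add: carr_scale f_carr pk)
  then show ?thesis by (auto simp: in_keys_iff)
qed

text \<open>Directness is inherited from F along \<open>\<phi>\<close>, which preserves degrees and
  is injective.\<close>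

lemma L_grading: "grading (Lpt j)"
proof
  show "is_grading (Lpt j)"
    unfolding is_grading_def
  proof (intro conjI allI impI ballI)
    fix g assume g: "(\<forall>a. lookup g a \<in> Lpt j a) \<and> (\<Sum>a\<in>keys g. lookup g a) = 0"
    have "(\<Sum>a\<in>keys g. \<phi> (lookup g a)) = \<phi> (\<Sum>a\<in>keys g. lookup g a)" by (simp add: \<phi>_sum)
    then have "\<phi> (lookup g a) = 0" if "a \<in> keys g" for a
      using g that by (intro P.direct[of "keys g" "\<lambda>a. \<phi> (lookup g a)" a]) (auto intro: \<phi>_pt)
    then have "lookup g a = 0" if "a \<in> keys g" for a
      using \<phi>_inj[of "lookup g a"] g that pt_L_carr by blast
    then show "g = 0" by (metis in_keys_iff lookup_zero poly_mapping_eqI)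
  qed (auto intro: pt_L_zero pt_L_add pt_L_neg)
qed

lemma \<phi>_pt_iff: "p \<in> Lcarr j \<Longrightarrow> \<phi> p \<in> pt F c \<Longrightarrow> p \<in> Lpt j c"
  by (rule graded_preimage[where f = \<phi> and H = "pt F"])
     (auto intro: L_grading P.grading_axioms \<phi>_add \<phi>_pt \<phi>_inj)

end

section \<open>Lifting a strand into a minimal resolution\<close>

text \<open>\<open>generated_in_degree\<close> speaks of an ungraded span. Cutting the coefficients
  into monomials and comparing degrees shows that a homogeneous element needs only coefficients of
  degree \<open>a - d\<close>.\<close>

lemma (in gmod) generated_pt:
  assumes gen: "generated_in_degree F d" and x: "x \<in> pt F a"
  shows "x \<in> K.span {sc F s u | s u. s \<in> Sg (a - d) \<and> u \<in> pt F d}"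
proof -
  let ?G = "\<lambda>a. K.span {sc F s u | s u. s \<in> Sg (a - d) \<and> u \<in> pt F d}"
  have sub: "?G a \<subseteq> pt F a" for a
  proof (rule K.span_minimal)
    show "{sc F s u | s u. s \<in> Sg (a - d) \<and> u \<in> pt F d} \<subseteq> pt F a"
      using scale_in[of _ "a - d" _ d] by auto
    show "K.subspace (pt F a)" by (rule K.subspaceI) (auto intro: Const_scale_in)
  qed
  have h: "sc F s u \<in> carr ?G" if u: "u \<in> pt F d" for s u
  proof (subst scale_expand, rule carr_sum)
    fix \<alpha>
    have "sc F (single \<alpha> 1) (sc F (Const (lookup s \<alpha>)) u) \<in> ?G (wt w \<alpha> + d)"
      by (intro K.span_base CollectI exI[of _ "single \<alpha> 1"] exI[of _ "sc F (Const (lookup s \<alpha>)) u"]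
          conjI refl Const_scale_in u) (simp add: single_in)
    then show "sc F (single \<alpha> 1) (sc F (Const (lookup s \<alpha>)) u) \<in> carr ?G"
      by (rule in_carrI[rotated]) (rule K.span_zero)
  qed (rule K.span_zero K.span_add; assumption)+
  have "F.span (pt F d) \<subseteq> carr ?G"
  proof
    fix v assume "v \<in> F.span (pt F d)"
    then show "v \<in> carr ?G"
    proof (induction rule: F.span_induct_alt)
      case base
      show ?case by (rule in_carrI[of ?G 0 0]) (rule K.span_zero)+
    next
      case (step c x y)
      then show ?case by (intro carr_add h) (rule K.span_zero K.span_add; assumption)+
    qed
  qed
  moreover have "x \<in> F.span (pt F d)" using gen P.carrI[OF x] by (simp add: generated_in_degree_def)
  ultimately have c: "x \<in> carr ?G" by (rule subsetD)
  show ?thesis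
    by (rule graded_refine[OF P.grading_axioms sub _ _ c x]) (rule K.span_zero K.span_add; assumption)+
qed

text \<open>If \<theta>(a - d) is negative, no monomial has weight \<open>a - d\<close>, and so
  \<open>Sg (a - d)\<close> is zero. The lower bound on the degrees of the resolution starts from
  here.\<close>

lemma (in gmod) generated_bounded:
  assumes gen: "generated_in_degree F d" and x: "x \<in> pt F a" "x \<noteq> 0"
  shows "\<theta> d \<le> \<theta> a"
proof (rule ccontr)
  assume *: "\<not> \<theta> d \<le> \<theta> a"
  have z: "s = 0" if "s \<in> Sg (a - d)" for s
  proof (rule poly_mapping_eqI)
    fix \<alpha>
    show "lookup s \<alpha> = lookup 0 \<alpha>"
    proof (rule ccontr)
      assume "lookup s \<alpha> \<noteq> lookup 0 \<alpha>"
      then have "wt w \<alpha> = a - d" using that by (auto simp: Sg_iff)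
      then have "\<theta> (wt w \<alpha>) = \<theta> a - \<theta> d" by simp
      with * \<theta>_wt_nonneg[of \<alpha>] show False by simp
    qed
  qed
  have "{sc F s u | s u. s \<in> Sg (a - d) \<and> u \<in> pt F d} \<subseteq> {0}" using z by fastforce
  then have "K.span {sc F s u | s u. s \<in> Sg (a - d) \<and> u \<in> pt F d} \<subseteq> {0}"
    by (rule K.span_minimal) simp
  with generated_pt[OF gen x(1)] x(2) show False by auto
qed

text \<open>Prescribing the values on \<open>W\<close> later forces the lifted chain map to hit a given subcomplex.\<close>

lemma graded_lift:
  fixes F :: "('a::ab_group_add, ('v::finite, 'k::field) mpol, 'f::ab_group_add) gmod"
    and kX :: "'k \<Rightarrow> 'x::ab_group_add \<Rightarrow> 'x"
  assumes egr: "egr Sg w \<theta> N" and gmod: "gmod Sg w \<theta> F"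
    and T: "module_hom (ksc N) kX T"
    and D_add: "\<And>x y. x \<in> mcarr F \<Longrightarrow> y \<in> mcarr F \<Longrightarrow> D (x + y) = D x + D y"
    and D_scale: "\<And>c x. x \<in> mcarr F \<Longrightarrow> D (sc F (Const c) x) = kX c (D x)"
    and lift: "\<And>b y. y \<in> gr N (b, j) \<Longrightarrow> \<exists>x\<in>pt F b. D x = T y"
    and W: "W \<subseteq> (\<Union>a. pt F a)"
    and W_lift: "\<And>b c. c \<in> W \<Longrightarrow> c \<in> pt F b \<Longrightarrow> \<exists>y\<in>gr N (b, j). T y = D c"
    and W_ind: "\<And>U l. finite U \<Longrightarrow> U \<subseteq> W \<Longrightarrow> D (\<Sum>c\<in>U. sc F (Const (l c)) c) = 0 \<Longrightarrow> \<forall>c\<in>U. l c = 0"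
  obtains f where "module_hom (ksc N) (\<lambda>c. sc F (Const c)) f"
    and "\<And>b y. y \<in> gr N (b, j) \<Longrightarrow> f y \<in> pt F b"
    and "\<And>y. y \<in> egr.KK N j \<Longrightarrow> D (f y) = T y"
    and "W \<subseteq> f ` egr.KK N j"
proof -
  interpret egr Sg w \<theta> N by fact
  interpret gmod Sg w \<theta> F by fact
  interpret T: module_hom "ksc N" kX T by fact
  interpret VP: vector_space_pair "ksc N" "\<lambda>c. sc F (Const c)" by unfold_locales
  interpret G: grading "\<lambda>b. gr N (b, j)" by (rule G)
  have D0: "D 0 = 0" using D_add[of 0 0] by simp
  have Wc: "c \<in> mcarr F" if "c \<in> W" for c using W that P.carrI by blast
  have D_sum: "D (\<Sum>c\<in>U. sc F (Const (l c)) c) = (\<Sum>c\<in>U. kX (l c) (D c))" if "U \<subseteq> W" for U l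
    using that
  proof (induction U rule: infinite_finite_induct)
    case (insert x U)
    then have "(\<Sum>c\<in>U. sc F (Const (l c)) c) \<in> mcarr F"
      by (intro P.carr_sum carr_scale Wc) auto
    then show ?case using insert by (simp add: D_add D_scale Wc carr_scale)
  qed (simp_all add: D0)
  have "\<exists>y. \<exists>b. c \<in> pt F b \<and> y \<in> gr N (b, j) \<and> T y = D c" if "c \<in> W" for c
    using W W_lift that by blast
  \<comment> \<open>\<open>\<eta> c\<close> is the element of N that has to be sent to
    \<open>c\<close>. By \<open>W_ind\<close> the \<open>\<eta> c\<close> are independent, so this
    prescription is consistent and the \<open>\<eta> c\<close> extend to a homogeneous basis
    \<open>Y\<close>.\<close>
  then obtain \<eta> where \<eta>: "\<And>c. c \<in> W \<Longrightarrow> \<exists>b. c \<in> pt F b \<and> \<eta> c \<in> gr N (b, j) \<and> T (\<eta> c) = D c"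
    by metis
  have T\<eta>: "D (\<Sum>c\<in>U. sc F (Const (l c)) c) = T (\<Sum>c\<in>U. ksc N (l c) (\<eta> c))" if "U \<subseteq> W" for U l
    unfolding D_sum[OF that] T.sum T.scale using \<eta> that by (intro sum.cong refl) (metis subsetD)
  have \<eta>_ind: "\<forall>c\<in>U. l c = 0" if "finite U" "U \<subseteq> W" "(\<Sum>c\<in>U. ksc N (l c) (\<eta> c)) = 0" for U l
    using W_ind[OF that(1,2), of l] T\<eta>[OF that(2), of l] that(3) by simp
  have inj: "inj_on \<eta> W"
    by (rule N.independent_image(1)[where f = \<eta> and W = W]) (rule \<eta>_ind)
  have ind: "N.independent (\<eta> ` W)"
    by (rule N.independent_image(2)[where f = \<eta> and W = W]) (rule \<eta>_ind)
  let ?V = "\<Union>b. gr N (b, j)"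
  have "\<eta> ` W \<subseteq> ?V" using \<eta> by blast
  then obtain Y where Y: "\<eta> ` W \<subseteq> Y" "Y \<subseteq> ?V" "N.independent Y" "?V \<subseteq> N.span Y"
    using N.maximal_independent_subset_extend[OF _ ind] by metis
  have Y0: "y \<noteq> 0" if "y \<in> Y" for y using Y(3) that N.dependent_zero by blast
  \<comment> \<open>A nonzero vector lies in one component only, so a homogeneous lift can be chosen
    separately for each element of \<open>Y\<close>.\<close>
  have uniq: "b' = b" if "y \<in> Y" "y \<in> gr N (b', j)" "y \<in> gr N (b, j)" for y b b'
    using G.disjoint[OF that(2,3)] Y0[OF that(1)] by blast
  have "\<exists>x. D x = T y \<and> (\<forall>b. y \<in> gr N (b, j) \<longrightarrow> x \<in> pt F b) \<and> (\<forall>c\<in>W. y = \<eta> c \<longrightarrow> x = c)" if y: "y \<in> Y" for y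
  proof (cases "y \<in> \<eta> ` W")
    case True
    then obtain c where c: "c \<in> W" "y = \<eta> c" by blast
    then obtain b where b: "c \<in> pt F b" "\<eta> c \<in> gr N (b, j)" "T (\<eta> c) = D c" using \<eta> by blast
    have "b' = b" if "y \<in> gr N (b', j)" for b'
      using uniq[OF y that, of b] b(2) c(2) by blast
    then have u: "c \<in> pt F b'" if "y \<in> gr N (b', j)" for b' using that b(1) by blast
    show ?thesis
    proof (intro exI[of _ c] conjI allI impI ballI u)
      show "D c = T y" using b(3) c(2) by simp
      show "c = c'" if "c' \<in> W" "y = \<eta> c'" for c' using inj_onD[OF inj, of c c'] that c by simp
    qed
  next
    case False
    obtain b where b: "y \<in> gr N (b, j)" using Y(2) y by blast
    obtain x where x: "x \<in> pt F b" "D x = T y" using lift[OF b] by blast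
    have "b' = b" if "y \<in> gr N (b', j)" for b' using uniq[OF y that b] .
    then have u: "x \<in> pt F b'" if "y \<in> gr N (b', j)" for b' using that x(1) by blast
    show ?thesis
    proof (intro exI[of _ x] conjI allI impI ballI u x(2))
      show "x = c" if "c \<in> W" "y = \<eta> c" for c using that False by blast
    qed
  qed
  then have "\<forall>y\<in>Y. \<exists>x. D x = T y \<and> (\<forall>b. y \<in> gr N (b, j) \<longrightarrow> x \<in> pt F b) \<and> (\<forall>c\<in>W. y = \<eta> c \<longrightarrow> x = c)"
    by blast
  from bchoice[OF this] obtain g where
    gg: "\<forall>y\<in>Y. D (g y) = T y \<and> (\<forall>b. y \<in> gr N (b, j) \<longrightarrow> g y \<in> pt F b) \<and> (\<forall>c\<in>W. y = \<eta> c \<longrightarrow> g y = c)" ..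
  then have g: "\<And>y. y \<in> Y \<Longrightarrow> D (g y) = T y" "\<And>y b. y \<in> Y \<Longrightarrow> y \<in> gr N (b, j) \<Longrightarrow> g y \<in> pt F b"
    "\<And>y c. y \<in> Y \<Longrightarrow> c \<in> W \<Longrightarrow> y = \<eta> c \<Longrightarrow> g y = c" by blast+
  define f where "f = VP.construct Y g"
  have f_hom: "module_hom (ksc N) (\<lambda>c. sc F (Const c)) f"
    unfolding f_def module_hom_iff_linear by (rule VP.linear_construct[OF Y(3)])
  interpret f: module_hom "ksc N" "\<lambda>c. sc F (Const c)" f by (rule f_hom)
  have f_Y: "f y = g y" if "y \<in> Y" for y unfolding f_def by (rule VP.construct_basis[OF Y(3) that])
  \<comment> \<open>A homogeneous basis splits into bases of the components, so it is enough that
    the degrees are right on \<open>Y\<close>.\<close>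
  have f_gr: "f y \<in> pt F b" if y: "y \<in> gr N (b, j)" for y b
  proof -
    let ?G = "\<lambda>b. N.span (Y \<inter> gr N (b, j))"
    have sub: "?G b \<subseteq> gr N (b, j)" for b
      by (rule N.span_minimal) (auto intro!: N.subspaceI intro: gr_ksc)
    have "v \<in> carr ?G" if "v \<in> N.span Y" for v
      using that
    proof (induction rule: N.span_induct_alt)
      case base
      show ?case by (rule in_carrI[of ?G 0 0]) (rule N.span_zero)+
    next
      case (step c u v)
      then obtain b where "u \<in> gr N (b, j)" using Y(2) by blast
      then have "ksc N c u \<in> ?G b" using step by (intro N.span_scale N.span_base) auto
      then have "ksc N c u \<in> carr ?G" by (rule in_carrI[rotated]) (rule N.span_zero)
      then show ?case by (intro carr_add step) (rule N.span_zero N.span_add; assumption)+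
    qed
    then have c: "y \<in> carr ?G" using y Y(4) by blast
    have "y \<in> ?G b"
      by (rule graded_refine[OF G.grading_axioms sub _ _ c y]) (rule N.span_zero N.span_add; assumption)+
    then show ?thesis
    proof (induction rule: N.span_induct_alt)
      case (step c x y)
      then show ?case using g(2) f_Y by (auto simp: f.add f.scale intro!: Const_scale_in)
    qed simp
  qed
  have KK_span: "y \<in> N.span Y" if y: "y \<in> KK j" for y
  proof -
    obtain A h where "\<And>a. h a \<in> gr N (a, j)" "y = (\<Sum>a\<in>A. h a)" using carrE y[unfolded KK_def] by metis
    then show ?thesis using Y(4) by (auto intro!: N.span_sum)
  qed
  have Df: "f y \<in> mcarr F \<and> D (f y) = T y" if "y \<in> N.span Y" for y
    using that
  proof (induction rule: N.span_induct_alt)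
    case base
    then show ?case using D0 T.zero by simp
  next
    case (step c x y)
    then have "f x \<in> mcarr F" using Y(2) f_gr P.carrI by blast
    then show ?case
      using step(2) g(1)[OF step(1)] f_Y[OF step(1)]
      by (simp add: f.add f.scale D_add D_scale carr_scale T.add T.scale P.carr_add)
  qed
  show ?thesis
  proof (rule that[OF f_hom f_gr])
    show "D (f y) = T y" if "y \<in> KK j" for y using Df[OF KK_span[OF that]] by blast
    show "W \<subseteq> f ` KK j"
    proof
      fix c assume c: "c \<in> W"
      then have "\<eta> c \<in> Y" using Y(1) by blast
      then have "f (\<eta> c) = c" using f_Y g(3) c by metis
      moreover have "\<eta> c \<in> KK j" using \<eta>[OF c] KK_I by blast
      ultimately show "c \<in> f ` KK j" by (metis imageI)
    qed
  qed
qed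

text \<open>The properties of K_d(M) on which the comparison with F rests. \<open>ev\<close>
  identifies auxiliary degree 0 with M_d. By \<open>e_inj\<close> and the two lifting conditions,
  N_{j+1} is as large as possible: its elements correspond to the families (z_i) in N_j that are
  linear syzygies of M for j = 0, or satisfy the exterior relations for j > 0.\<close>

locale strand = egr Sg w \<theta> N + M: gmod Sg w \<theta> M
  for Sg :: "'a::ab_group_add \<Rightarrow> ('v::finite, 'k::field) mpol set" and w \<theta>
    and N :: "('a, 'v, 'k, 'n::ab_group_add) emod"
    and M :: "('a, ('v, 'k) mpol, 'm::ab_group_add) gmod" +
  fixes d :: 'a and ev :: "'n \<Rightarrow> 'm"
  assumes generated: "generated_in_degree M d"
    and ev_hom: "module_hom (ksc N) (\<lambda>c. sc M (Const c)) ev"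
    and gr_neg: "j < 0 \<Longrightarrow> gr N (b, j) = {0}"
    and gr_0: "y \<in> KK 0 \<Longrightarrow> y \<in> gr N (d, 0)"
    and gr_bounded: "y \<in> gr N (b, j) \<Longrightarrow> y \<noteq> 0 \<Longrightarrow> \<theta> d \<le> \<theta> b"
    and e_gr: "y \<in> gr N (b, j) \<Longrightarrow> e j i y \<in> gr N (b - w i, j - 1)"
    and e_inj: "j > 0 \<Longrightarrow> y \<in> KK j \<Longrightarrow> (\<And>i. e j i y = 0) \<Longrightarrow> y = 0"
    and ev_inj: "y \<in> KK 0 \<Longrightarrow> ev y = 0 \<Longrightarrow> y = 0"
    and ev_gr: "y \<in> gr N (d, 0) \<Longrightarrow> ev y \<in> pt M d"
    and ev_surj: "m \<in> pt M d \<Longrightarrow> \<exists>y\<in>gr N (d, 0). ev y = m"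
    and e_lift_0: "(\<And>i. z i \<in> KK 0) \<Longrightarrow>
      (\<Sum>i\<in>UNIV. sc M (Var i) (ev (z i))) = 0 \<longleftrightarrow> (\<exists>y\<in>KK 1. \<forall>i. e 1 i y = z i)"
    and e_lift: "j > 0 \<Longrightarrow> (\<And>i. z i \<in> KK j) \<Longrightarrow>
      (\<forall>i. e j i (z i) = 0) \<and> (\<forall>i l. e j i (z l) + e j l (z i) = 0) \<longleftrightarrow>
      (\<exists>y\<in>KK (j + 1). \<forall>i. e (j + 1) i y = z i)"
begin

sublocale ev: module_hom "ksc N" "\<lambda>c. sc M (Const c)" ev by (rule ev_hom)

lemma e_KK: "y \<in> KK j \<Longrightarrow> e j i y \<in> KK (j - 1)"
  unfolding KK_def
  by (rule carr_map[where G = "\<lambda>b. gr N (b, j)" and f = "e j i"])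
     (auto intro: grading.zero[OF G] grading.add[OF G] grading.carrI[OF G] e_gr simp: e_sum)

lemma KK_neg: "j < 0 \<Longrightarrow> KK j = {0}"
proof
  assume j: "j < 0"
  show "KK j \<subseteq> {0}"
  proof
    fix y assume "y \<in> KK j"
    then obtain A h where "\<And>a. h a \<in> gr N (a, j)" "y = (\<Sum>a\<in>A. h a)" unfolding KK_def using carrE by metis
    then show "y \<in> {0}" using gr_neg[OF j] by simp
  qed
qed simp

lemma L_diff_carr: "p \<in> Lcarr j \<Longrightarrow> L_diff N j p \<in> Lcarr (j - 1)"
  unfolding L_diff_def e_def[symmetric]
  by (intro mcarr_L_sum tens_mcarr e_KK) (simp add: mcarr_L)

lemma L_diff_pt: "p \<in> Lpt j c \<Longrightarrow> L_diff N j p \<in> Lpt (j - 1) c"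
proof -
  assume p: "p \<in> Lpt j c"
  have "tens (Var i * single \<alpha> 1) (e j i (lookup p \<alpha>)) \<in> Lpt (j - 1) c" for \<alpha> i
  proof -
    have "e j i (lookup p \<alpha>) \<in> gr N (c - wt w \<alpha> - w i, j - 1)"
      using p by (intro e_gr) (simp add: pt_L)
    from tens_single_pt[OF this, of "single i (Suc 0) + \<alpha>" 1]
    show ?thesis by (simp add: Var_mult_single)
  qed
  then have "(\<Sum>i\<in>B. tens (Var i * single \<alpha> 1) (e j i (lookup p \<alpha>))) \<in> Lpt (j - 1) c" for B \<alpha>
    by (induction B rule: infinite_finite_induct) (auto intro: pt_L_add pt_L_zero)
  then have "(\<Sum>\<alpha>\<in>A. \<Sum>i\<in>UNIV. tens (Var i * single \<alpha> 1) (e j i (lookup p \<alpha>))) \<in> Lpt (j - 1) c" for A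
    by (induction A rule: infinite_finite_induct) (auto intro: pt_L_add pt_L_zero)
  then show ?thesis unfolding L_diff_def e_def[symmetric] .
qed

lemma tens_1: "lookup (tens 1 y) 0 = y"
  by (simp add: lookup_tens)

end

lemma Var_Var_lookup:
  "lookup (Var l * Var i :: ('v, 'k::field) mpol) \<gamma> = (if \<gamma> = single l 1 + single i 1 then 1 else 0)"
  by (simp add: Var_def mult_single lookup_single when_def)

lemma single_pair_eq:
  "single l (1::nat) + single i 1 = single a 1 + single b 1 \<longleftrightarrow> l = a \<and> i = b \<or> l = b \<and> i = a"
proof
  assume *: "single l (1::nat) + single i 1 = single a 1 + single b 1"
  have "lookup (single l (1::nat) + single i 1) x = lookup (single a 1 + single b 1) x" for x
    by (simp only: *)
  from this[of l] this[of i] show "l = a \<and> i = b \<or> l = b \<and> i = a"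
    by (auto simp: lookup_add lookup_single when_def split: if_splits)
qed (auto simp: add.commute)

section \<open>Minimal free resolutions of a module generated in one degree\<close>

locale resol = strand Sg w \<theta> N M d ev
  for Sg :: "'a::ab_group_add \<Rightarrow> ('v::finite, 'k::field) mpol set" and w \<theta>
    and N :: "('a, 'v, 'k, 'n::ab_group_add) emod"
    and M :: "('a, ('v, 'k) mpol, 'm::ab_group_add) gmod" and d ev +
  fixes R :: "('a, ('v, 'k) mpol, 'f::ab_group_add) cplx" and BR and \<epsilon> :: "'f \<Rightarrow> 'm"
  assumes complex: "graded_complex Sg R"
    and bases: "homogeneous_basis (md R j) (BR j)"
    and R_neg: "j < 0 \<Longrightarrow> mcarr (md R j) = {0}"
    and exact: "j > 0 \<Longrightarrow> {x \<in> mcarr (md R j). df R j x = 0} = df R (j + 1) ` mcarr (md R (j + 1))"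
    and \<epsilon>_hom: "graded_hom (md R 0) M \<epsilon>"
    and \<epsilon>_surj: "\<epsilon> ` mcarr (md R 0) = mcarr M"
    and \<epsilon>_ker: "{x \<in> mcarr (md R 0). \<epsilon> x = 0} = df R 1 ` mcarr (md R 1)"
    and minimal: "df R j ` mcarr (md R j) \<subseteq> module.span (sc (md R (j - 1)))
        {sc (md R (j - 1)) (Var i) x | i x. x \<in> mcarr (md R (j - 1))}"
begin

sublocale R: gfree Sg w \<theta> "md R j" "BR j" for j
  using complex bases by unfold_locales (auto simp: graded_complex_def)

abbreviation Rcarr where "Rcarr j \<equiv> mcarr (md R j)"

abbreviation Rpt where "Rpt j \<equiv> pt (md R j)"

abbreviation Rsc where "Rsc j \<equiv> sc (md R j)"

lemma df_add: "x \<in> Rcarr j \<Longrightarrow> y \<in> Rcarr j \<Longrightarrow> df R j (x + y) = df R j x + df R j y"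
  and df_scale: "x \<in> Rcarr j \<Longrightarrow> df R j (Rsc j s x) = Rsc (j - 1) s (df R j x)"
  and df_pt: "x \<in> Rpt j a \<Longrightarrow> df R j x \<in> Rpt (j - 1) a"
  and df_df: "x \<in> Rcarr j \<Longrightarrow> df R (j - 1) (df R j x) = 0"
  using complex by (auto simp: graded_complex_def graded_hom_def linear_on_def)

lemma df_0 [simp]: "df R j 0 = 0"
  using df_add[of 0 j 0] by simp

lemma df_sum: "(\<And>x. x \<in> A \<Longrightarrow> h x \<in> Rcarr j) \<Longrightarrow> df R j (\<Sum>x\<in>A. h x) = (\<Sum>x\<in>A. df R j (h x))"
  by (induction A rule: infinite_finite_induct) (auto simp: df_add R.P.carr_sum)

lemma df_diff: "x \<in> Rcarr j \<Longrightarrow> y \<in> Rcarr j \<Longrightarrow> df R j (x - y) = df R j x - df R j y"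
  using df_add[of "x - y" j y] R.P.carr_diff[of x j y] by simp

lemma df_mm: "x \<in> Rcarr j \<Longrightarrow> df R j x \<in> R.mm (j - 1)"
  using minimal[of j] unfolding R.mm_def by blast

lemma df_carr: "x \<in> Rcarr j \<Longrightarrow> df R j x \<in> Rcarr (j - 1)"
  using df_mm R.mm_subset by blast

lemma eps_add: "x \<in> Rcarr 0 \<Longrightarrow> y \<in> Rcarr 0 \<Longrightarrow> \<epsilon> (x + y) = \<epsilon> x + \<epsilon> y"
  and eps_scale: "x \<in> Rcarr 0 \<Longrightarrow> \<epsilon> (Rsc 0 s x) = sc M s (\<epsilon> x)"
  and eps_pt: "x \<in> Rpt 0 a \<Longrightarrow> \<epsilon> x \<in> pt M a"
  using \<epsilon>_hom by (auto simp: graded_hom_def linear_on_def image_subset_iff)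

lemma eps_0 [simp]: "\<epsilon> 0 = 0"
  using eps_add[of 0 0] by simp

lemma eps_sum: "(\<And>x. x \<in> A \<Longrightarrow> h x \<in> Rcarr 0) \<Longrightarrow> \<epsilon> (\<Sum>x\<in>A. h x) = (\<Sum>x\<in>A. \<epsilon> (h x))"
  by (induction A rule: infinite_finite_induct) (auto simp: eps_add R.P.carr_sum)

lemma eps_diff: "x \<in> Rcarr 0 \<Longrightarrow> y \<in> Rcarr 0 \<Longrightarrow> \<epsilon> (x - y) = \<epsilon> x - \<epsilon> y"
  using eps_add[of "x - y" y] R.P.carr_diff[of x 0 y] by simp

text \<open>The boundaries. They are the cycles for positive \<open>j\<close> and the kernel of
  \<open>\<epsilon>\<close> for \<open>j = 0\<close>, and the common notation lets both cases share
  the lifting argument.\<close>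

definition Z :: "int \<Rightarrow> 'f set"
  where "Z j = df R (j + 1) ` Rcarr (j + 1)"

lemma Z_pos: "j > 0 \<Longrightarrow> x \<in> Rcarr j \<Longrightarrow> x \<in> Z j \<longleftrightarrow> df R j x = 0"
  using exact[of j] by (auto simp: Z_def)

lemma Z_zero: "x \<in> Rcarr 0 \<Longrightarrow> x \<in> Z 0 \<longleftrightarrow> \<epsilon> x = 0"
  using \<epsilon>_ker by (auto simp: Z_def)

lemma Z_mm: "x \<in> Z j \<Longrightarrow> x \<in> R.mm j"
  using df_mm[of _ "j + 1"] by (auto simp: Z_def)

lemma Z_lift:
  assumes x: "x \<in> Z j" "x \<in> Rpt j b"
  shows "\<exists>u\<in>Rpt (j + 1) b. df R (j + 1) u = x"
proof -
  obtain v where v: "v \<in> Rcarr (j + 1)" "df R (j + 1) v = x" using x(1) by (auto simp: Z_def)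
  obtain u where "u \<in> Rpt (j + 1) b" "df R (j + 1) u = df R (j + 1) v"
  proof (rule graded_component[where G = "Rpt (j + 1)" and H = "Rpt j"
        and f = "df R (j + 1)" and x = v and b = b])
    show "df R (j + 1) y \<in> Rpt j a" if "y \<in> Rpt (j + 1) a" for a y
      using df_pt[OF that] by simp
  qed (use v x R.P.grading_axioms df_add in auto)
  then show ?thesis using v by auto
qed

lemma eps_lift:
  assumes m: "m \<in> pt M b"
  shows "\<exists>u\<in>Rpt 0 b. \<epsilon> u = m"
proof -
  obtain v where v: "v \<in> Rcarr 0" "\<epsilon> v = m" using \<epsilon>_surj M.P.carrI[OF m] by (metis imageE)
  obtain u where "u \<in> Rpt 0 b" "\<epsilon> u = \<epsilon> v"
    by (rule graded_component[where G = "Rpt 0" and H = "pt M" and f = \<epsilon> and x = v and b = b])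
       (use v m M.P.grading_axioms eps_add eps_pt in auto)
  then show ?thesis using v by auto
qed

text \<open>On coefficients: if x lies in \<mm>F, then its differential lies in \<mm>^2F, because
  the differential is S-linear and by minimality already maps the basis into \<mm>F.\<close>

lemma df_low:
  assumes x: "x \<in> Rcarr j" and x0: "\<And>b. b \<in> BR j \<Longrightarrow> R.coef j 0 b x = 0" and \<beta>: "tdeg \<beta> \<le> 1"
  shows "R.coef (j - 1) \<beta> b (df R j x) = 0"
proof -
  obtain U where U: "finite U" "U \<subseteq> BR j" "x = (\<Sum>b\<in>U. Rsc j (R.rep j x b) b)"
    by (rule R.expand[OF x], rule that)
  have Uc: "c \<in> Rcarr j" if "c \<in> U" for c using U(2) that R.B_carr by blast
  have "df R j x = (\<Sum>b\<in>U. Rsc (j - 1) (R.rep j x b) (df R j b))"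
    by (subst U(3)) (simp add: df_sum df_scale Uc R.carr_scale)
  also have "R.coef (j - 1) \<beta> b \<dots> = (\<Sum>c\<in>U. R.coef (j - 1) \<beta> b (Rsc (j - 1) (R.rep j x c) (df R j c)))"
    by (rule R.coef_sum) (simp add: R.carr_scale df_carr Uc)
  also have "\<dots> = 0"
  proof (rule sum.neutral, rule ballI, rule R.coef_low[OF _ _ _ \<beta>])
    fix c assume c: "c \<in> U"
    show "lookup (R.rep j x c) 0 = 0" using x0[of c] c U(2) by (auto simp: R.coef_def)
    show "df R j c \<in> Rcarr (j - 1)" by (rule df_carr[OF Uc[OF c]])
    show "R.coef (j - 1) 0 b (df R j c) = 0" by (rule R.mm_coef[OF df_mm[OF Uc[OF c]]])
  qed
  finally show ?thesis .
qed

text \<open>For b \<noteq> d the elements of M_b are combinations of M_d with coefficients that have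
  no constant term. So \<open>\<epsilon> c\<close> lifts to an element of \<mm>F_0, and
  \<open>c\<close> differs from it by an element of ker \<epsilon>, which lies in \<mm>F_0 by
  minimality. Hence values prescribed in homological degree 0 have degree \<open>d\<close>.\<close>

lemma degree_0:
  assumes c: "c \<in> Rpt 0 b" "c \<notin> R.mm 0"
  shows "b = d"
proof (rule ccontr)
  assume bd: "b \<noteq> d"
  have "\<exists>v\<in>R.mm 0. \<epsilon> v = m" if "m \<in> M.K.span {sc M s u | s u. s \<in> Sg (b - d) \<and> u \<in> pt M d}" for m
    using that
  proof (induction rule: M.K.span_induct_alt)
    case base
    show ?case using eps_0 R.F.span_zero unfolding R.mm_def by blast
  next
    case (step t x y)
    then obtain s u v where s: "x = sc M s u" "s \<in> Sg (b - d)" "u \<in> pt M d" and v: "v \<in> R.mm 0" "\<epsilon> v = y"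
      by blast
    obtain u' where u': "u' \<in> Rpt 0 d" "\<epsilon> u' = u" using eps_lift[OF s(3)] by blast
    have uc: "u' \<in> Rcarr 0" by (rule R.P.carrI[OF u'(1)])
    have vc: "v \<in> Rcarr 0" using v R.mm_subset by blast
    have s0: "lookup s 0 = 0" using s(2) bd by (auto simp: Sg_iff)
    have "Rsc 0 (Const t * s) u' + v \<in> R.mm 0"
      using R.scale_mm[of "Const t * s" u' 0] s0 uc v(1) unfolding R.mm_def by (simp add: R.F.span_add)
    moreover have "\<epsilon> (Rsc 0 (Const t * s) u' + v) = sc M (Const t) x + y"
      using uc vc u' v s by (simp add: eps_add eps_scale R.carr_scale)
    ultimately show ?case by blast
  qed
  then obtain v where v: "v \<in> R.mm 0" "\<epsilon> v = \<epsilon> c"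
    using M.generated_pt[OF generated eps_pt[OF c(1)]] by blast
  have cc: "c \<in> Rcarr 0" by (rule R.P.carrI[OF c(1)])
  have vc: "v \<in> Rcarr 0" using v R.mm_subset by blast
  have "c - v \<in> Z 0" using v cc vc by (subst Z_zero) (auto simp: eps_diff R.P.carr_diff)
  then have "c - v \<in> R.mm 0" by (rule Z_mm)
  with v(1) have "(c - v) + v \<in> R.mm 0" unfolding R.mm_def by (intro R.F.span_add)
  with c(2) show False by simp
qed

text \<open>By minimality a basis element is not a boundary. Its image under the differential, or
  under \<open>\<epsilon>\<close> for \<open>n = 0\<close>, is therefore a nonzero element of the
  same degree one step lower, where the bound is known.\<close>

lemma R_bounded: "b \<in> BR (int n) \<Longrightarrow> \<theta> d \<le> \<theta> (R.deg (int n) b)"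
proof (induction n arbitrary: b)
  case 0
  have b: "b \<in> BR 0" using 0 by simp
  have c: "b \<in> Rcarr 0" by (rule R.B_carr[OF b])
  have "R.coef 0 0 b b \<noteq> 0" using b by (simp add: R.coef_B)
  then have "b \<notin> Z 0" using Z_mm R.mm_coef by blast
  then have "\<epsilon> b \<noteq> 0" using Z_zero[OF c] by simp
  then show ?case
    using M.generated_bounded[OF generated eps_pt[OF R.deg[OF b]]] by simp
next
  case (Suc n)
  let ?j = "int (Suc n)"
  have c: "b \<in> Rcarr ?j" by (rule R.B_carr[OF Suc.prems])
  have "R.coef ?j 0 b b \<noteq> 0" using Suc.prems by (simp add: R.coef_B)
  then have "b \<notin> Z ?j" using Z_mm R.mm_coef by blast
  then have nz: "df R ?j b \<noteq> 0" using Z_pos[OF _ c] by simp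
  have j: "?j - 1 = int n" by simp
  have "df R ?j b \<in> Rpt (int n) (R.deg ?j b)" using df_pt[OF R.deg[OF Suc.prems]] unfolding j .
  then show ?case by (rule R.pt_bounded[rotated]) (use Suc.IH nz in auto)
qed

text \<open>Sets \<open>W j\<close> that are bases of the terms of a strongly linear, quasi-split subcomplex; the empty
  sets serve for the zero complex.\<close>

definition lin_basis :: "(int \<Rightarrow> 'f set) \<Rightarrow> bool"
  where "lin_basis W \<longleftrightarrow> (\<forall>j. W j \<subseteq> (\<Union>a. Rpt j a)) \<and>
    (\<forall>j U l. finite U \<longrightarrow> U \<subseteq> W j \<longrightarrow> (\<Sum>c\<in>U. Rsc j (Const (l c)) c) \<in> R.mm j \<longrightarrow> (\<forall>c\<in>U. l c = 0)) \<and>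
    (\<forall>j>0. \<forall>c\<in>W j. \<exists>z. (\<forall>i. z i \<in> R.K.span (j - 1) (W (j - 1))) \<and>
      df R j c = (\<Sum>i\<in>UNIV. Rsc (j - 1) (Var i) (z i)))"

lemma lin_basis_pt: "lin_basis W \<Longrightarrow> W j \<subseteq> (\<Union>a. Rpt j a)"
  by (simp add: lin_basis_def)

lemma lin_basis_carr: "lin_basis W \<Longrightarrow> c \<in> W j \<Longrightarrow> c \<in> Rcarr j"
  using lin_basis_pt R.P.carrI by blast

lemma lin_basis_ind:
  assumes W: "lin_basis W" and U: "finite U" "U \<subseteq> W j" "(\<Sum>c\<in>U. Rsc j (Const (l c)) c) \<in> R.mm j"
  shows "\<forall>c\<in>U. l c = 0"
proof -
  have "\<forall>j U l. finite U \<longrightarrow> U \<subseteq> W j \<longrightarrow> (\<Sum>c\<in>U. Rsc j (Const (l c)) c) \<in> R.mm j \<longrightarrow> (\<forall>c\<in>U. l c = 0)"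
    using W unfolding lin_basis_def by (elim conjE)
  from this[rule_format, of U j l] U show ?thesis by simp
qed

lemma lin_basis_df:
  assumes W: "lin_basis W" and c: "j > 0" "c \<in> W j"
  obtains z where "\<And>i. z i \<in> R.K.span (j - 1) (W (j - 1))"
    "df R j c = (\<Sum>i\<in>UNIV. Rsc (j - 1) (Var i) (z i))"
proof -
  have "\<forall>j>0. \<forall>c\<in>W j. \<exists>z. (\<forall>i. z i \<in> R.K.span (j - 1) (W (j - 1))) \<and>
      df R j c = (\<Sum>i\<in>UNIV. Rsc (j - 1) (Var i) (z i))"
    using W unfolding lin_basis_def by (elim conjE)
  from this[rule_format, OF c] that show ?thesis by blast
qed

text \<open>The third clause identifies \<open>K\<^bsub>j+1\<^esub>\<close> with the linear cycles that become boundaries in the resolution;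
  carrying it along makes the inductive step depend on the terms \<open>j\<close> and \<open>j + 1\<close> only.\<close>

definition lifts :: "(int \<Rightarrow> 'f set) \<Rightarrow> int \<Rightarrow> ('n \<Rightarrow> 'f) \<Rightarrow> bool"
  where "lifts W j f \<longleftrightarrow> kmap_free Sg w \<theta> N (md R j) j f (BR j) \<and> W j \<subseteq> f ` KK j \<and>
    (\<forall>z. (\<forall>i. z i \<in> KK j) \<longrightarrow> (\<Sum>i\<in>UNIV. Rsc j (Var i) (f (z i))) \<in> Z j \<longleftrightarrow>
      (\<exists>y\<in>KK (j + 1). \<forall>i. e (j + 1) i y = z i)) \<and>
    (j = 0 \<longrightarrow> (\<forall>y\<in>KK 0. \<epsilon> (f y) = ev y))"

lemma lifts_base:
  assumes W: "lin_basis W"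
  shows "\<exists>f. lifts W 0 f"
proof -
  have egr: "egr Sg w \<theta> N" by unfold_locales
  have gm: "gmod Sg w \<theta> (md R 0)" by unfold_locales
  have W0: "\<forall>c\<in>U. l c = 0" if "finite U" "U \<subseteq> W 0" "(\<Sum>c\<in>U. Rsc 0 (Const (l c)) c) \<in> R.mm 0" for U l
    by (rule lin_basis_ind[OF W that])
  note Wpt = lin_basis_pt[OF W, of 0] and Wc = lin_basis_carr[OF W, of _ 0]
  obtain f where f: "module_hom (ksc N) (\<lambda>c. Rsc 0 (Const c)) f"
    "\<And>b y. y \<in> gr N (b, 0) \<Longrightarrow> f y \<in> Rpt 0 b" "\<And>y. y \<in> KK 0 \<Longrightarrow> \<epsilon> (f y) = ev y" "W 0 \<subseteq> f ` KK 0"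
  proof (rule graded_lift[OF egr gm ev_hom, where D = \<epsilon> and W = "W 0" and j = 0])
    fix b y assume y: "y \<in> gr N (b, 0)"
    show "\<exists>x\<in>Rpt 0 b. \<epsilon> x = ev y"
    proof (cases "y = 0")
      case True
      then show ?thesis by (intro bexI[of _ 0]) auto
    next
      case False
      have y': "y \<in> gr N (d, 0)" by (rule gr_0[OF KK_I[OF y]])
      then have "b = d" using grading.disjoint[OF G y] False by blast
      then show ?thesis using eps_lift[OF ev_gr[OF y']] by simp
    qed
  next
    fix b c assume c: "c \<in> W 0" "c \<in> Rpt 0 b"
    have "c \<notin> R.mm 0" using W0[of "{c}" "\<lambda>_. 1"] c(1) by auto
    then have "b = d" using degree_0[OF c(2)] by simp
    then show "\<exists>y\<in>gr N (b, 0). ev y = \<epsilon> c" using ev_surj[of "\<epsilon> c"] eps_pt[OF c(2)] by simp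
  next
    fix U l assume U: "finite U" "U \<subseteq> W 0" and z: "\<epsilon> (\<Sum>c\<in>U. Rsc 0 (Const (l c)) c) = 0"
    have "(\<Sum>c\<in>U. Rsc 0 (Const (l c)) c) \<in> Rcarr 0"
      using U Wc by (intro R.P.carr_sum R.carr_scale) auto
    then have "(\<Sum>c\<in>U. Rsc 0 (Const (l c)) c) \<in> Z 0" using z by (simp add: Z_zero)
    then show "\<forall>c\<in>U. l c = 0" using W0[OF U] Z_mm by blast
  qed (use Wpt eps_add eps_scale in auto)
  interpret k: kmap Sg w \<theta> N "md R 0" 0 f
    by (intro kmap.intro egr gm kmap_axioms.intro f(1,2))
  have "lifts W 0 f"
    unfolding lifts_def
  proof (intro conjI allI impI ballI f(4) f(3))
    show "kmap_free Sg w \<theta> N (md R 0) 0 f (BR 0)"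
    proof unfold_locales
      fix y assume y: "y \<in> KK 0" and y0: "\<And>b. b \<in> BR 0 \<Longrightarrow> R.coef 0 0 b (f y) = 0"
      have x: "f y \<in> Rpt 0 d" by (rule f(2)[OF gr_0[OF y]])
      obtain U where U: "finite U" "U \<subseteq> BR 0" "f y = (\<Sum>b\<in>U. Rsc 0 (R.rep 0 (f y) b) b)"
        "\<And>b. b \<in> U \<longleftrightarrow> R.rep 0 (f y) b \<noteq> 0"
        by (rule R.expand[OF R.P.carrI[OF x]], rule that)
      \<comment> \<open>\<open>f y\<close> has degree \<open>d\<close> and no constant coefficients,
        so the basis elements in its expansion have \<theta>-degree below \<theta>(d), where M
        vanishes.\<close>
      have "\<epsilon> b = 0" if b: "b \<in> U" for b
      proof (rule ccontr)
        assume nz: "\<epsilon> b \<noteq> 0"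
        have bB: "b \<in> BR 0" using U(2) b by blast
        obtain \<alpha> where \<alpha>: "R.coef 0 \<alpha> b (f y) \<noteq> 0"
          using U(4) b by (metis R.coef_def lookup_zero poly_mapping_eqI)
        then have "\<alpha> \<noteq> 0" using y0[OF bB] by auto
        moreover have "d = wt w \<alpha> + R.deg 0 b" using R.coef_pt[OF x \<alpha>] by simp
        ultimately have "\<theta> (R.deg 0 b) < \<theta> d" using \<theta>_wt_pos by simp
        with M.generated_bounded[OF generated eps_pt[OF R.deg[OF bB]] nz] show False by simp
      qed
      then have "\<epsilon> (\<Sum>b\<in>U. Rsc 0 (R.rep 0 (f y) b) b) = 0"
        using U(2) R.B_carr by (subst eps_sum) (auto simp: eps_scale R.carr_scale subset_iff)
      then have "\<epsilon> (f y) = 0" using U(3) by simp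
      then show "y = 0" using f(3)[OF y] ev_inj[OF y] by simp
    qed
    fix z :: "'v \<Rightarrow> 'n" assume z: "\<forall>i. z i \<in> KK 0"
    have fz: "f (z i) \<in> Rcarr 0" for i using z k.f_carr by blast
    have "(\<Sum>i\<in>UNIV. Rsc 0 (Var i) (f (z i))) \<in> Z 0 \<longleftrightarrow> (\<Sum>i\<in>UNIV. sc M (Var i) (ev (z i))) = 0"
      using fz z by (subst Z_zero) (auto simp: eps_sum eps_scale R.carr_scale f(3) intro!: R.P.carr_sum)
    then show "(\<Sum>i\<in>UNIV. Rsc 0 (Var i) (f (z i))) \<in> Z 0 \<longleftrightarrow> (\<exists>y\<in>KK (0 + 1). \<forall>i. e (0 + 1) i y = z i)"
      using e_lift_0[of z] z by simp
  qed
  then show ?thesis by blast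
qed

lemma T_eq:
  assumes f: "kmap Sg w \<theta> N (md R j) j f"
  shows "lin_ext (md R j) f (L_diff N (j + 1) (tens 1 y)) = (\<Sum>i\<in>UNIV. Rsc j (Var i) (f (e (j + 1) i y)))"
proof -
  interpret k: kmap Sg w \<theta> N "md R j" j f by fact
  show ?thesis by (simp add: L_diff_tens' k.\<phi>_sum k.\<phi>_tens)
qed

text \<open>The sum is \<phi> applied to the differential of 1 \<otimes> y. If it vanishes up to
  total degree 1, so does that differential, whose coefficient at x_i is e_i y. The lemma serves
  twice: for injectivity of \<open>T\<close>, and for injectivity of the next map modulo
  \<mm>.\<close>

lemma T_low:
  assumes f: "kmap_free Sg w \<theta> N (md R j) j f (BR j)" and j: "j \<ge> 0" and y: "y \<in> KK (j + 1)"
    and z: "\<And>\<beta> b. tdeg \<beta> \<le> 1 \<Longrightarrow> b \<in> BR j \<Longrightarrow>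
      R.coef j \<beta> b (\<Sum>i\<in>UNIV. Rsc j (Var i) (f (e (j + 1) i y))) = 0"
  shows "y = 0"
proof (rule e_inj[of "j + 1"])
  interpret k: kmap_free Sg w \<theta> N "md R j" j f "BR j" by fact
  have p: "L_diff N (j + 1) (tens 1 y) \<in> Lcarr j"
    using L_diff_carr[OF tens_mcarr[OF y, of 1]] by simp
  fix i
  have "lookup (L_diff N (j + 1) (tens 1 y)) (single i 1) = 0"
    by (rule k.\<phi>_low[OF p, of 1]) (simp_all add: T_eq[OF k.kmap_axioms] z)
  then show "e (j + 1) i y = 0" by (simp only: lookup_L_diff tens_1)
qed (use j y in auto)

text \<open>The right-hand side of the equation for \<open>f'\<close> is a boundary by the third
  clause of \<open>lifts\<close>, so homogeneous solutions exist. Minimality then gives injectivity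
  of \<open>f'\<close> modulo \<mm>, and the exterior relations give the third clause one degree
  higher.\<close>

lemma lifts_step:
  assumes W: "lin_basis W" and j: "j \<ge> 0" and f: "lifts W j f"
  shows "\<exists>f'. lifts W (j + 1) f' \<and>
    (\<forall>y\<in>KK (j + 1). df R (j + 1) (f' y) = (\<Sum>i\<in>UNIV. Rsc j (Var i) (f (e (j + 1) i y))))"
proof -
  let ?j = "j + 1"
  have egr: "egr Sg w \<theta> N" by unfold_locales
  have gm: "gmod Sg w \<theta> (md R j)" for j by unfold_locales
  have gf: "gfree Sg w \<theta> (md R j) (BR j)" for j by unfold_locales
  have kf: "kmap_free Sg w \<theta> N (md R j) j f (BR j)" and Wf: "W j \<subseteq> f ` KK j"
    and cyc: "\<And>z. (\<And>i. z i \<in> KK j) \<Longrightarrow> (\<Sum>i\<in>UNIV. Rsc j (Var i) (f (z i))) \<in> Z j \<longleftrightarrow>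
      (\<exists>y\<in>KK (j + 1). \<forall>i. e (j + 1) i y = z i)"
    using f unfolding lifts_def by auto
  interpret k: kmap_free Sg w \<theta> N "md R j" j f "BR j" by (rule kf)
  define T where "T y = (\<Sum>i\<in>UNIV. Rsc j (Var i) (f (e ?j i y)))" for y
  have T_hom: "module_hom (ksc N) (\<lambda>c. Rsc j (Const c)) T"
    by unfold_locales
      (simp_all add: T_def e_add e_scale k.f.add k.f.scale R.F.scale_right_distrib sum.distrib
        R.F.scale_sum_right mult.commute)
  have e_KK': "e ?j i y \<in> KK j" if "y \<in> KK ?j" for i y using e_KK[OF that, of i] by simp
  have T_pt: "T y \<in> Rpt j b" if y: "y \<in> gr N (b, ?j)" for b y
    unfolding T_def
  proof (rule R.P.sum)
    fix i
    have "e ?j i y \<in> gr N (b - w i, j)" using e_gr[OF y] by simp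
    from R.Var_scale_in[OF k.f_gr[OF this], of i]
    show "Rsc j (Var i) (f (e ?j i y)) \<in> Rpt j b" by simp
  qed
  have T_Z: "T y \<in> Z j" if "y \<in> KK ?j" for y
    unfolding T_def by (subst cyc) (use e_KK' that in auto)
  have T_inj: "y = 0" if "y \<in> KK ?j" "T y = 0" for y
    by (rule T_low[OF kf j that(1)]) (use that(2) in \<open>simp add: T_def\<close>)
  note Wpt = lin_basis_pt[OF W, of ?j] and Wc = lin_basis_carr[OF W, of _ ?j]
  obtain f' where f': "module_hom (ksc N) (\<lambda>c. Rsc ?j (Const c)) f'"
    "\<And>b y. y \<in> gr N (b, ?j) \<Longrightarrow> f' y \<in> Rpt ?j b" "\<And>y. y \<in> KK ?j \<Longrightarrow> df R ?j (f' y) = T y" "W ?j \<subseteq> f' ` KK ?j"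
  proof (rule graded_lift[OF egr gm T_hom, where D = "df R ?j" and W = "W ?j" and j = ?j])
    fix b y assume y: "y \<in> gr N (b, ?j)"
    show "\<exists>x\<in>Rpt ?j b. df R ?j x = T y"
      by (rule Z_lift[OF T_Z[OF KK_I[OF y]] T_pt[OF y]])
  next
    fix b c assume c: "c \<in> W ?j" "c \<in> Rpt ?j b"
    \<comment> \<open>The differential of \<open>c\<close> is a linear expression in the span of
      \<open>W j\<close>, hence in values of \<open>f\<close>. Being a boundary, it comes from an
      element of N_{j+1} by the third clause of \<open>lifts\<close>.\<close>
    obtain z where z: "\<And>i. z i \<in> R.K.span j (W j)" "df R ?j c = (\<Sum>i\<in>UNIV. Rsc j (Var i) (z i))"
      using lin_basis_df[OF W _ c(1)] j by auto
    have "R.K.subspace j (f ` KK j)"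
      by (rule k.f.subspace_image, rule N.subspaceI) (auto intro: KK_add KK_ksc)
    then have "z i \<in> f ` KK j" for i using R.K.span_minimal[OF Wf] z(1) by blast
    then have "\<exists>u. u \<in> KK j \<and> z i = f u" for i by (simp add: image_iff Bex_def)
    then obtain u where u: "\<And>i. u i \<in> KK j" "\<And>i. z i = f (u i)"
      using choice[of "\<lambda>i u. u \<in> KK j \<and> z i = f u"] by blast
    have "df R ?j c \<in> Z j" unfolding Z_def using Wc[OF c(1)] by blast
    then have "(\<Sum>i\<in>UNIV. Rsc j (Var i) (f (u i))) \<in> Z j" using z(2) u(2) by simp
    then obtain y where y: "y \<in> KK ?j" "\<And>i. e ?j i y = u i" using cyc[of u, OF u(1)] by blast
    have Ty: "T y = df R ?j c" unfolding T_def y(2) z(2) u(2) ..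
    have "df R ?j c \<in> Rpt j b" using df_pt[OF c(2)] by simp
    then have "T y \<in> Rpt j b" by (simp only: Ty)
    \<comment> \<open>The degree of \<open>y\<close> can be read off from \<open>T y\<close>,
      because \<open>T\<close> is injective and preserves degrees.\<close>
    have "y \<in> gr N (b, ?j)"
    proof (rule graded_preimage[where f = T and H = "Rpt j" and G = "\<lambda>b. gr N (b, ?j)"])
      show "T y \<in> Rpt j b" by fact
      show "y \<in> carr (\<lambda>b. gr N (b, ?j))" using y(1) by (simp add: KK_def)
      show "x = 0" if "x \<in> carr (\<lambda>b. gr N (b, ?j))" "T x = 0" for x
        using T_inj that by (simp add: KK_def)
      show "T (x + y) = T x + T y" for x y by (rule module_hom.add[OF T_hom])
    qed (auto intro: T_pt R.P.grading_axioms G)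
    with Ty show "\<exists>y\<in>gr N (b, ?j). T y = df R ?j c" by blast
  next
    fix U l assume U: "finite U" "U \<subseteq> W ?j" and z: "df R ?j (\<Sum>c\<in>U. Rsc ?j (Const (l c)) c) = 0"
    have "(\<Sum>c\<in>U. Rsc ?j (Const (l c)) c) \<in> Rcarr ?j"
      using U Wc by (intro R.P.carr_sum R.carr_scale) auto
    \<comment> \<open>As \<open>j + 1 > 0\<close>, a cycle is a boundary and so lies in \<mm>F,
      where independence of \<open>W\<close> modulo \<mm> applies.\<close>
    then have "(\<Sum>c\<in>U. Rsc ?j (Const (l c)) c) \<in> Z ?j" using z j by (subst Z_pos) simp_all
    from lin_basis_ind[OF W U Z_mm[OF this]] show "\<forall>c\<in>U. l c = 0" .
  next
    fix c x assume "x \<in> Rcarr ?j"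
    from df_scale[OF this, of "Const c"]
    show "df R ?j (Rsc ?j (Const c) x) = Rsc j (Const c) (df R ?j x)" by simp
  qed (use Wpt df_add in auto)
  interpret k': kmap Sg w \<theta> N "md R ?j" ?j f'
    by (intro kmap.intro egr gm kmap_axioms.intro f'(1,2))
  have "lifts W ?j f'"
    unfolding lifts_def
  proof (intro conjI allI impI ballI f'(4))
    show "kmap_free Sg w \<theta> N (md R ?j) ?j f' (BR ?j)"
    proof (intro kmap_free.intro kmap_free_axioms.intro k'.kmap_axioms gf)
      fix y assume y: "y \<in> KK ?j" and y0: "\<And>b. b \<in> BR ?j \<Longrightarrow> R.coef ?j 0 b (f' y) = 0"
      show "y = 0"
      proof (rule T_low[OF kf j y])
        fix \<beta> :: "'v \<Rightarrow>\<^sub>0 nat" and b assume \<beta>: "tdeg \<beta> \<le> 1"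
        \<comment> \<open>If \<open>f' y\<close> lies in \<mm>F, its differential \<open>T y\<close>
          lies in \<mm>^2F.\<close>
        have "R.coef (?j - 1) \<beta> b (df R ?j (f' y)) = 0"
          by (rule df_low[OF k'.f_carr[OF y] y0 \<beta>])
        then show "R.coef j \<beta> b (\<Sum>i\<in>UNIV. Rsc j (Var i) (f (e ?j i y))) = 0"
          using f'(3)[OF y] by (simp add: T_def)
      qed
    qed
    fix z :: "'v \<Rightarrow> 'n" assume "\<forall>i. z i \<in> KK ?j"
    then have z: "z i \<in> KK ?j" for i by blast
    \<comment> \<open>\<open>q\<close> is the differential of \<Sum> x_l \<otimes> z_l in L(N). Its
      coefficient at x_a^2 is e_a z_a, and at x_a x_b it is e_b z_a + e_a z_b, so
      \<open>q = 0\<close> is exactly the condition in \<open>e_lift\<close>.\<close>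
    define q where "q = (\<Sum>l\<in>UNIV. \<Sum>i\<in>UNIV. tens (Var l * Var i) (e ?j i (z l)))"
    have q: "q \<in> Lcarr j"
      unfolding q_def by (intro mcarr_L_sum tens_mcarr e_KK' z)
    have fz: "f' (z i) \<in> Rcarr ?j" for i by (rule k'.f_carr[OF z])
    have lq: "lookup q \<gamma> = (\<Sum>l\<in>UNIV. \<Sum>i\<in>UNIV. if \<gamma> = single l 1 + single i 1 then e ?j i (z l) else 0)" for \<gamma>
      unfolding q_def lookup_sum lookup_tens Var_Var_lookup by (intro sum.cong refl) auto
    have lq1: "lookup q (single a 1 + single a 1) = e ?j a (z a)" for a
    proof -
      have "lookup q (single a 1 + single a 1) = (\<Sum>l\<in>UNIV. \<Sum>i\<in>UNIV. if i = a then (if l = a then e ?j a (z a) else 0) else 0)"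
        unfolding lq single_pair_eq by (intro sum.cong refl) auto
      then show ?thesis by simp
    qed
    have lq2: "lookup q (single a 1 + single b 1) = e ?j b (z a) + e ?j a (z b)" if "a \<noteq> b" for a b
    proof -
      have "lookup q (single a 1 + single b 1) =
        (\<Sum>l\<in>UNIV. \<Sum>i\<in>UNIV. (if i = b then (if l = a then e ?j b (z a) else 0) else 0) +
          (if i = a then (if l = b then e ?j a (z b) else 0) else 0))"
        unfolding lq single_pair_eq using that by (intro sum.cong refl) auto
      then show ?thesis by (simp add: sum.distrib)
    qed
    have q0: "q = 0 \<longleftrightarrow> (\<forall>i. e ?j i (z i) = 0) \<and> (\<forall>i l. e ?j i (z l) + e ?j l (z i) = 0)" (is "_ \<longleftrightarrow> ?rel")
    proof
      assume "q = 0"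
      then have l0: "lookup q \<gamma> = 0" for \<gamma> by simp
      have "e ?j i (z i) = 0" for i using l0 lq1[of i] by metis
      moreover have "e ?j i (z l) + e ?j l (z i) = 0" if "i \<noteq> l" for i l using l0 lq2[of l i] that by metis
      ultimately show ?rel by (metis add.right_neutral)
    next
      assume rel: ?rel
      show "q = 0"
      proof (rule poly_mapping_eqI)
        fix \<gamma>
        show "lookup q \<gamma> = lookup 0 \<gamma>"
        proof (cases "\<exists>a b. \<gamma> = single a 1 + single b 1")
          case True
          then obtain a b where \<gamma>: "\<gamma> = single a 1 + single b 1" by blast
          show ?thesis unfolding \<gamma> using lq1[of a] lq2[of a b] rel by (cases "a = b") (simp_all del: One_nat_def)
        next
          case False
          then have "\<gamma> \<noteq> single l 1 + single i 1" for l i by blast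
          then show ?thesis unfolding lq by (simp del: One_nat_def)
        qed
      qed
    qed
    have "df R ?j (\<Sum>l\<in>UNIV. Rsc ?j (Var l) (f' (z l))) = (\<Sum>l\<in>UNIV. Rsc j (Var l) (T (z l)))"
      by (subst df_sum) (simp_all add: R.carr_scale fz df_scale f'(3) z)
    also have "\<dots> = k.\<phi> q"
      by (simp add: q_def k.\<phi>_sum k.\<phi>_tens T_def R.F.scale_sum_right)
    finally have dq: "df R ?j (\<Sum>l\<in>UNIV. Rsc ?j (Var l) (f' (z l))) = k.\<phi> q" .
    have "(\<Sum>l\<in>UNIV. Rsc ?j (Var l) (f' (z l))) \<in> Z ?j \<longleftrightarrow> k.\<phi> q = 0"
      unfolding dq[symmetric] using j by (intro Z_pos R.P.carr_sum R.carr_scale fz) simp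
    also have "\<dots> \<longleftrightarrow> q = 0" using k.\<phi>_inj[OF q] k.\<phi>_0 by blast
    also have "\<dots> \<longleftrightarrow> (\<exists>y\<in>KK (?j + 1). \<forall>i. e (?j + 1) i y = z i)"
      unfolding q0 using j z by (intro e_lift) simp_all
    finally show "(\<Sum>l\<in>UNIV. Rsc ?j (Var l) (f' (z l))) \<in> Z ?j \<longleftrightarrow>
      (\<exists>y\<in>KK (?j + 1). \<forall>i. e (?j + 1) i y = z i)" .
  qed (use j in auto)
  then show ?thesis using f'(3) unfolding T_def by blast
qed

text \<open>Lifts for all integers that fit together to a chain map over \<open>ev\<close>; the
  second clause is the chain map equation on the elements 1 \<otimes> y.\<close>

definition family :: "(int \<Rightarrow> 'f set) \<Rightarrow> (int \<Rightarrow> 'n \<Rightarrow> 'f) \<Rightarrow> bool"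
  where "family W ff \<longleftrightarrow> (\<forall>j. kmap_free Sg w \<theta> N (md R j) j (ff j) (BR j)) \<and>
    (\<forall>j. \<forall>y\<in>KK j. df R j (ff j y) = (\<Sum>i\<in>UNIV. Rsc (j - 1) (Var i) (ff (j - 1) (e j i y)))) \<and>
    (\<forall>j. W j \<subseteq> ff j ` KK j) \<and> (\<forall>y\<in>KK 0. \<epsilon> (ff 0 y) = ev y)"

lemma family_exists:
  assumes W: "lin_basis W"
  shows "\<exists>ff. family W ff"
proof -
  have "\<exists>f. \<forall>n. lifts W (int n) (f n) \<and>
    (\<forall>y\<in>KK (int n + 1). df R (int n + 1) (f (Suc n) y) = (\<Sum>i\<in>UNIV. Rsc (int n) (Var i) (f n (e (int n + 1) i y))))"
  proof (rule dependent_nat_choice)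
    show "\<exists>f. lifts W (int 0) f" using lifts_base[OF W] by simp
    fix f n assume "lifts W (int n) f"
    from lifts_step[OF W _ this]
    show "\<exists>f'. lifts W (int (Suc n)) f' \<and>
      (\<forall>y\<in>KK (int n + 1). df R (int n + 1) (f' y) = (\<Sum>i\<in>UNIV. Rsc (int n) (Var i) (f (e (int n + 1) i y))))"
      by (simp add: add.commute)
  qed
  then obtain f where f: "\<And>n. lifts W (int n) (f n)"
    and df: "\<And>n y. y \<in> KK (int n + 1) \<Longrightarrow>
      df R (int n + 1) (f (Suc n) y) = (\<Sum>i\<in>UNIV. Rsc (int n) (Var i) (f n (e (int n + 1) i y)))" by blast
  \<comment> \<open>In negative degrees both N and the resolution vanish, so the zero map qualifies
    and the recursion may start at 0.\<close>
  define ff where "ff j = (if j < 0 then (\<lambda>_. 0) else f (nat j))" for j :: int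
  have neg: "kmap_free Sg w \<theta> N (md R j) j (\<lambda>_. 0) (BR j)" if j: "j < 0" for j
    by unfold_locales (use KK_neg[OF j] in auto)
  have ffn: "ff j = f (nat j)" "lifts W j (ff j)" if "j \<ge> 0" for j
    using f[of "nat j"] that by (auto simp: ff_def)
  have "family W ff"
    unfolding family_def
  proof (intro conjI allI ballI)
    show "kmap_free Sg w \<theta> N (md R j) j (ff j) (BR j)" for j
      using neg ffn(2)[of j] unfolding lifts_def by (cases "j < 0") (simp_all add: ff_def)
    show "W j \<subseteq> ff j ` KK j" for j
    proof (cases "j < 0")
      case True
      have "W j \<subseteq> {0}" using lin_basis_carr[OF W, of _ j] R_neg[OF True] by auto
      then show ?thesis using True KK_neg[OF True] by (simp add: ff_def)
    next
      case False
      then show ?thesis using ffn(2)[of j] unfolding lifts_def by simp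
    qed
    show "\<epsilon> (ff 0 y) = ev y" if "y \<in> KK 0" for y using ffn(2)[of 0] that unfolding lifts_def by simp
    fix j y assume y: "y \<in> KK j"
    show "df R j (ff j y) = (\<Sum>i\<in>UNIV. Rsc (j - 1) (Var i) (ff (j - 1) (e j i y)))"
    proof (cases "j > 0")
      case True
      then obtain n where j: "j = int n + 1" by (metis zero_less_imp_eq_int Suc_pred add.commute of_nat_Suc)
      have "ff j = f (Suc n)" "ff (j - 1) = f n" using j by (simp_all add: ff_def nat_add_distrib)
      then show ?thesis using df[of y n] y j by simp
    next
      case False
      interpret k: kmap_free Sg w \<theta> N "md R j" j "ff j" "BR j"
        using neg ffn(2)[of j] unfolding lifts_def by (cases "j < 0") (simp_all add: ff_def)
      have "df R j (ff j y) = 0"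
        using df_carr[OF k.f_carr[OF y]] R_neg[of "j - 1"] False by simp
      moreover have "ff (j - 1) = (\<lambda>_. 0)" using False by (simp add: ff_def)
      ultimately show ?thesis by simp
    qed
  qed
  then show ?thesis by blast
qed

end

section \<open>Images of \<open>\<^bold>L(N)\<close> and maximality\<close>

text \<open>The degreewise inverse inherits all properties as soon as \<open>C\<close> is closed
  under its operations. Only this closure is asked of \<open>C\<close>, so that the lemma applies to
  L(N) directly.\<close>

lemma complex_iso_sym:
  assumes iso: "complex_iso C D"
    and zero: "\<And>j a. 0 \<in> pt (md C j) a"
    and add: "\<And>j x y. x \<in> mcarr (md C j) \<Longrightarrow> y \<in> mcarr (md C j) \<Longrightarrow> x + y \<in> mcarr (md C j)"
    and scale: "\<And>j s x. x \<in> mcarr (md C j) \<Longrightarrow> sc (md C j) s x \<in> mcarr (md C j)"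
    and df: "\<And>j x. x \<in> mcarr (md C j) \<Longrightarrow> df C j x \<in> mcarr (md C (j - 1))"
  shows "complex_iso D C"
proof -
  obtain \<phi> where hom: "\<And>j. graded_hom (md C j) (md D j) (\<phi> j)"
    and ptb: "\<And>j a. bij_betw (\<phi> j) (pt (md C j) a) (pt (md D j) a)"
    and bij: "\<And>j. bij_betw (\<phi> j) (mcarr (md C j)) (mcarr (md D j))"
    and chain: "\<And>j x. x \<in> mcarr (md C j) \<Longrightarrow> \<phi> (j - 1) (df C j x) = df D j (\<phi> j x)"
    using iso unfolding complex_iso_def by auto
  have sub: "pt (md C j) a \<subseteq> mcarr (md C j)" for j a using in_carrI[of "pt (md C j)"] zero by blast
  define \<psi> where "\<psi> j = inv_into (mcarr (md C j)) (\<phi> j)" for j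
  have \<psi>: "\<psi> j (\<phi> j x) = x" if "x \<in> mcarr (md C j)" for j x
    unfolding \<psi>_def using bij[of j] that by (auto simp: bij_betw_def)
  have surj: "\<exists>u\<in>mcarr (md C j). x = \<phi> j u" if "x \<in> mcarr (md D j)" for x j
    using bij[of j] that by (auto simp: bij_betw_def)
  have ladd: "\<phi> j (x + y) = \<phi> j x + \<phi> j y" and lsc: "\<phi> j (sc (md C j) s x) = sc (md D j) s (\<phi> j x)"
    if "x \<in> mcarr (md C j)" "y \<in> mcarr (md C j)" for j x y s
    using hom[of j] that unfolding graded_hom_def linear_on_def by auto
  have ptb': "bij_betw (\<psi> j) (pt (md D j) a) (pt (md C j) a)" for j a
    unfolding \<psi>_def using ptb[of j a] by (intro bij_betw_inv_into_subset[OF bij sub]) (simp add: bij_betw_def)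
  show ?thesis
    unfolding complex_iso_def
  proof (intro exI[of _ \<psi>] allI conjI ballI)
    fix j
    show "graded_hom (md D j) (md C j) (\<psi> j)"
      unfolding graded_hom_def linear_on_def
    proof (intro conjI ballI allI)
      fix x y assume "x \<in> mcarr (md D j)" "y \<in> mcarr (md D j)"
      then obtain u v where uv: "u \<in> mcarr (md C j)" "v \<in> mcarr (md C j)" "x = \<phi> j u" "y = \<phi> j v"
        using surj by blast
      show "\<psi> j (x + y) = \<psi> j x + \<psi> j y"
        using \<psi>[OF add[OF uv(1,2)]] uv by (simp add: ladd \<psi>)
    next
      fix s x assume "x \<in> mcarr (md D j)"
      then obtain u where u: "u \<in> mcarr (md C j)" "x = \<phi> j u" using surj by blast
      show "\<psi> j (sc (md D j) s x) = sc (md C j) s (\<psi> j x)"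
        using \<psi>[OF scale[OF u(1)], of s] u by (simp add: lsc \<psi>)
    next
      show "\<psi> j ` pt (md D j) a \<subseteq> pt (md C j) a" for a using ptb'[of j a] by (simp add: bij_betw_def)
    qed
    show "bij_betw (\<psi> j) (pt (md D j) a) (pt (md C j) a)" for a by (rule ptb')
    show "bij_betw (\<psi> j) (mcarr (md D j)) (mcarr (md C j))"
      unfolding \<psi>_def by (rule bij_betw_inv_into[OF bij])
    fix x assume "x \<in> mcarr (md D j)"
    then obtain u where u: "u \<in> mcarr (md C j)" "x = \<phi> j u" using surj by blast
    show "\<psi> (j - 1) (df D j x) = df C j (\<psi> j x)"
      using chain[OF u(1)] \<psi>[OF df[OF u(1)]] u by (simp add: \<psi>)
  qed
qed

lemma is_grading_mono:
  assumes H: "grading H" and sub: "\<And>a. G a \<subseteq> H a" and "\<And>a. 0 \<in> G a"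
    "\<And>a x y. x \<in> G a \<Longrightarrow> y \<in> G a \<Longrightarrow> x + y \<in> G a" "\<And>a x. x \<in> G a \<Longrightarrow> - x \<in> G a"
  shows "is_grading G"
  unfolding is_grading_def
proof (intro conjI allI impI ballI)
  fix f assume f: "(\<forall>a. lookup f a \<in> G a) \<and> (\<Sum>a\<in>keys f. lookup f a) = 0"
  have "lookup f a = 0" if "a \<in> keys f" for a
    by (rule grading.direct[OF H, of "keys f" "lookup f"]) (use f that sub in auto)
  then show "f = 0" by (metis in_keys_iff lookup_zero poly_mapping_eqI)
qed (use assms in auto)

section \<open>Images of chain maps as strongly linear, quasi-split subcomplexes\<close>

context resol
begin

abbreviation cmap :: "(int \<Rightarrow> 'n \<Rightarrow> 'f) \<Rightarrow> int \<Rightarrow> ('v mono \<Rightarrow>\<^sub>0 'n) \<Rightarrow> 'f"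
  where "cmap ff j \<equiv> lin_ext (md R j) (ff j)"

definition img :: "(int \<Rightarrow> 'n \<Rightarrow> 'f) \<Rightarrow> ('a, ('v, 'k) mpol, 'f) cplx"
  where "img ff = \<lparr>md = (\<lambda>j. \<lparr>sc = Rsc j, pt = (\<lambda>a. cmap ff j ` Lpt j a)\<rparr>), df = df R\<rparr>"

abbreviation Icarr where "Icarr ff j \<equiv> mcarr (md (img ff) j)"

abbreviation Ipt where "Ipt ff j \<equiv> pt (md (img ff) j)"

lemma img_simps [simp]: "sc (md (img ff) j) = Rsc j" "pt (md (img ff) j) a = cmap ff j ` Lpt j a"
  "df (img ff) = df R"
  by (simp_all add: img_def)

context
  fixes W ff assumes family: "family W ff"
begin

lemma family_kmap: "kmap_free Sg w \<theta> N (md R j) j (ff j) (BR j)"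
  and family_df: "y \<in> KK j \<Longrightarrow> df R j (ff j y) = (\<Sum>i\<in>UNIV. Rsc (j - 1) (Var i) (ff (j - 1) (e j i y)))"
  and family_W: "W j \<subseteq> ff j ` KK j"
  and family_ev: "y \<in> KK 0 \<Longrightarrow> \<epsilon> (ff 0 y) = ev y"
  using family unfolding family_def by auto

interpretation k: kmap_free Sg w \<theta> N "md R j" j "ff j" "BR j" for j
  by (rule family_kmap)

lemma cmap_chain:
  assumes p: "p \<in> Lcarr j"
  shows "df R j (cmap ff j p) = cmap ff (j - 1) (L_diff N j p)"
proof -
  have pk: "lookup p \<alpha> \<in> KK j" for \<alpha> using p by (simp add: mcarr_L)
  have "df R j (cmap ff j p) = (\<Sum>\<alpha>\<in>keys p. Rsc (j - 1) (single \<alpha> 1) (df R j (ff j (lookup p \<alpha>))))"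
    unfolding lin_ext_def by (simp add: df_sum df_scale R.carr_scale k.f_carr pk)
  also have "\<dots> = cmap ff (j - 1) (L_diff N j p)"
    unfolding L_diff_def e_def[symmetric]
    by (simp add: k.\<phi>_sum k.\<phi>_tens family_df pk R.F.scale_sum_right mult.commute)
  finally show ?thesis .
qed

lemma mcarr_img: "Icarr ff j = cmap ff j ` Lcarr j"
proof (intro equalityI subsetI)
  fix x assume "x \<in> Icarr ff j"
  then obtain A h where A: "finite A" "\<And>a. h a \<in> cmap ff j ` Lpt j a" "x = (\<Sum>a\<in>A. h a)"
    using carrE[of x "Ipt ff j"] by (metis img_simps(2))
  have "\<exists>p. p \<in> Lpt j a \<and> h a = cmap ff j p" for a using A(2)[of a] by blast
  then obtain p where p: "\<And>a. p a \<in> Lpt j a" "\<And>a. h a = cmap ff j (p a)"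
    using choice[of "\<lambda>a p. p \<in> Lpt j a \<and> h a = cmap ff j p"] by blast
  have "x = cmap ff j (\<Sum>a\<in>A. p a)" unfolding A(3) p(2) k.\<phi>_sum ..
  moreover have "(\<Sum>a\<in>A. p a) \<in> Lcarr j" by (intro mcarr_L_sum pt_L_carr[OF p(1)])
  ultimately show "x \<in> cmap ff j ` Lcarr j" by blast
next
  fix x assume "x \<in> cmap ff j ` Lcarr j"
  then obtain p where p: "p \<in> Lcarr j" "x = cmap ff j p" by blast
  obtain A h where A: "finite A" "\<And>a. h a \<in> Lpt j a" "p = (\<Sum>a\<in>A. h a)"
    using carrE[OF p(1)] by metis
  have "(\<Sum>a\<in>A. cmap ff j (h a)) \<in> Icarr ff j"
  proof (rule carr_sumI[OF A(1)])
    show "0 \<in> Ipt ff j a" for a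
      unfolding img_simps by (rule image_eqI[of _ _ 0]) (simp_all add: pt_L_zero)
    show "cmap ff j (h a) \<in> Ipt ff j a" for a using A(2) by simp
  qed
  then show "x \<in> Icarr ff j" unfolding p(2) A(3) k.\<phi>_sum .
qed

text \<open>The image carries two candidate gradings, the image of that of L(N) and the one induced
  from the resolution; they agree because the injective map \<open>cmap\<close> detects
  degrees.\<close>

lemma img_pt_iff: "x \<in> Ipt ff j a \<longleftrightarrow> x \<in> Icarr ff j \<and> x \<in> Rpt j a"
  unfolding mcarr_img img_simps using k.\<phi>_pt k.\<phi>_pt_iff pt_L_carr by blast

lemma img_subcomplex: "subcomplex Sg (img ff) R"
proof -
  have gr: "is_grading (Ipt ff j)" for j
  proof (rule is_grading_mono[OF R.P.grading_axioms[of j]])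
    show "Ipt ff j a \<subseteq> Rpt j a" for a using img_pt_iff by blast
    show "0 \<in> Ipt ff j a" for a
      unfolding img_simps by (rule image_eqI[of _ _ 0]) (simp_all add: pt_L_zero)
    fix a x assume "x \<in> Ipt ff j a"
    then obtain p where p: "p \<in> Lpt j a" "x = cmap ff j p" by auto
    show "- x \<in> Ipt ff j a"
      using p k.\<phi>_diff[of j 0 p] pt_L_neg[OF p(1)] by (auto intro: image_eqI[of _ _ "- p"])
    fix y assume "y \<in> Ipt ff j a"
    then obtain q where q: "q \<in> Lpt j a" "y = cmap ff j q" by auto
    show "x + y \<in> Ipt ff j a"
      unfolding img_simps by (rule image_eqI[of _ _ "p + q"]) (simp_all add: k.\<phi>_add p q pt_L_add)
  qed
  have carr: "Icarr ff j \<subseteq> Rcarr j" for j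
    by (rule carr_mono) (use img_pt_iff in blast)
  have df_in: "df R j x \<in> Ipt ff (j - 1) a" if "x \<in> Ipt ff j a" for j a x
  proof -
    obtain p where p: "p \<in> Lpt j a" "x = cmap ff j p" using \<open>x \<in> _\<close> by auto
    show ?thesis
      unfolding p(2) cmap_chain[OF pt_L_carr[OF p(1)]] img_simps by (intro imageI L_diff_pt p(1))
  qed
  have "graded_complex Sg (img ff)"
    unfolding graded_complex_def graded_module_def graded_hom_def linear_on_def
  proof (intro allI conjI ballI)
    fix j
    show "module (sc (md (img ff) j))" by (simp add: R.F.module_axioms)
    show "is_grading (Ipt ff j)" by (rule gr)
    show "sc (md (img ff) j) s x \<in> Ipt ff j (a + b)" if s: "s \<in> Sg a" and "x \<in> Ipt ff j b" for a b s x
    proof -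
      obtain p where p: "p \<in> Lpt j b" "x = cmap ff j p" using \<open>x \<in> _\<close> by auto
      show ?thesis unfolding p(2) img_simps k.\<phi>_scale[symmetric] by (intro imageI pt_L_scale s p(1))
    qed
    show "df (img ff) j ` Ipt ff j a \<subseteq> Ipt ff (j - 1) a" for a
      using df_in[of _ j a] by (auto simp del: img_simps(2))
  qed (use df_add df_scale df_df carr in \<open>simp_all add: subset_iff\<close>)
  then show ?thesis unfolding subcomplex_def using img_pt_iff by auto
qed

lemma img_iso: "complex_iso L (img ff)"
  unfolding complex_iso_def
proof (intro exI[of _ "cmap ff"] allI conjI ballI)
  fix j
  show "graded_hom (md L j) (md (img ff) j) (cmap ff j)"
    unfolding graded_hom_def linear_on_def by (simp add: k.\<phi>_add k.\<phi>_scale sc_L)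
  show "bij_betw (cmap ff j) (Lpt j a) (Ipt ff j a)" for a
    unfolding img_simps using k.\<phi>_inj_on[of j] pt_L_carr by (intro inj_on_imp_bij_betw) (blast intro: inj_on_subset)
  show "bij_betw (cmap ff j) (Lcarr j) (Icarr ff j)"
    unfolding mcarr_img by (rule inj_on_imp_bij_betw[OF k.\<phi>_inj_on])
  show "cmap ff (j - 1) (df L j p) = df (img ff) j (cmap ff j p)" if "p \<in> Lcarr j" for p
    by (simp add: df_L cmap_chain that)
qed

lemma ff_inj_on: "inj_on (ff j) (KK j)"
proof (rule inj_onI)
  fix x y assume xy: "x \<in> KK j" "y \<in> KK j" "ff j x = ff j y"
  have "x - y = 0"
    by (rule k.inj_mod[OF KK_diff[OF xy(1,2)]]) (simp add: k.f.diff xy(3))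
  then show "x = y" by simp
qed

text \<open>A relation modulo \<mm> pulls back to an element of N that \<open>ff j\<close> sends
  into \<mm>F, and \<open>inj_mod\<close> makes this element zero.\<close>

lemma img_indep_mod:
  assumes Y: "Y \<subseteq> (\<Union>b. gr N (b, j))" "N.independent Y" "N.span Y = KK j"
  shows "R.indep_mod j (ff j ` Y)"
  unfolding R.indep_mod_def
proof (intro conjI allI impI)
  have Yk: "Y \<subseteq> KK j" using Y(3) N.span_superset by blast
  show "ff j ` Y \<subseteq> Rcarr j" using Yk k.f_carr by blast
  fix U l assume U: "finite U" "U \<subseteq> ff j ` Y" and z: "\<forall>b\<in>BR j. R.coef j 0 b (\<Sum>x\<in>U. Rsc j (Const (l x)) x) = 0"
  obtain V where V: "V \<subseteq> Y" "finite V" "U = ff j ` V" using finite_subset_image[OF U] by metis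
  have inj: "inj_on (ff j) V" using ff_inj_on V(1) Yk by (meson inj_on_subset subset_trans)
  have "(\<Sum>x\<in>U. Rsc j (Const (l x)) x) = ff j (\<Sum>y\<in>V. ksc N (l (ff j y)) y)"
    unfolding V(3) by (subst sum.reindex[OF inj]) (simp add: k.f.sum k.f.scale)
  moreover have "(\<Sum>y\<in>V. ksc N (l (ff j y)) y) \<in> KK j"
    using V(1) Yk by (intro KK_sum KK_ksc) blast
  ultimately have "(\<Sum>y\<in>V. ksc N (l (ff j y)) y) = 0" using k.inj_mod z by simp
  from N.independentD[OF Y(2) V(2,1) this] show "\<forall>x\<in>U. l x = 0" unfolding V(3) by blast
qed

lemma img_span:
  assumes Y: "Y \<subseteq> (\<Union>b. gr N (b, j))" "N.independent Y" "N.span Y = KK j"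
  shows "R.F.span j (ff j ` Y) = Icarr ff j"
proof
  have Yk: "Y \<subseteq> KK j" using Y(3) N.span_superset by blast
  interpret \<phi>: module_hom "tens_S_scale N" "Rsc j" "cmap ff j" by (rule k.\<phi>_hom)
  show "R.F.span j (ff j ` Y) \<subseteq> Icarr ff j"
  proof (rule R.F.span_minimal)
    show "ff j ` Y \<subseteq> Icarr ff j"
    proof
      fix x assume "x \<in> ff j ` Y"
      then obtain y where y: "y \<in> Y" "x = ff j y" by blast
      then have "x = cmap ff j (tens 1 y)" by (simp add: k.\<phi>_tens)
      moreover have "tens 1 y \<in> Lcarr j" using y Yk by (intro tens_mcarr) blast
      ultimately show "x \<in> Icarr ff j" unfolding mcarr_img by blast
    qed
    have "\<phi>.m1.subspace (Lcarr j)"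
      by (rule \<phi>.m1.subspaceI) (simp_all add: mcarr_L_add mcarr_L_scale pt_L_carr[OF pt_L_zero])
    then show "R.F.subspace j (Icarr ff j)" unfolding mcarr_img by (rule \<phi>.subspace_image)
  qed
  have ys: "ff j y \<in> R.F.span j (ff j ` Y)" if "y \<in> KK j" for y
    using that unfolding Y(3)[symmetric]
  proof (induction rule: N.span_induct_alt)
    case (step c x y)
    then show ?case by (simp add: k.f.add k.f.scale R.F.span_add R.F.span_scale R.F.span_base)
  qed (simp add: R.F.span_zero)
  show "Icarr ff j \<subseteq> R.F.span j (ff j ` Y)"
  proof
    fix x assume "x \<in> Icarr ff j"
    then obtain p where p: "p \<in> Lcarr j" "x = cmap ff j p" unfolding mcarr_img by blast
    then have "lookup p \<alpha> \<in> KK j" for \<alpha> by (simp add: mcarr_L)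
    then show "x \<in> R.F.span j (ff j ` Y)"
      unfolding p(2) lin_ext_def by (intro R.F.span_sum R.F.span_scale ys)
  qed
qed

text \<open>A homogeneous vector space basis of N maps to a basis of the image over S. Linearity of
  the differential is visible in this basis, and its independence modulo \<mm> gives the
  complement.\<close>

lemma img_slqs: "slqs Sg (img ff) R"
proof -
  have "\<exists>Y. Y \<subseteq> (\<Union>b. gr N (b, j)) \<and> N.independent Y \<and> N.span Y = KK j" for j
    using KK_basis[of j] by metis
  then have "\<exists>Y. \<forall>j. Y j \<subseteq> (\<Union>b. gr N (b, j)) \<and> N.independent (Y j) \<and> N.span (Y j) = KK j"
    by (intro choice allI)
  then obtain Y where "\<forall>j. Y j \<subseteq> (\<Union>b. gr N (b, j)) \<and> N.independent (Y j) \<and> N.span (Y j) = KK j" ..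
  then have Y: "\<And>j. Y j \<subseteq> (\<Union>b. gr N (b, j))" "\<And>j. N.independent (Y j)" "\<And>j. N.span (Y j) = KK j"
    by simp_all
  have Yk: "Y j \<subseteq> KK j" for j using Y(3)[of j] N.span_superset[of "Y j"] by simp
  define X where "X j = ff j ` Y j" for j
  have Xi: "R.indep_mod j (X j)" for j unfolding X_def by (rule img_indep_mod[OF Y])
  have Xs: "R.F.span j (X j) = Icarr ff j" for j unfolding X_def by (rule img_span[OF Y])
  have ind: "R.F.independent j (X j)" for j by (rule R.indep_mod_independent[OF Xi])
  have Xpt: "X j \<subseteq> (\<Union>a. Ipt ff j a)" for j
  proof
    fix x assume "x \<in> X j"
    then obtain y where y: "y \<in> Y j" "x = ff j y" unfolding X_def by blast
    then obtain b where b: "y \<in> gr N (b, j)" using Y(1) by blast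
    have "x = cmap ff j (tens 1 y)" using y by (simp add: k.\<phi>_tens)
    moreover have "tens 1 y \<in> Lpt j b" using tens_single_pt[OF b, of 0 1] by simp
    ultimately show "x \<in> (\<Union>a. Ipt ff j a)" unfolding img_simps by blast
  qed
  have hb: "homogeneous_basis (md (img ff) j) (X j)" for j
    unfolding homogeneous_basis_def using Xpt[of j] ind[of j] Xs[of j] by simp
  have ffX: "ff j v \<in> R.F.span j (X j)" if "v \<in> KK j" for j v
    unfolding Xs mcarr_img
    by (rule image_eqI[of _ _ "tens 1 v"]) (simp_all add: k.\<phi>_tens tens_mcarr that)
  \<comment> \<open>Images of vectors of N have constant coordinates in the basis \<open>X\<close>,
    so the variables in the formula for the differential produce linear forms.\<close>
  have cf: "ff j v \<in> R.F.span j (X j) \<and> (\<exists>c. R.F.representation j (X j) (ff j v) x = Const c)" if "v \<in> KK j" for j v x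
    using that unfolding Y(3)[symmetric]
  proof (induction rule: N.span_induct_alt)
    case base
    show ?case by (intro conjI exI[of _ 0]) (simp_all add: R.F.representation_zero R.F.span_zero)
  next
    case (step t y v)
    then obtain c where v: "ff j v \<in> R.F.span j (X j)" and c: "R.F.representation j (X j) (ff j v) x = Const c"
      by blast
    have yX: "ff j y \<in> X j" using step by (simp add: X_def)
    have "R.F.representation j (X j) (ff j (ksc N t y + v)) x =
      Const (t * (if x = ff j y then 1 else 0) + c)"
      using yX by (simp add: k.f.add k.f.scale R.F.representation_add[OF ind v] R.F.representation_scale[OF ind]
          R.F.span_scale R.F.span_base R.F.representation_basis[OF ind] c)
    moreover have "ff j (ksc N t y + v) \<in> R.F.span j (X j)"
      using yX v by (simp add: k.f.add k.f.scale R.F.span_add R.F.span_scale R.F.span_base)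
    ultimately show ?case by blast
  qed
  have "R.F.representation (j - 1) (X (j - 1)) (df R j b) b' \<in> linear_forms" if b: "b \<in> X j" for j b b'
  proof -
    obtain y where y: "y \<in> KK j" "b = ff j y" using b Yk unfolding X_def by blast
    have ek: "e j i y \<in> KK (j - 1)" for i by (rule e_KK[OF y(1)])
    note sp = ffX[OF ek]
    have "\<exists>c. R.F.representation (j - 1) (X (j - 1)) (ff (j - 1) (e j i y)) b' = Const c" for i
      using cf[OF ek] by blast
    then have "\<exists>c. \<forall>i. R.F.representation (j - 1) (X (j - 1)) (ff (j - 1) (e j i y)) b' = Const (c i)"
      by (intro choice allI)
    then obtain c where c: "\<forall>i. R.F.representation (j - 1) (X (j - 1)) (ff (j - 1) (e j i y)) b' = Const (c i)" ..
    have "R.F.representation (j - 1) (X (j - 1)) (df R j b) b' = (\<Sum>i\<in>UNIV. Var i * Const (c i))"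
      unfolding y(2) family_df[OF y(1)]
      by (subst R.F.representation_sum[OF ind])
        (simp_all add: R.F.span_scale sp R.F.representation_scale[OF ind sp] c)
    then show ?thesis using linear_formsI[of c] by (simp add: mult.commute)
  qed
  then have sl: "strongly_linear Sg (img ff)"
    unfolding strongly_linear_def using img_subcomplex hb
    by (intro conjI exI[of _ X] allI ballI) (simp_all add: subcomplex_def)
  \<comment> \<open>In negative degrees there are no basis elements, since 0 cannot be one;
    elsewhere this is \<open>R_bounded\<close>. The bound drives the Nakayama argument behind the
    splitting.\<close>
  have bd: "\<theta> d \<le> \<theta> (R.deg j b)" if "b \<in> BR j" for j b
  proof (cases "j < 0")
    case True
    then show ?thesis using R.B_carr[OF that] R_neg[OF True] R.B_nonzero that by auto
  next
    case False
    then show ?thesis using R_bounded[of b "nat j"] that by simp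
  qed
  have "\<exists>D. module.subspace (Rsc j) D \<and> Icarr ff j \<inter> D = {0} \<and>
      {x + y | x y. x \<in> Icarr ff j \<and> y \<in> D} = Rcarr j" for j
  proof -
    have XR: "X j \<subseteq> (\<Union>a. Rpt j a)"
    proof
      fix x assume "x \<in> X j"
      then have "x \<in> (\<Union>a. Ipt ff j a)" by (rule subsetD[OF Xpt])
      then obtain a where "x \<in> Ipt ff j a" by (elim UN_E)
      then have "x \<in> Rpt j a" unfolding img_pt_iff by (elim conjE)
      then show "x \<in> (\<Union>a. Rpt j a)" by (rule UN_I[OF UNIV_I])
    qed
    obtain D where "R.F.subspace j D" "Icarr ff j \<inter> D = {0}"
      "{x + y | x y. x \<in> Icarr ff j \<and> y \<in> D} = Rcarr j"
      by (rule R.indep_mod_split[OF Xi XR bd, unfolded Xs]) (assumption, rule that)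
    then show ?thesis by (intro exI[of _ D] conjI)
  qed
  then have "quasi_split Sg (img ff) R"
    unfolding quasi_split_def using img_subcomplex by blast
  with sl show ?thesis by (simp add: slqs_def)
qed

end

end

section \<open>Comparison with arbitrary strongly linear, quasi-split subcomplexes\<close>

context resol
begin

text \<open>Quasi-splitting enters through C \<inter> \<mm>F = \<mm>C, obtained by projection along
  a complement; it makes a basis of C independent modulo \<mm>F. Strong linearity supplies the
  linear form of the differentials.\<close>

lemma slqs_lin_basis:
  assumes C: "slqs Sg C R"
  obtains BC where "lin_basis BC" "\<And>j. mcarr (md C j) = R.F.span j (BC j)"
proof -
  have gc: "graded_complex Sg C" and sub: "df C = df R" "\<And>j. sc (md C j) = Rsc j"
    "\<And>j a. pt (md C j) a \<subseteq> Rpt j a"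
    using C by (auto simp: slqs_def strongly_linear_def quasi_split_def subcomplex_def)
  obtain BC where hb: "\<And>j. homogeneous_basis (md C j) (BC j)"
    and lf: "\<And>j b b'. b \<in> BC j \<Longrightarrow> b' \<in> BC (j - 1) \<Longrightarrow>
        module.representation (sc (md C (j - 1))) (BC (j - 1)) (df C j b) b' \<in> linear_forms"
    using C unfolding slqs_def strongly_linear_def by auto
  have split: "\<exists>D. module.subspace (Rsc j) D \<and>
      mcarr (md C j) \<inter> D = {0} \<and> {x + y | x y. x \<in> mcarr (md C j) \<and> y \<in> D} = Rcarr j" for j
    using C unfolding slqs_def quasi_split_def by blast
  interpret C: gfree Sg w \<theta> "md C j" "BC j" for j
    using gc hb by unfold_locales (auto simp: graded_complex_def)
  have span: "mcarr (md C j) = R.F.span j (BC j)" for j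
    using C.span_B[of j] by (simp add: sub)
  have Cdf: "df R j x \<in> mcarr (md C (j - 1))" if "x \<in> BC j" for j x
  proof -
    have "df C j x \<in> pt (md C (j - 1)) (C.deg j x)"
      using gc C.deg[OF that] unfolding graded_complex_def graded_hom_def by blast
    then show ?thesis unfolding sub by (rule C.P.carrI)
  qed
  have "lin_basis BC"
    unfolding lin_basis_def
  proof (intro conjI allI impI ballI)
    fix j
    show "BC j \<subseteq> (\<Union>a. Rpt j a)" by (rule order_trans[OF C.B_pt UN_mono[OF order_refl sub(3)]])
  next
    fix j U l c assume U: "finite U" "U \<subseteq> BC j" and mm: "(\<Sum>c\<in>U. Rsc j (Const (l c)) c) \<in> R.mm j"
      and c: "c \<in> U"
    let ?x = "\<Sum>c\<in>U. Rsc j (Const (l c)) c"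
    obtain u where u: "\<And>i. u i \<in> Rcarr j" "?x = (\<Sum>i\<in>UNIV. Rsc j (Var i) (u i))"
      by (rule R.mm_alt[OF mm], rule that)
    obtain D where D: "R.F.subspace j D" "mcarr (md C j) \<inter> D = {0}"
      "{x + y | x y. x \<in> mcarr (md C j) \<and> y \<in> D} = Rcarr j" using split[of j] by (elim exE conjE)
    \<comment> \<open>\<open>v\<close> will be the projection of \<open>u i\<close> to C along
      \<open>D\<close>.\<close>
    have "\<exists>v. v \<in> mcarr (md C j) \<and> u i - v \<in> D" for i
    proof -
      have "u i \<in> {x + y | x y. x \<in> mcarr (md C j) \<and> y \<in> D}" using u(1) D(3) by simp
      then obtain x y where "u i = x + y" "x \<in> mcarr (md C j)" "y \<in> D" by blast
      then show ?thesis by (intro exI[of _ x]) simp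
    qed
    then have "\<exists>v. \<forall>i. v i \<in> mcarr (md C j) \<and> u i - v i \<in> D" by (intro choice allI)
    then obtain v where v: "\<forall>i. v i \<in> mcarr (md C j) \<and> u i - v i \<in> D" ..
    let ?y = "\<Sum>i\<in>UNIV. Rsc j (Var i) (v i)"
    have xC: "?x \<in> mcarr (md C j)"
      using U(2) C.B_carr C.carr_scale[of _ j] unfolding sub by (intro C.P.carr_sum) blast
    have yC: "?y \<in> mcarr (md C j)"
      using v C.carr_scale[of _ j] unfolding sub by (intro C.P.carr_sum) blast
    \<comment> \<open>The difference lies in C and in \<open>D\<close>, hence is zero. So
      \<open>?x\<close> is in \<mm>C, and its constant coefficients in the basis of C, which are the
      \<open>l c\<close>, vanish.\<close>
    have "?x - ?y = (\<Sum>i\<in>UNIV. Rsc j (Var i) (u i - v i))"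
      unfolding u(2) by (simp add: R.F.scale_right_diff_distrib sum_subtractf)
    also have "\<dots> \<in> D" using D(1) v by (intro R.F.subspace_sum R.F.subspace_scale) simp_all
    finally have "?x - ?y \<in> mcarr (md C j) \<inter> D" using C.P.carr_diff[OF xC yC] by blast
    then have xy: "?x = ?y" using D(2) by simp
    have "C.coef j 0 c ?x = (\<Sum>b\<in>U. if c = b then l b else 0)"
      using U(2) C.B_carr C.carr_scale[of _ j] C.coef_Const[of _ j] C.coef_B[of _ j] unfolding sub
      by (subst C.coef_sum) (auto intro!: sum.cong)
    also have "\<dots> = l c" using U(1) c by simp
    finally have "l c = C.coef j 0 c ?y" using xy by simp
    also have "\<dots> = (\<Sum>i\<in>UNIV. C.coef j 0 c (Rsc j (Var i) (v i)))"
      using v C.carr_scale[of _ j] unfolding sub by (intro C.coef_sum) blast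
    also have "\<dots> = 0"
      using v C.coef_scale_zero[where j = j and b = c] unfolding sub
      by (intro sum.neutral ballI) (simp add: Var_def lookup_single single_Suc_0_nonzero)
    finally show "l c = 0" .
  next
    fix j :: int and c assume c: "c \<in> BC j"
    obtain U where U: "finite U" "U \<subseteq> BC (j - 1)"
      "df R j c = (\<Sum>b\<in>U. sc (md C (j - 1)) (C.rep (j - 1) (df R j c) b) b)"
      by (rule C.expand[OF Cdf[OF c]], rule that)
    have "\<exists>l. C.rep (j - 1) (df R j c) b = (\<Sum>i\<in>UNIV. Const (l i) * Var i)" if "b \<in> U" for b
    proof -
      have "C.rep (j - 1) (df R j c) b \<in> linear_forms" using lf[OF c, of b] U(2) that sub(1) by auto
      then show ?thesis by (rule linear_forms_cases) blast
    qed
    then have "\<forall>b\<in>U. \<exists>l. C.rep (j - 1) (df R j c) b = (\<Sum>i\<in>UNIV. Const (l i) * Var i)" by blast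
    from bchoice[OF this] obtain l
      where l: "\<forall>b\<in>U. C.rep (j - 1) (df R j c) b = (\<Sum>i\<in>UNIV. Const (l b i) * Var i)" ..
    let ?z = "\<lambda>i. \<Sum>b\<in>U. Rsc (j - 1) (Const (l b i)) b"
    have "df R j c = (\<Sum>b\<in>U. Rsc (j - 1) (C.rep (j - 1) (df R j c) b) b)"
      using U(3) by (simp only: sub)
    also have "\<dots> = (\<Sum>b\<in>U. \<Sum>i\<in>UNIV. Rsc (j - 1) (Var i) (Rsc (j - 1) (Const (l b i)) b))"
      by (rule sum.cong) (simp_all add: l R.F.scale_sum_left mult.commute)
    also have "\<dots> = (\<Sum>i\<in>UNIV. Rsc (j - 1) (Var i) (?z i))"
      by (subst sum.swap) (simp add: R.F.scale_sum_right)
    finally have "df R j c = (\<Sum>i\<in>UNIV. Rsc (j - 1) (Var i) (?z i))" .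
    moreover have "?z i \<in> R.K.span (j - 1) (BC (j - 1))" for i
      by (intro R.K.span_sum R.K.span_scale R.K.span_base) (use U(2) in blast)
    ultimately show "\<exists>z. (\<forall>i. z i \<in> R.K.span (j - 1) (BC (j - 1))) \<and>
      df R j c = (\<Sum>i\<in>UNIV. Rsc (j - 1) (Var i) (z i))" by (intro exI[of _ ?z] conjI allI)
  qed
  then show ?thesis using span by (rule that)
qed

text \<open>The key to maximality: an inclusion between the images of two independently chosen chain
  maps is turned into an equality.\<close>

lemma family_unique:
  assumes ff: "family W ff" and gg: "family V gg"
    and sub: "\<And>j. Icarr ff j \<subseteq> Icarr gg j"
  shows "Icarr gg j \<subseteq> Icarr ff j"
proof -
  interpret f: kmap_free Sg w \<theta> N "md R j" j "ff j" "BR j" for j by (rule family_kmap[OF ff])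
  interpret g: kmap_free Sg w \<theta> N "md R j" j "gg j" "BR j" for j by (rule family_kmap[OF gg])
  have gc: "graded_complex Sg (img ff)" using img_subcomplex[OF ff] by (simp add: subcomplex_def)
  interpret I: gmod Sg w \<theta> "md (img ff) j" for j
    using gc by unfold_locales (simp add: graded_complex_def)
  have ff_in: "ff j y \<in> Icarr ff j" if "y \<in> KK j" for j y
    unfolding mcarr_img[OF ff] by (rule image_eqI[of _ _ "tens 1 y"]) (simp_all add: f.\<phi>_tens tens_mcarr that)
  \<comment> \<open>The inclusion of the images expresses the difference of the two maps through
    \<open>gg\<close> alone, so the order of vanishing of the difference can be read off from
    \<open>q\<close>.\<close>
  have diff: "\<exists>q\<in>Lcarr j. gg j y - ff j y = cmap gg j q" if y: "y \<in> KK j" for j y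
  proof -
    obtain p where p: "p \<in> Lcarr j" "ff j y = cmap gg j p"
      using ff_in[OF y] sub[of j] unfolding mcarr_img[OF gg] by blast
    have "tens 1 y - p \<in> Lcarr j" by (intro mcarr_L_diff tens_mcarr y p(1))
    moreover have "gg j y - ff j y = cmap gg j (tens 1 y - p)"
      by (simp add: g.\<phi>_diff g.\<phi>_tens p(2))
    ultimately show ?thesis by blast
  qed
  have c: "gg j y - ff j y \<in> Rcarr j" if "y \<in> KK j" for j y
    by (intro R.P.carr_diff f.f_carr g.f_carr that)
  \<comment> \<open>The two maps agree modulo \<mm>. In degree 0 their difference lies in ker
    \<epsilon>, as both lie over \<open>ev\<close>. In the step, its differential is the sum of x_i
    times the differences at e_i y, which are in \<mm>F by induction; so it lies in \<mm>^2F, which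
    kills e_i of the constant term of \<open>q\<close> and, by \<open>e_inj\<close>, that constant
    term.\<close>
  have coef0: "R.coef (int n) 0 b (gg (int n) y - ff (int n) y) = 0" if "y \<in> KK (int n)" for n y b
    using that
  proof (induction n arbitrary: y b)
    case 0
    then have y: "y \<in> KK 0" by simp
    have "gg 0 y - ff 0 y \<in> Z 0"
      using family_ev[OF ff y] family_ev[OF gg y]
      by (subst Z_zero) (simp_all add: c y eps_diff f.f_carr g.f_carr)
    then show ?case using R.mm_coef[OF Z_mm] by simp
  next
    case (Suc n)
    let ?j = "int (Suc n)"
    have j1: "?j - 1 = int n" by simp
    obtain q where q: "q \<in> Lcarr ?j" "gg ?j y - ff ?j y = cmap gg ?j q" using diff[OF Suc.prems] by blast
    have ek: "e ?j i y \<in> KK (int n)" for i using e_KK[OF Suc.prems, of i] by simp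
    have "df R ?j (gg ?j y - ff ?j y) =
      (\<Sum>i\<in>UNIV. Rsc (int n) (Var i) (gg (int n) (e ?j i y) - ff (int n) (e ?j i y)))"
      unfolding df_diff[OF g.f_carr[OF Suc.prems] f.f_carr[OF Suc.prems]]
        family_df[OF ff Suc.prems] family_df[OF gg Suc.prems] j1
      by (simp only: R.F.scale_right_diff_distrib sum_subtractf)
    then have dq: "cmap gg (int n) (L_diff N ?j q) =
      (\<Sum>i\<in>UNIV. Rsc (int n) (Var i) (gg (int n) (e ?j i y) - ff (int n) (e ?j i y)))"
      using cmap_chain[OF gg q(1)] q(2) unfolding j1 by simp
    have Lq: "L_diff N ?j q \<in> Lcarr (int n)" using L_diff_carr[OF q(1)] by simp
    have "R.coef (int n) \<beta> b (cmap gg (int n) (L_diff N ?j q)) = 0" if \<beta>: "tdeg \<beta> \<le> 1" for \<beta> b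
      unfolding dq
    proof (subst R.coef_sum)
      show "(\<Sum>i\<in>UNIV. R.coef (int n) \<beta> b (Rsc (int n) (Var i) (gg (int n) (e ?j i y) - ff (int n) (e ?j i y)))) = 0"
        by (intro sum.neutral ballI R.coef_low[OF _ c[OF ek] Suc.IH[OF ek] \<beta>])
          (simp add: Var_def lookup_single single_Suc_0_nonzero)
    qed (intro R.carr_scale c ek)
    then have "lookup (L_diff N ?j q) (single i 1) = 0" for i
      by (intro g.\<phi>_low[OF Lq, of 1]) simp_all
    then have eq: "e ?j i (lookup q 0) = 0" for i by (simp only: lookup_L_diff)
    have "lookup q 0 \<in> KK ?j" using q(1) by (simp only: mcarr_L mem_Collect_eq)
    from e_inj[OF _ this eq] have "lookup q 0 = 0" by simp
    then show ?case unfolding q(2) g.coef_\<phi>_0[OF q(1)] by simp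
  qed
  \<comment> \<open>Nakayama as an induction on \<theta>: in the difference only terms x^\<alpha>
    gg(q_\<alpha>) with \<alpha> \<noteq> 0 occur, so each q_\<alpha> has smaller degree, bounded
    below by \<open>gr_bounded\<close>.\<close>
  have gg_in: "gg j y \<in> Icarr ff j" if "y \<in> gr N (b, j)" for j y b
    using that
  proof (induction "nat (\<theta> b - \<theta> d)" arbitrary: b y rule: less_induct)
    case less
    note y = less.prems
    note yk = KK_I[OF y]
    show ?case
    proof (cases "j < 0")
      case True
      then show ?thesis using KK_neg[OF True] yk by simp
    next
      case False
      then have jn: "j = int (nat j)" by simp
      obtain q where q: "q \<in> Lcarr j" "gg j y - ff j y = cmap gg j q" using diff[OF yk] by blast
      have "cmap gg j q \<in> Rpt j b"
        unfolding q(2)[symmetric] by (intro R.P.diff f.f_gr g.f_gr y)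
      then have qpt: "q \<in> Lpt j b" by (rule g.\<phi>_pt_iff[OF q(1)])
      have z: "R.coef j 0 b' (cmap gg j q) = 0" for b'
        unfolding q(2)[symmetric] using coef0[of y "nat j" b'] yk jn by simp
      have q0: "lookup q 0 = 0" by (rule g.\<phi>_low[OF q(1), of 0]) (simp_all add: z)
      have "gg j (lookup q \<alpha>) \<in> Icarr ff j" if \<alpha>: "\<alpha> \<in> keys q" for \<alpha>
      proof -
        have nz: "lookup q \<alpha> \<noteq> 0" using \<alpha> by (simp add: in_keys_iff)
        then have "\<alpha> \<noteq> 0" using q0 by metis
        have g: "lookup q \<alpha> \<in> gr N (b - wt w \<alpha>, j)" using qpt by (simp add: pt_L)
        have "\<theta> d \<le> \<theta> (b - wt w \<alpha>)" by (rule gr_bounded[OF g nz])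
        moreover have "\<theta> (b - wt w \<alpha>) < \<theta> b" using \<theta>_wt_pos[OF \<open>\<alpha> \<noteq> 0\<close>] by simp
        ultimately show ?thesis by (intro less.hyps[OF _ g]) linarith
      qed
      then have "cmap gg j q \<in> Icarr ff j"
        unfolding lin_ext_def using I.carr_scale[of _ j] unfolding img_simps(1) by (intro I.P.carr_sum) blast
      then have "cmap gg j q + ff j y \<in> Icarr ff j" by (intro I.P.carr_add ff_in yk)
      then show ?thesis unfolding q(2)[symmetric] by simp
    qed
  qed
  have gg_KK: "gg j y \<in> Icarr ff j" if y: "y \<in> KK j" for y
  proof -
    obtain A h where A: "\<And>a. h a \<in> gr N (a, j)" "y = (\<Sum>a\<in>A. h a)"
      using y unfolding KK_def using carrE by metis
    show ?thesis unfolding A(2) g.f.sum by (intro I.P.carr_sum gg_in[OF A(1)])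
  qed
  show "Icarr gg j \<subseteq> Icarr ff j"
  proof (rule subsetI)
    fix x assume "x \<in> Icarr gg j"
    then obtain p where p: "p \<in> Lcarr j" "x = cmap gg j p" unfolding mcarr_img[OF gg] by blast
    have "gg j (lookup p \<alpha>) \<in> Icarr ff j" for \<alpha> using p(1) by (intro gg_KK) (simp add: mcarr_L)
    from I.carr_scale[OF this]
    have "Rsc j (single \<alpha> 1) (gg j (lookup p \<alpha>)) \<in> Icarr ff j" for \<alpha>
      unfolding img_simps(1) .
    then have "cmap gg j p \<in> Icarr ff j" unfolding lin_ext_def by (rule I.P.carr_sum)
    then show "x \<in> Icarr ff j" by (simp only: p(2))
  qed
qed

text \<open>Containment of the total spaces suffices, because the grading of the image is the one
  induced from the resolution.\<close>

lemma img_subcomplexI: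
  assumes ff: "family W ff" and C: "graded_complex Sg C" "subcomplex Sg C R"
    and sub: "\<And>j. mcarr (md C j) \<subseteq> Icarr ff j"
  shows "subcomplex Sg C (img ff)"
  unfolding subcomplex_def
proof (intro conjI allI C(1))
  show "df C = df (img ff)" "sc (md C j) = sc (md (img ff) j)" for j
    using C(2) by (simp_all add: subcomplex_def)
  fix j a
  interpret P: grading "pt (md C j)"
    using C(1) by unfold_locales (simp add: graded_complex_def graded_module_def)
  show "pt (md C j) a \<subseteq> Ipt ff j a"
  proof
    fix x assume x: "x \<in> pt (md C j) a"
    have "x \<in> Icarr ff j" using P.carrI[OF x] sub by blast
    moreover have "x \<in> Rpt j a" using x C(2) unfolding subcomplex_def by blast
    ultimately show "x \<in> Ipt ff j a" unfolding img_pt_iff[OF ff] by (rule conjI)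
  qed
qed

text \<open>A basis of C serves as the prescribed set \<open>W\<close>, so the resulting image
  contains C.\<close>

lemma slqs_extend:
  assumes C: "slqs Sg C R"
  obtains W ff where "family W ff" "subcomplex Sg C (img ff)"
proof -
  obtain BC where BC: "lin_basis BC" "\<And>j. mcarr (md C j) = R.F.span j (BC j)"
    by (rule slqs_lin_basis[OF C], rule that)
  obtain ff where ff: "family BC ff" using family_exists[OF BC(1)] ..
  interpret f: kmap_free Sg w \<theta> N "md R j" j "ff j" "BR j" for j by (rule family_kmap[OF ff])
  have gc: "graded_complex Sg (img ff)" using img_subcomplex[OF ff] by (simp add: subcomplex_def)
  interpret I: gmod Sg w \<theta> "md (img ff) j" for j
    using gc by unfold_locales (simp add: graded_complex_def)
  have "mcarr (md C j) \<subseteq> Icarr ff j" for j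
    unfolding BC(2)
  proof (rule R.F.span_minimal)
    show "R.F.subspace j (Icarr ff j)" using I.subspace_carr[of j] by simp
    show "BC j \<subseteq> Icarr ff j"
    proof
      fix c assume "c \<in> BC j"
      then obtain y where y: "y \<in> KK j" "c = ff j y" using family_W[OF ff, of j] by blast
      show "c \<in> Icarr ff j"
        unfolding mcarr_img[OF ff] y(2)
        by (rule image_eqI[of _ _ "tens 1 y"]) (simp_all add: f.\<phi>_tens tens_mcarr y(1))
    qed
  qed
  moreover have "graded_complex Sg C" "subcomplex Sg C R"
    using C by (simp_all add: slqs_def strongly_linear_def quasi_split_def)
  ultimately have "subcomplex Sg C (img ff)" by (intro img_subcomplexI[OF ff])
  then show ?thesis by (rule that[OF ff])
qed

text \<open>C' is the preimage of C under the chain map. This map is injective and C lies in its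
  image, so C' is isomorphic to C, and the preimage of a complement of C is a complement of C' in
  L(N).\<close>

lemma slqs_pullback:
  assumes C: "slqs Sg C R" and ff: "family W ff" and sub: "subcomplex Sg C (img ff)"
  shows "\<exists>C'. quasi_split Sg C' L \<and> complex_iso C C'"
proof -
  interpret f: kmap_free Sg w \<theta> N "md R j" j "ff j" "BR j" for j by (rule family_kmap[OF ff])
  have gc: "graded_complex Sg C" and s: "\<And>j. sc (md C j) = Rsc j" and d: "df C = df R"
    and ptC: "\<And>j a. pt (md C j) a \<subseteq> cmap ff j ` Lpt j a"
    using sub by (auto simp: subcomplex_def)
  have split: "\<exists>D. module.subspace (Rsc j) D \<and>
      mcarr (md C j) \<inter> D = {0} \<and> {x + y | x y. x \<in> mcarr (md C j) \<and> y \<in> D} = Rcarr j" for j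
    using C unfolding slqs_def quasi_split_def by blast
  interpret C: gmod Sg w \<theta> "md C j" for j
    using gc by unfold_locales (simp add: graded_complex_def)
  interpret T: module "tens_S_scale N" by (rule tens_S_module)
  have Cdf: "df R j x \<in> pt (md C (j - 1)) a" if "x \<in> pt (md C j) a" for j x a
    using gc that unfolding graded_complex_def graded_hom_def d by blast
  define C' where "C' = \<lparr>md = (\<lambda>j. \<lparr>sc = tens_S_scale N,
    pt = (\<lambda>a. {p \<in> Lpt j a. cmap ff j p \<in> pt (md C j) a})\<rparr>), df = L_diff N\<rparr>"
  have C'_simps [simp]: "sc (md C' j) = tens_S_scale N" "df C' = L_diff N"
    "pt (md C' j) a = {p \<in> Lpt j a. cmap ff j p \<in> pt (md C j) a}" for j a
    by (simp_all add: C'_def)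
  have gr: "is_grading (pt (md C' j))" for j
    by (rule is_grading_mono[OF f.L_grading[of j]])
      (use f.\<phi>_diff[of j 0] in \<open>auto intro: pt_L_zero pt_L_add pt_L_neg simp: f.\<phi>_add\<close>)
  have C'L: "mcarr (md C' j) \<subseteq> Lcarr j" for j by (rule carr_mono) simp
  have mC': "mcarr (md C' j) = {p \<in> Lcarr j. cmap ff j p \<in> mcarr (md C j)}" for j
  proof (intro equalityI subsetI CollectI conjI)
    fix p assume p: "p \<in> mcarr (md C' j)"
    then show "p \<in> Lcarr j" using C'L by blast
    show "cmap ff j p \<in> mcarr (md C j)"
      using p by (rule carr_map[rotated 2]) (auto simp: f.\<phi>_sum intro: C.P.carrI)
  next
    fix p assume "p \<in> {p \<in> Lcarr j. cmap ff j p \<in> mcarr (md C j)}"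
    then have p: "p \<in> Lcarr j" "cmap ff j p \<in> mcarr (md C j)" by simp_all
    obtain A h where A: "finite A" "\<And>a. h a \<in> pt (md C j) a" "cmap ff j p = (\<Sum>a\<in>A. h a)"
      using carrE[OF p(2)] by metis
    have "\<exists>q. q \<in> Lpt j a \<and> h a = cmap ff j q" for a using A(2)[of a] ptC by blast
    then have "\<exists>q. \<forall>a. q a \<in> Lpt j a \<and> h a = cmap ff j (q a)" by (intro choice allI)
    then obtain q where q: "\<forall>a. q a \<in> Lpt j a \<and> h a = cmap ff j (q a)" ..
    have "cmap ff j p = cmap ff j (\<Sum>a\<in>A. q a)" using A(3) q by (simp add: f.\<phi>_sum)
    moreover have "(\<Sum>a\<in>A. q a) \<in> Lcarr j" using q by (intro mcarr_L_sum pt_L_carr) blast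
    ultimately have pq: "p = (\<Sum>a\<in>A. q a)" using inj_onD[OF f.\<phi>_inj_on _ p(1)] by blast
    show "p \<in> mcarr (md C' j)"
      unfolding pq
    proof (rule carr_sumI[OF A(1)])
      show "0 \<in> pt (md C' j) a" for a by (simp add: pt_L_zero)
      show "q a \<in> pt (md C' j) a" for a using q A(2)[of a] by auto
    qed
  qed
  have gC': "graded_complex Sg C'"
    unfolding graded_complex_def graded_module_def graded_hom_def linear_on_def
  proof (intro allI conjI ballI)
    fix j
    show "module (sc (md C' j))" by (simp add: T.module_axioms)
    show "is_grading (pt (md C' j))" by (rule gr)
    show "sc (md C' j) t x \<in> pt (md C' j) (a + b)" if "t \<in> Sg a" "x \<in> pt (md C' j) b" for a b t x
      using that C.scale_in[of t a _ j b] by (simp add: pt_L_scale f.\<phi>_scale s)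
    show "df C' j ` pt (md C' j) a \<subseteq> pt (md C' (j - 1)) a" for a
      using Cdf[of _ j a] by (auto simp: L_diff_pt cmap_chain[OF ff pt_L_carr, symmetric])
    show "df C' j (x + y) = df C' j x + df C' j y" for x y by (simp add: L_diff_add)
    show "df C' j (sc (md C' j) t x) = sc (md C' (j - 1)) t (df C' j x)" for t x by (simp add: L_diff_scale)
    fix x assume "x \<in> mcarr (md C' j)"
    then have x: "x \<in> Lcarr j" using C'L by blast
    \<comment> \<open>That the differential squares to zero is inherited from the resolution through
      the injective chain map.\<close>
    have "cmap ff (j - 1 - 1) (L_diff N (j - 1) (L_diff N j x)) = df R (j - 1) (df R j (cmap ff j x))"
      by (simp only: cmap_chain[OF ff x] cmap_chain[OF ff L_diff_carr[OF x]])
    also have "\<dots> = 0" by (rule df_df[OF f.\<phi>_carr[OF x]])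
    finally show "df C' (j - 1) (df C' j x) = 0"
      unfolding C'_simps by (intro f.\<phi>_inj[of _ "j - 1 - 1"] L_diff_carr x)
  qed
  interpret C': gmod Sg w \<theta> "md C' j" for j
    using gC' by unfold_locales (simp add: graded_complex_def)
  have "complex_iso C' C"
    unfolding complex_iso_def
  proof (intro exI[of _ "cmap ff"] allI conjI ballI)
    fix j
    have inj: "inj_on (cmap ff j) (mcarr (md C' j))" by (rule inj_on_subset[OF f.\<phi>_inj_on C'L])
    show "graded_hom (md C' j) (md C j) (cmap ff j)"
      unfolding graded_hom_def linear_on_def by (auto simp: f.\<phi>_add f.\<phi>_scale s)
    show "bij_betw (cmap ff j) (pt (md C' j) a) (pt (md C j) a)" for a
      unfolding bij_betw_def
    proof
      show "inj_on (cmap ff j) (pt (md C' j) a)"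
        by (rule inj_on_subset[OF inj]) (use C'.P.carrI in blast)
      show "cmap ff j ` pt (md C' j) a = pt (md C j) a" using ptC[of j a] by auto
    qed
    show "bij_betw (cmap ff j) (mcarr (md C' j)) (mcarr (md C j))"
      unfolding bij_betw_def
    proof
      have "mcarr (md C j) \<subseteq> Icarr ff j" by (rule carr_mono) (use ptC in simp)
      then show "cmap ff j ` mcarr (md C' j) = mcarr (md C j)" unfolding mC' mcarr_img[OF ff] by auto
    qed (rule inj)
    show "cmap ff (j - 1) (df C' j p) = df C j (cmap ff j p)" if "p \<in> mcarr (md C' j)" for p
      using cmap_chain[OF ff subsetD[OF C'L that]] by (simp add: d)
  qed
  then have "complex_iso C C'"
  proof (rule complex_iso_sym)
    fix j x assume "x \<in> mcarr (md C' j)"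
    then show "df C' j x \<in> mcarr (md C' (j - 1))"
    proof (rule carr_map[rotated 2])
      fix a y assume "y \<in> pt (md C' j) a"
      then have "df C' j y \<in> pt (md C' (j - 1)) a"
        using gC' unfolding graded_complex_def graded_hom_def by blast
      then show "df C' j y \<in> mcarr (md C' (j - 1))" by (rule C'.P.carrI)
    qed (simp_all add: L_diff_sum C'.P.add del: C'_simps(3))
  qed (intro C'.P.zero C'.P.carr_add C'.carr_scale; assumption)+
  moreover have "quasi_split Sg C' L"
    unfolding quasi_split_def subcomplex_def
  proof (intro conjI allI gC')
    show "df C' = df L" "sc (md C' j) = sc (md L j)" for j by (simp_all add: df_L sc_L)
    show "pt (md C' j) a \<subseteq> Lpt j a" for j a by auto
    fix j
    obtain D where D: "R.F.subspace j D" "mcarr (md C j) \<inter> D = {0}"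
      "{x + y | x y. x \<in> mcarr (md C j) \<and> y \<in> D} = Rcarr j" using split[of j] by (elim exE conjE)
    let ?D = "{p \<in> Lcarr j. cmap ff j p \<in> D}"
    have "T.subspace ?D"
      using R.F.subspace_0[OF D(1)] R.F.subspace_add[OF D(1)] R.F.subspace_scale[OF D(1)]
      by (intro T.subspaceI) (auto simp: f.\<phi>_add f.\<phi>_scale mcarr_L_add mcarr_L_scale pt_L_carr[OF pt_L_zero])
    moreover have "mcarr (md C' j) \<inter> ?D = {0}"
    proof
      show "mcarr (md C' j) \<inter> ?D \<subseteq> {0}"
      proof
        fix p assume "p \<in> mcarr (md C' j) \<inter> ?D"
        then have "p \<in> Lcarr j" "cmap ff j p \<in> mcarr (md C j) \<inter> D" unfolding mC' by auto
        then show "p \<in> {0}" using f.\<phi>_inj[of p j] D(2) by simp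
      qed
      show "{0} \<subseteq> mcarr (md C' j) \<inter> ?D"
        using R.F.subspace_0[OF D(1)] C'.P.carr_zero[of j] pt_L_carr[OF pt_L_zero] by simp
    qed
    moreover have "{x + y | x y. x \<in> mcarr (md C' j) \<and> y \<in> ?D} = Lcarr j"
    proof (intro equalityI subsetI)
      fix p assume "p \<in> {x + y | x y. x \<in> mcarr (md C' j) \<and> y \<in> ?D}"
      then show "p \<in> Lcarr j" unfolding mC' by (auto intro: mcarr_L_add)
    next
      fix p assume p: "p \<in> Lcarr j"
      then have "cmap ff j p \<in> Rcarr j" by (rule f.\<phi>_carr)
      then have "cmap ff j p \<in> {x + y | x y. x \<in> mcarr (md C j) \<and> y \<in> D}" using D(3) by simp
      then obtain c u where cu: "cmap ff j p = c + u" "c \<in> mcarr (md C j)" "u \<in> D" by blast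
      have "mcarr (md C j) \<subseteq> Icarr ff j" by (rule carr_mono) (use ptC in simp)
      then obtain q where q: "q \<in> Lcarr j" "c = cmap ff j q" using cu(2) unfolding mcarr_img[OF ff] by blast
      have "q \<in> mcarr (md C' j)" unfolding mC' using q cu(2) by simp
      moreover have "p - q \<in> ?D" using p q cu by (simp add: mcarr_L_diff f.\<phi>_diff)
      moreover have "p = q + (p - q)" by simp
      ultimately show "p \<in> {x + y | x y. x \<in> mcarr (md C' j) \<and> y \<in> ?D}" by blast
    qed
    ultimately show "\<exists>D. module.subspace (sc (md L j)) D \<and> mcarr (md C' j) \<inter> D = {0} \<and>
      {x + y | x y. x \<in> mcarr (md C' j) \<and> y \<in> D} = Lcarr j"
      unfolding sc_L by (intro exI[of _ ?D] conjI)
  qed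
  ultimately show ?thesis by blast
qed

text \<open>Anything above the image lies in a further image of the same kind, and
  \<open>family_unique\<close> collapses this chain of inclusions.\<close>

lemma img_maximal:
  assumes ff: "family W ff"
  shows "maximal_slqs Sg (img ff) R"
  unfolding maximal_slqs_def
proof (intro conjI allI impI img_slqs[OF ff])
  fix D assume D: "slqs Sg D R \<and> subcomplex Sg (img ff) D"
  obtain V gg where gg: "family V gg" "subcomplex Sg D (img gg)" by (rule slqs_extend, rule conjunct1[OF D], rule that)
  have fD: "Icarr ff j \<subseteq> mcarr (md D j)" for j
    by (rule carr_mono) (use D in \<open>auto simp: subcomplex_def\<close>)
  have Dg: "mcarr (md D j) \<subseteq> Icarr gg j" for j
    by (rule carr_mono) (use gg(2) in \<open>auto simp: subcomplex_def\<close>)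
  have "Icarr gg j \<subseteq> Icarr ff j" for j
    by (rule family_unique[OF ff gg(1)]) (rule order_trans[OF fD Dg])
  then have "mcarr (md D j) \<subseteq> Icarr ff j" for j using Dg by (rule order_trans[rotated])
  moreover have "graded_complex Sg D" "subcomplex Sg D R"
    using D by (simp_all add: slqs_def strongly_linear_def quasi_split_def)
  ultimately show "subcomplex Sg D (img ff)" by (intro img_subcomplexI[OF ff])
qed

text \<open>A maximal subcomplex equals the image into which it extends, since that image is
  strongly linear and quasi-split itself.\<close>

lemma maximal_iso:
  assumes C: "maximal_slqs Sg C R"
  shows "complex_iso C L"
proof -
  have s: "slqs Sg C R" using C by (simp add: maximal_slqs_def)
  obtain W ff where ff: "family W ff" "subcomplex Sg C (img ff)" by (rule slqs_extend[OF s], rule that)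
  have sub: "subcomplex Sg (img ff) C"
    using C img_slqs[OF ff(1)] ff(2) unfolding maximal_slqs_def by blast
  have "md C j = md (img ff) j" for j
    by (rule gmod.equality) (use sub ff(2) in \<open>auto simp: subcomplex_def fun_eq_iff set_eq_subset simp del: img_simps\<close>)
  then have "C = img ff"
    by (intro cplx.equality) (use sub in \<open>auto simp: subcomplex_def\<close>)
  moreover have "complex_iso (img ff) L"
  proof (rule complex_iso_sym[OF img_iso[OF ff(1)]])
    show "0 \<in> Lpt j a" for j a by (rule pt_L_zero)
    show "x + y \<in> Lcarr j" if "x \<in> Lcarr j" "y \<in> Lcarr j" for j x y
      using that by (rule mcarr_L_add)
    show "sc (md L j) s x \<in> Lcarr j" if "x \<in> Lcarr j" for j s x
      unfolding sc_L using that by (rule mcarr_L_scale)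
    show "df L j x \<in> Lcarr (j - 1)" if "x \<in> Lcarr j" for j x
      unfolding df_L using that by (rule L_diff_carr)
  qed
  ultimately show ?thesis by simp
qed

lemma lin_basis_empty: "lin_basis (\<lambda>_. {})"
  by (simp add: lin_basis_def)

theorem linear_strand:
  "(\<exists>F'. slqs Sg F' R \<and> complex_iso L F')
   \<and> (\<forall>C. slqs Sg C R \<longrightarrow> (\<exists>C'. quasi_split Sg C' L \<and> complex_iso C C'))
   \<and> (\<exists>F'. maximal_slqs Sg F' R \<and> complex_iso L F')
   \<and> (\<forall>C. maximal_slqs Sg C R \<longrightarrow> complex_iso C L)
   \<and> (strongly_linear Sg R \<longrightarrow> complex_iso R L)"
proof -
  obtain ff where ff: "family (\<lambda>_. {}) ff" using family_exists[OF lin_basis_empty] ..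
  \<comment> \<open>A strongly linear resolution is quasi-split in itself with complement 0, so the
    last claim is the one about maximal subcomplexes.\<close>
  have "maximal_slqs Sg R R" if "strongly_linear Sg R"
  proof -
    have sub: "subcomplex Sg R R" using complex by (simp add: subcomplex_def)
    have "\<exists>D. module.subspace (Rsc j) D \<and> Rcarr j \<inter> D = {0} \<and>
        {x + y | x y. x \<in> Rcarr j \<and> y \<in> D} = Rcarr j" for j
      by (rule exI[of _ "{0}"]) (simp add: R.F.subspace_single_0)
    then have "quasi_split Sg R R" unfolding quasi_split_def using sub by blast
    then show ?thesis using that unfolding maximal_slqs_def slqs_def quasi_split_def by blast
  qed
  then show ?thesis
    using img_slqs[OF ff] img_iso[OF ff] img_maximal[OF ff] maximal_iso slqs_extend slqs_pullback by metis
qed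

end

section \<open>The module \<open>K\<^sub>d(M)\<close>\<close>

lemma sum_ext_degree: "(\<Sum>i\<in>I. (- w i, - 1 :: int)) = (- (\<Sum>i\<in>I. w i :: 'a::ab_group_add), - int (card I))"
  for I :: "'v::finite set"
  by (induction I rule: infinite_finite_induct) (auto simp: zero_prod_def)

lemma ext_basis_gr: "ext_basis I \<in> ext_gr w (- (\<Sum>i\<in>I. w i), - int (card I))"
  by (auto simp: ext_gr_def ext_basis_def sum_ext_degree)

lemma omega_gr_nonzero:
  assumes f: "f \<in> omega_gr w (a, j)" and nz: "f (ext_basis I) \<noteq> 0"
  shows "a = (\<Sum>i\<in>I. w i)" "j = int (card I)"
proof -
  have "(- (\<Sum>i\<in>I. w i), - int (card I)) = - (a, j)"
    using f nz ext_basis_gr[of I w] unfolding omega_gr_def by blast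
  then show "a = (\<Sum>i\<in>I. w i)" "j = int (card I)" by (auto simp: uminus_prod_def)
qed

lemma dual_basis_gr:
  fixes w :: "'v::{finite, linorder} \<Rightarrow> 'a::ab_group_add"
  shows "(dual_basis I :: ('v, 'k::field) ext \<Rightarrow> 'k) \<in> omega_gr w (\<Sum>i\<in>I. w i, int (card I))"
  unfolding omega_gr_def
proof (intro CollectI conjI allI impI ballI)
  show "module_hom (\<lambda>(c::'k) e I. c * e I) (*) (dual_basis I :: ('v, 'k) ext \<Rightarrow> 'k)"
    by unfold_locales (auto simp: dual_basis_def fun_eq_iff algebra_simps)
  fix b and e :: "('v, 'k) ext" assume "b \<noteq> - (\<Sum>i\<in>I. w i, int (card I))" "e \<in> ext_gr w b"
  then show "dual_basis I e = 0"
    by (auto simp: dual_basis_def ext_gr_def sum_ext_degree uminus_prod_def)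
qed

lemma dual_basis_ext_basis: "dual_basis I (ext_basis J) = (if I = J then 1 else 0)"
  by (simp add: dual_basis_def ext_basis_def)

locale kstrand = gmod Sg w \<theta> M
  for Sg :: "'a::ab_group_add \<Rightarrow> ('v::{finite, linorder}, 'k::field) mpol set" and w \<theta>
    and M :: "('a, ('v, 'k) mpol, 'm::ab_group_add) gmod" +
  fixes d :: 'a
  assumes generated: "generated_in_degree M d"
begin

abbreviation N where "N \<equiv> K_module w M d"

lemma ksc_N: "ksc N = (\<lambda>c g I. sc M (Const c) (g I))"
  and ract_N: "ract N = (\<lambda>g e. \<Sum>I\<in>UNIV. tens_omega M (g I) (omega_ract (dual_basis I) e))"
  by (simp_all add: K_module_def R_summand_def)

sublocale V: vector_space "\<lambda>c (g :: 'v set \<Rightarrow> 'm) I. sc M (Const c) (g I)"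
  by unfold_locales (auto simp: fun_eq_iff F.scale_left_distrib F.scale_right_distrib)

text \<open>The right action of e_i in coordinates with respect to the dual basis of E: contraction
  by e_i with its sign.\<close>

definition r :: "'v \<Rightarrow> ('v set \<Rightarrow> 'm) \<Rightarrow> 'v set \<Rightarrow> 'm"
  where "r i g J = (if i \<in> J then 0 else sc M (Const (ext_sign {i} J)) (g (insert i J)))"

lemma ext_mult_e: "ext_mult (ext_basis {i}) (ext_basis J) I =
  (if i \<notin> J \<and> I = insert i J then ext_sign {i} J else (0 :: 'k))"
  unfolding ext_basis_mult by (auto simp: ext_basis_def)

lemma ract_e: "ract N g (ext_basis {i}) = r i g"
proof
  fix J
  have "ract N g (ext_basis {i}) J =
    (\<Sum>I\<in>UNIV. if I = insert i J then (if i \<in> J then 0 else sc M (Const (ext_sign {i} J)) (g (insert i J))) else 0)"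
    unfolding ract_N sum_apply tens_omega_def omega_ract_def dual_basis_def ext_mult_e
    by (intro sum.cong refl) auto
  then show "ract N g (ext_basis {i}) J = r i g J" by (simp add: r_def)
qed

text \<open>The sign between the right and the left action of e_i in auxiliary degree
  \<open>j\<close>: the exponent is -j because e_i has auxiliary degree -1.\<close>

definition sg :: "int \<Rightarrow> 'k" where "sg j = (if even j then 1 else - 1)"

lemma sg_sq_scale [simp]: "sc M (Const (sg j)) (sc M (Const (sg j)) x) = x"
  by (simp add: sg_def)

lemma sg_nonzero [simp]: "sg j \<noteq> 0"
  by (simp add: sg_def)

lemma sg_cancel: "sc M (Const (sg j)) x = 0 \<longleftrightarrow> x = 0"
  by (simp add: sg_def)

lemma lact_e: "lact (ract N) (- 1) j (ext_basis {i}) g = (\<lambda>J. sc M (Const (sg j)) (r i g J))"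
  by (auto simp: lact_def ract_e sg_def fun_eq_iff)

text \<open>The hypothesis places \<open>g\<close> in one auxiliary degree, so the signs of the left
  action form a common factor. The kernel condition can then be stated with the sign-free operators
  \<Sum> x_i r_i.\<close>

lemma R_diff_eq:
  assumes "\<And>I. g I \<noteq> 0 \<Longrightarrow> int (card I) = j"
  shows "R_diff M g J = sc M (Const (sg j)) (\<Sum>i\<in>UNIV. sc M (Var i) (r i g J))"
proof -
  have 1: "tens_omega M (sc M (Var i) (g I)) (lact omega_ract (- 1) (int (card I)) (ext_basis {i}) (dual_basis I)) J =
    (if I = insert i J then sc M (Const (sg j)) (sc M (Var i) (r i g J)) else 0)" for i I
  proof (cases "g I = 0")
    case True
    then show ?thesis by (auto simp: tens_omega_def r_def)
  next
    case False
    then have c: "int (card I) = j" by (rule assms)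
    have "lact omega_ract (- 1) (int (card I)) (ext_basis {i}) (dual_basis I) (ext_basis J) =
      sg j * (if i \<notin> J \<and> I = insert i J then ext_sign {i} J else 0)"
      unfolding c by (simp add: lact_def omega_ract_def dual_basis_def ext_mult_e sg_def)
    then show ?thesis by (auto simp: tens_omega_def r_def mult_ac)
  qed
  have "R_diff M g J = (\<Sum>i\<in>UNIV. \<Sum>I\<in>UNIV. if I = insert i J then sc M (Const (sg j)) (sc M (Var i) (r i g J)) else 0)"
    unfolding R_diff_def sum_apply 1 by (rule sum.swap)
  then show ?thesis by (simp add: F.scale_sum_right)
qed

lemma R_diff_zero_iff:
  assumes "\<And>I. g I \<noteq> 0 \<Longrightarrow> int (card I) = j"
  shows "R_diff M g = 0 \<longleftrightarrow> (\<forall>J. (\<Sum>i\<in>UNIV. sc M (Var i) (r i g J)) = 0)"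
  using R_diff_eq[OF assms] sg_cancel by (simp add: fun_eq_iff)

lemma sign_anti: "i \<noteq> l \<Longrightarrow> ext_sign {i} {l} = - (ext_sign {l} {i :: 'v} :: 'k)"
proof -
  assume "i \<noteq> l"
  have *: "{(a, b). a \<in> {x} \<and> b \<in> {y} \<and> b < a} = (if y < x then {(x, y)} else {})" for x y :: 'v
    by auto
  show ?thesis unfolding ext_sign_def * using \<open>i \<noteq> l\<close> by auto
qed

lemma sign_insert: "l \<notin> J \<Longrightarrow> ext_sign {i :: 'v} (insert l J) = ext_sign {i} {l} * (ext_sign {i} J :: 'k)"
  using sgn_Un2[of "{l}" J "{i}"] by simp

lemma sign_nonzero [simp]: "ext_sign I J \<noteq> (0 :: 'k)"
  by (simp add: ext_sign_def)

lemma r_add: "r i (g + h) = r i g + r i h"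
  by (auto simp: r_def fun_eq_iff F.scale_right_distrib)

lemma r_zero: "r i 0 = 0"
  by (simp add: r_def fun_eq_iff)

lemma r_scale: "r i (\<lambda>I. sc M (Const c) (g I)) = (\<lambda>J. sc M (Const c) (r i g J))"
  by (auto simp: r_def fun_eq_iff mult.commute)

lemma r_sq: "r i (r i g) = 0"
  by (auto simp: r_def fun_eq_iff)

lemma r_anti: "r i (r l g) = - r l (r i g)"
proof (cases "i = l")
  case False
  show ?thesis
  proof
    fix J
    show "r i (r l g) J = (- r l (r i g)) J"
    proof (cases "i \<in> J \<or> l \<in> J")
      case True
      then show ?thesis using False by (auto simp: r_def)
    next
      case J: False
      have s: "ext_sign {i} J * ext_sign {l} (insert i J) = - (ext_sign {l} J * ext_sign {i} (insert l J) :: 'k)"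
      proof -
        have a: "ext_sign {l} {i} = - (ext_sign {i} {l} :: 'k)" using False by (intro sign_anti) simp
        have b: "ext_sign {l} (insert i J) = ext_sign {l} {i} * (ext_sign {l} J :: 'k)"
          "ext_sign {i} (insert l J) = ext_sign {i} {l} * (ext_sign {i} J :: 'k)"
          using J by (simp_all only: sign_insert not_False_eq_True de_Morgan_disj)
        show ?thesis unfolding b a by (simp add: mult_ac)
      qed
      have "r i (r l g) J = sc M (Const (ext_sign {i} J * ext_sign {l} (insert i J))) (g (insert l (insert i J)))"
        using J False by (simp add: r_def)
      also have "\<dots> = - sc M (Const (ext_sign {l} J * ext_sign {i} (insert l J))) (g (insert i (insert l J)))"
        unfolding s by (simp only: Const_simps F.scale_minus_left insert_commute)
      also have "\<dots> = (- r l (r i g)) J" using J False by (simp add: r_def)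
      finally show ?thesis .
    qed
  qed
qed (simp add: r_sq)

lemma r_supp: "r i g J \<noteq> 0 \<Longrightarrow> i \<notin> J \<and> g (insert i J) \<noteq> 0"
  by (auto simp: r_def split: if_splits)

text \<open>\<open>y\<close> is read off at the smallest index of a set because contraction has sign
  1 there, no other element lying below it. The anticommutation relations carry the value from the
  smallest index to all others, and \<open>sq\<close> makes \<open>z i\<close> vanish on sets that
  contain \<open>i\<close>.\<close>

lemma r_integrate:
  assumes sq: "\<And>i. r i (z i) = 0" and anti: "\<And>i l. r i (z l) + r l (z i) = 0"
  defines "y \<equiv> \<lambda>I. if I = {} then 0 else z (Min I) (I - {Min I})"
  shows "r i y = z i"
proof
  fix J
  show "r i y J = z i J"
  proof (cases "i \<in> J")
    case True
    have "r i (z i) (J - {i}) = sc M (Const (ext_sign {i} (J - {i}))) (z i J)"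
      using True by (simp add: r_def insert_absorb)
    then have "z i J = 0" using sq[of i] by simp
    then show ?thesis using True by (simp add: r_def)
  next
    case False
    let ?I = "insert i J" and ?m = "Min (insert i J)"
    have y: "r i y J = sc M (Const (ext_sign {i} J)) (z ?m (?I - {?m}))"
      using False by (simp add: r_def y_def)
    have mI: "?m \<in> ?I" by (rule Min_in) simp_all
    show ?thesis
    proof (cases "?m = i")
      case True
      have "i \<le> b" if "b \<in> J" for b using Min_le[of ?I b] True that by simp
      then have s0: "{(a, b). a \<in> {i} \<and> b \<in> J \<and> b < a} = {}" by (auto simp: not_less)
      have "ext_sign {i} J = (1 :: 'k)" unfolding ext_sign_def s0 by simp
      then show ?thesis unfolding y True using False by simp
    next
      case m: False
      then have mJ: "?m \<in> J" using mI by auto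
      have "?m \<le> i" by (rule Min_le) simp_all
      then have mi: "?m < i" using m by (rule le_neq_trans)
      let ?J = "J - {?m}"
      have J: "insert ?m ?J = J" "?m \<notin> ?J" using mJ by auto
      have IJ: "?I - {?m} = insert i ?J" using m by auto
      have 1: "{(a, b). a \<in> {i} \<and> b \<in> {?m} \<and> b < a} = {(i, ?m)}" using mi by auto
      have s1: "ext_sign {i} {?m} = (- 1 :: 'k)" unfolding ext_sign_def 1 by simp
      have "?m \<le> b" if "b \<in> J" for b using Min_le[of ?I b] that by simp
      then have 2: "{(a, b). a \<in> {?m} \<and> b \<in> ?J \<and> b < a} = {}" by (auto simp: not_less simp del: Min_insert)
      have s2: "ext_sign {?m} ?J = (1 :: 'k)" unfolding ext_sign_def 2 by simp
      have s3: "ext_sign {i} J = - (ext_sign {i} ?J :: 'k)"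
        using sign_insert[OF J(2), of i] s1 J(1) by simp
      \<comment> \<open>Here \<open>?m < i\<close>: the relation at \<open>J - {?m}\<close>
        exchanges the two indices at the cost of a sign, and removing \<open>?m\<close> from
        \<open>J\<close> changes the sign of contraction by e_i, so the two signs cancel.\<close>
      have "r i (z ?m) ?J = - r ?m (z i) ?J"
        using fun_cong[OF anti[of i ?m], of ?J] by (simp add: eq_neg_iff_add_eq_0)
      moreover have "r i (z ?m) ?J = sc M (Const (ext_sign {i} ?J)) (z ?m (?I - {?m}))"
        unfolding IJ using False by (simp add: r_def)
      moreover have "r ?m (z i) ?J = z i J"
        using J s2 by (simp add: r_def)
      ultimately have "sc M (Const (ext_sign {i} ?J)) (z ?m (?I - {?m})) = - z i J" by simp
      then show ?thesis unfolding y s3 by (simp only: Const_simps F.scale_minus_left minus_minus)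
    qed
  qed
qed

section \<open>The graded pieces of K_d(M) in coordinates\<close>

definition Kset :: "int \<Rightarrow> ('v set \<Rightarrow> 'm) set"
  where "Kset j = {g. (\<forall>I. g I \<in> pt M d) \<and> (\<forall>I. g I \<noteq> 0 \<longrightarrow> int (card I) = j) \<and>
    (\<forall>J. (\<Sum>i\<in>UNIV. sc M (Var i) (r i g J)) = 0)}"

text \<open>The twist by (-d;0) turns degree (b;j) into degree (b - d;j) of \<omega>_E, which is
  spanned by the dual basis elements of the sets with \<open>j\<close> elements and weight
  \<open>b - d\<close>.\<close>

lemma gr_N: "gr N (b, j) = {g \<in> Kset j. \<forall>I. g I \<noteq> 0 \<longrightarrow> d + (\<Sum>i\<in>I. w i) = b}"
proof -
  let ?X = "{tens_omega M m f | m f. m \<in> pt M d \<and> f \<in> twist (omega_gr w) (- d, 0) (b, j)}"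
  let ?Y = "{g. (\<forall>I. g I \<in> pt M d) \<and> (\<forall>I. g I \<noteq> 0 \<longrightarrow> int (card I) = j) \<and> (\<forall>I. g I \<noteq> 0 \<longrightarrow> d + (\<Sum>i\<in>I. w i) = b)}"
  have XY: "V.span ?X = ?Y"
  proof
    show "V.span ?X \<subseteq> ?Y"
    proof (rule V.span_minimal)
      show "?X \<subseteq> ?Y"
      proof
        fix g assume "g \<in> ?X"
        then obtain m f where g: "g = tens_omega M m f" "m \<in> pt M d" and f: "f \<in> omega_gr w (- d + b, j)"
          by (auto simp: twist_def)
        have "g I \<noteq> 0 \<Longrightarrow> f (ext_basis I) \<noteq> 0" for I unfolding g(1) tens_omega_def by auto
        then have "g I \<noteq> 0 \<Longrightarrow> - d + b = (\<Sum>i\<in>I. w i)" "g I \<noteq> 0 \<Longrightarrow> j = int (card I)" for I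
          using omega_gr_nonzero[OF f] by blast+
        then show "g \<in> ?Y" using g by (auto simp: tens_omega_def Const_scale_in algebra_simps)
      qed
      show "V.subspace ?Y"
        by (rule V.subspaceI) (auto intro: Const_scale_in, (metis add_0 add.right_neutral)+)
    qed
    show "?Y \<subseteq> V.span ?X"
    proof
      fix g assume g: "g \<in> ?Y"
      have "g = (\<Sum>I\<in>UNIV. tens_omega M (g I) (dual_basis I))"
      proof
        fix J
        have "(\<Sum>I\<in>UNIV. tens_omega M (g I) (dual_basis I)) J = (\<Sum>I\<in>UNIV. if I = J then g J else 0)"
          unfolding sum_apply tens_omega_def dual_basis_ext_basis by (intro sum.cong refl) auto
        then show "g J = (\<Sum>I\<in>UNIV. tens_omega M (g I) (dual_basis I)) J" by simp
      qed
      also have "\<dots> \<in> V.span ?X"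
      proof (rule V.span_sum)
        fix I
        show "tens_omega M (g I) (dual_basis I) \<in> V.span ?X"
        proof (cases "g I = 0")
          case True
          then have "tens_omega M (g I) (dual_basis I) = 0" by (auto simp: tens_omega_def fun_eq_iff)
          then show ?thesis by (simp only: V.span_zero)
        next
          case False
          then have "(- d + b, j) = (\<Sum>i\<in>I. w i, int (card I))" using g by auto
          then have "dual_basis I \<in> twist (omega_gr w) (- d, 0) (b, j)"
            using dual_basis_gr[of I w] by (simp add: twist_def)
          moreover have "g I \<in> pt M d" using g by blast
          ultimately show ?thesis by (intro V.span_base) blast
        qed
      qed
      finally show "g \<in> V.span ?X" .
    qed
  qed
  define Y where "Y = ?Y"
  have iff: "R_diff M g = 0 \<longleftrightarrow> (\<forall>J. (\<Sum>i\<in>UNIV. sc M (Var i) (r i g J)) = 0)" if "g \<in> Y" for g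
    using that unfolding Y_def by (intro R_diff_zero_iff[of g j]) blast
  have "gr N (b, j) = {g \<in> V.span ?X. R_diff M g = 0}"
    by (simp add: K_module_def R_summand_def)
  then have "gr N (b, j) = {g \<in> Y. R_diff M g = 0}" unfolding XY Y_def .
  also have "\<dots> = {g \<in> Y. \<forall>J. (\<Sum>i\<in>UNIV. sc M (Var i) (r i g J)) = 0}"
    by (rule Collect_cong) (simp add: iff cong: conj_cong)
  finally show ?thesis unfolding Y_def Kset_def by auto
qed

lemma Kset_0: "0 \<in> Kset j"
  by (simp add: Kset_def r_zero)

lemma Kset_add: "g \<in> Kset j \<Longrightarrow> h \<in> Kset j \<Longrightarrow> g + h \<in> Kset j"
  by (auto simp: Kset_def r_add F.scale_right_distrib sum.distrib) (metis add_0)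

lemma Kset_scale: "g \<in> Kset j \<Longrightarrow> (\<lambda>I. sc M (Const c) (g I)) \<in> Kset j"
proof -
  assume g: "g \<in> Kset j"
  have "(\<Sum>i\<in>UNIV. sc M (Var i) (sc M (Const c) (r i g J))) = sc M (Const c) (\<Sum>i\<in>UNIV. sc M (Var i) (r i g J))" for J
    by (simp add: F.scale_sum_right mult.commute)
  then show ?thesis using g by (auto simp: Kset_def r_scale Const_scale_in)
qed

lemma Kset_neg: "g \<in> Kset j \<Longrightarrow> - g \<in> Kset j"
  using Kset_scale[of g j "-1"] by (simp add: fun_Compl_def)

lemma gr_N_grading: "is_grading (\<lambda>b. gr N (b, j))"
  unfolding is_grading_def
proof (intro conjI allI ballI impI)
  fix b show "0 \<in> gr N (b, j)" by (simp add: gr_N Kset_0)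
  fix x assume x: "x \<in> gr N (b, j)"
  then show "- x \<in> gr N (b, j)" by (auto simp: gr_N Kset_neg)
  fix y assume "y \<in> gr N (b, j)"
  then show "x + y \<in> gr N (b, j)" using x by (auto simp: gr_N Kset_add) (metis add_0)
next
  fix f assume f: "(\<forall>b. lookup f b \<in> gr N (b, j)) \<and> (\<Sum>b\<in>keys f. lookup f b) = 0"
  have "lookup f b I = 0" for b I
  proof (rule ccontr)
    assume nz: "lookup f b I \<noteq> 0"
    have b': "lookup f b' I = 0" if "b' \<noteq> b" for b'
    proof -
      have "\<forall>I. lookup f b I \<noteq> 0 \<longrightarrow> d + (\<Sum>i\<in>I. w i) = b" "\<forall>I. lookup f b' I \<noteq> 0 \<longrightarrow> d + (\<Sum>i\<in>I. w i) = b'"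
        using f by (simp_all add: gr_N)
      then show ?thesis using nz that by blast
    qed
    have "0 = (\<Sum>b'\<in>keys f. lookup f b' I)" using f by (simp add: sum_apply[symmetric])
    also have "\<dots> = (\<Sum>b'\<in>keys f. if b' = b then lookup f b I else 0)"
      by (intro sum.cong refl) (simp add: b')
    also have "\<dots> = lookup f b I" using nz by (auto simp: in_keys_iff)
    finally show False using nz by simp
  qed
  then show "f = 0" by (intro poly_mapping_eqI) (auto simp: fun_eq_iff)
qed

text \<open>The kernel condition in \<open>Kset\<close> involves all degrees at once. Since the
  differential of R(M) is homogeneous, each graded part of a solution is again a solution.\<close>

lemma carr_gr_N: "carr (\<lambda>b. gr N (b, j)) = Kset j"
proof
  show "carr (\<lambda>b. gr N (b, j)) \<subseteq> Kset j"
  proof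
    fix g assume "g \<in> carr (\<lambda>b. gr N (b, j))"
    then obtain A h where h: "\<And>a. h a \<in> gr N (a, j)" "g = (\<Sum>a\<in>A. h a)" using carrE by metis
    have "h a \<in> Kset j" for a using h(1)[of a] by (simp add: gr_N)
    then show "g \<in> Kset j" unfolding h(2)
      by (induction A rule: infinite_finite_induct) (auto intro: Kset_0 Kset_add)
  qed
  show "Kset j \<subseteq> carr (\<lambda>b. gr N (b, j))"
  proof
    fix g assume g: "g \<in> Kset j"
    define D where "D I = d + (\<Sum>i\<in>I. w i)" for I
    define h where "h b = (\<lambda>I. if D I = b then g I else 0)" for b
    let ?A = "range D"
    have fin: "finite ?A" by simp
    have gh: "g = (\<Sum>b\<in>?A. h b)" by (auto simp: fun_eq_iff sum_apply h_def)
    have r_sum: "r i (\<Sum>b\<in>A. h b) = (\<Sum>b\<in>A. r i (h b))" for i A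
    proof (induction A rule: infinite_finite_induct)
      case (insert x A)
      then show ?case unfolding sum.insert[OF insert(1,2)] by (simp only: r_add)
    qed (simp_all only: sum.infinite sum.empty r_zero not_False_eq_True)
    \<comment> \<open>The contribution of the degree-\<open>b\<close> part of \<open>g\<close> to
      the kernel condition at \<open>J\<close>; it is homogeneous in M, of degree \<open>b\<close>
      minus the weight of \<open>J\<close>.\<close>
    define t where "t J b = (\<Sum>i\<in>UNIV. sc M (Var i) (r i (h b) J))" for J b
    have tsum: "(\<Sum>b\<in>?A. t J b) = 0" for J
    proof -
      have "(\<Sum>b\<in>?A. t J b) = (\<Sum>i\<in>UNIV. sc M (Var i) (r i g J))"
        unfolding t_def by (subst sum.swap) (subst gh, simp add: r_sum sum_apply F.scale_sum_right)
      then show ?thesis using g by (simp add: Kset_def)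
    qed
    have tpt: "t J b \<in> pt M (b - (\<Sum>i\<in>J. w i))" for J b
      unfolding t_def
    proof (rule P.sum)
      fix i
      show "sc M (Var i) (r i (h b) J) \<in> pt M (b - (\<Sum>i\<in>J. w i))"
      proof (cases "r i (h b) J = 0")
        case False
        then have i: "i \<notin> J" "D (insert i J) = b" using r_supp[of i "h b" J] by (auto simp: h_def split: if_splits)
        have "r i (h b) J \<in> pt M d"
          using g i(1) by (auto simp: r_def h_def Kset_def intro: Const_scale_in)
        then have "sc M (Var i) (r i (h b) J) \<in> pt M (w i + d)" by (rule Var_scale_in)
        moreover have "w i + d = b - (\<Sum>i\<in>J. w i)" using i by (auto simp: D_def algebra_simps)
        ultimately show ?thesis by simp
      qed simp
    qed
    have t0: "t J b = 0" if b: "b \<in> ?A" for J b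
    proof -
      let ?s = "\<Sum>i\<in>J. w i"
      \<comment> \<open>Reindexing by the degree in M, so that directness of its grading separates
        the contributions.\<close>
      have "(\<Sum>a\<in>(\<lambda>b. b - ?s) ` ?A. t J (a + ?s)) = (\<Sum>b\<in>?A. t J b)"
        by (subst sum.reindex) (auto simp: inj_on_def)
      then have "(\<Sum>a\<in>(\<lambda>b. b - ?s) ` ?A. t J (a + ?s)) = 0" by (simp only: tsum)
      then have "t J ((b - ?s) + ?s) = 0"
        by (intro P.direct[of "(\<lambda>b. b - ?s) ` ?A" "\<lambda>a. t J (a + ?s)"])
          (use fin b tpt[of J] in \<open>auto simp: algebra_simps\<close>)
      then show ?thesis by simp
    qed
    have "h b \<in> gr N (b, j)" if "b \<in> ?A" for b
      using g t0[OF that] by (auto simp: gr_N Kset_def t_def h_def D_def)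
    then have "(\<Sum>b\<in>?A. h b) \<in> carr (\<lambda>b. gr N (b, j))"
      by (intro carr_sumI fin) (simp_all add: gr_N Kset_0)
    then show "g \<in> carr (\<lambda>b. gr N (b, j))" using gh by simp
  qed
qed

lemma egr_N: "egr Sg w \<theta> N"
proof (intro egr.intro posgr_axioms egr_axioms.intro)
  show "vector_space (ksc N)" unfolding ksc_N by (rule V.vector_space_axioms)
  show "module_hom (ksc N) (ksc N) (\<lambda>y. ract N y e)" for e
    unfolding ksc_N ract_N
    by unfold_locales (auto simp: tens_omega_def fun_eq_iff sum_apply F.scale_right_distrib sum.distrib
        F.scale_sum_right mult.commute)
  show "is_grading (\<lambda>b. gr N (b, j))" for j by (rule gr_N_grading)
  show "ksc N t y \<in> gr N c" if "y \<in> gr N c" for t y c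
    using that by (cases c) (auto simp: gr_N ksc_N Kset_scale)
qed

interpretation N: egr Sg w \<theta> N by (rule egr_N)

lemma KK_N: "N.KK j = Kset j"
  by (simp add: N.KK_def carr_gr_N)

lemma e_N: "N.e j i g = (\<lambda>J. sc M (Const (sg j)) (r i g J))"
  by (simp add: N.e_def lact_e)

lemma KsetI:
  assumes "\<And>I. g I \<in> pt M d" "\<And>I. g I \<noteq> 0 \<Longrightarrow> int (card I) = j" "\<And>J. (\<Sum>i\<in>UNIV. sc M (Var i) (r i g J)) = 0"
  shows "g \<in> Kset j"
  using assms by (simp add: Kset_def)

lemma KsetD:
  assumes "g \<in> Kset j"
  shows "g I \<in> pt M d" "g I \<noteq> 0 \<Longrightarrow> int (card I) = j" "(\<Sum>i\<in>UNIV. sc M (Var i) (r i g J)) = 0"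
  using assms by (simp_all add: Kset_def)

text \<open>By \<open>r_anti\<close> contraction anticommutes with \<Sum> x_i r_i and therefore
  preserves its kernel.\<close>

lemma r_Kset:
  assumes g: "g \<in> Kset j"
  shows "r l g \<in> Kset (j - 1)"
proof (rule KsetI)
  show "r l g I \<in> pt M d" for I using KsetD(1)[OF g] by (auto simp: r_def intro: Const_scale_in)
  show "int (card I) = j - 1" if "r l g I \<noteq> 0" for I
    using r_supp[OF that] KsetD(2)[OF g, of "insert l I"] by simp
  fix J
  have "(\<Sum>i\<in>UNIV. sc M (Var i) (r i (r l g) J)) = - (\<Sum>i\<in>UNIV. sc M (Var i) (r l (r i g) J))"
    by (subst r_anti) (simp add: sum_negf)
  also have "(\<Sum>i\<in>UNIV. sc M (Var i) (r l (r i g) J)) =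
    (if l \<in> J then 0 else sc M (Const (ext_sign {l} J)) (\<Sum>i\<in>UNIV. sc M (Var i) (r i g (insert l J))))"
    unfolding r_def[of l] by (simp add: F.scale_sum_right mult.commute)
  also have "\<dots> = 0" using KsetD(3)[OF g] by simp
  finally show "(\<Sum>i\<in>UNIV. sc M (Var i) (r i (r l g) J)) = 0" by simp
qed

lemma Kset_integrate:
  assumes z: "\<And>i. z i \<in> Kset j" and sq: "\<And>i. r i (z i) = 0" and anti: "\<And>i l. r i (z l) + r l (z i) = 0"
    and cyc: "\<And>J. (\<Sum>i\<in>UNIV. sc M (Var i) (z i J)) = 0"
  shows "\<exists>y\<in>Kset (j + 1). \<forall>i. N.e (j + 1) i y = z i"
proof -
  define y where "y = (\<lambda>I. if I = {} then 0 else z (Min I) (I - {Min I}))"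
  have ry: "r i y = z i" for i unfolding y_def by (rule r_integrate[OF sq anti])
  have "y \<in> Kset (j + 1)"
  proof (rule KsetI)
    show "y I \<in> pt M d" for I using KsetD(1)[OF z] by (auto simp: y_def)
    show "int (card I) = j + 1" if "y I \<noteq> 0" for I
    proof -
      have I: "I \<noteq> {}" "z (Min I) (I - {Min I}) \<noteq> 0" using that by (auto simp: y_def split: if_splits)
      have "int (card (I - {Min I})) = j" by (rule KsetD(2)[OF z I(2)])
      moreover have "card I = Suc (card (I - {Min I}))" 
        using card_Suc_Diff1[of I "Min I"] Min_in[of I] I(1) by simp
      ultimately show ?thesis by simp
    qed
    show "(\<Sum>i\<in>UNIV. sc M (Var i) (r i y J)) = 0" for J unfolding ry by (rule cyc)
  qed
  \<comment> \<open>The factor \<open>sg (j + 1)\<close> undoes the sign of the left action in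
    degree \<open>j + 1\<close>.\<close>
  then have "(\<lambda>I. sc M (Const (sg (j + 1))) (y I)) \<in> Kset (j + 1)" by (rule Kset_scale)
  moreover have "N.e (j + 1) i (\<lambda>I. sc M (Const (sg (j + 1))) (y I)) = z i" for i
    unfolding e_N r_scale ry by (simp only: sg_sq_scale)
  ultimately show ?thesis by blast
qed

lemma ee_N: "N.e j i (N.e k l y) = (\<lambda>J. sc M (Const (sg j * sg k)) (r i (r l y) J))"
  unfolding e_N r_scale by simp

lemma sg_cancel_fun: "(\<lambda>J. sc M (Const (sg j)) (g J)) = 0 \<longleftrightarrow> g = 0"
  by (simp add: fun_eq_iff sg_cancel)

text \<open>Elements of auxiliary degree 0 are supported on the empty set, so evaluation there
  identifies them with M_d. The two lifting conditions carry the content, and in both the existence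
  of \<open>y\<close> comes from \<open>Kset_integrate\<close>.\<close>

lemma strand_N: "strand Sg w \<theta> N M d (\<lambda>g. g {})"
proof (intro strand.intro egr_N gmod_axioms strand_axioms.intro generated)
  show "module_hom (ksc N) (\<lambda>c. sc M (Const c)) (\<lambda>g. g {})"
    unfolding ksc_N by unfold_locales auto
  show "gr N (b, j) = {0}" if "j < 0" for b j
  proof -
    have "g = 0" if "g \<in> Kset j" for g
    proof
      show "g I = 0 I" for I using KsetD(2)[OF that, of I] \<open>j < 0\<close> by (cases "g I = 0") auto
    qed
    then show ?thesis using Kset_0[of j] by (auto simp: gr_N)
  qed
  show "y \<in> gr N (d, 0)" if "y \<in> N.KK 0" for y
    using that KsetD(2)[of y 0] unfolding KK_N gr_N by fastforce
  show "\<theta> d \<le> \<theta> b" if y: "y \<in> gr N (b, j)" "y \<noteq> 0" for y b j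
  proof -
    obtain I where "y I \<noteq> 0" using y(2) by (auto simp: fun_eq_iff)
    then have "b = d + (\<Sum>i\<in>I. w i)" using y(1) by (auto simp: gr_N)
    moreover have "0 \<le> (\<Sum>i\<in>I. \<theta> (w i))" using \<theta>_pos by (intro sum_nonneg) (simp add: less_imp_le)
    ultimately show ?thesis by (simp add: \<theta>_sum)
  qed
  show "N.e j i y \<in> gr N (b - w i, j - 1)" if y: "y \<in> gr N (b, j)" for y b j i
  proof -
    have "d + (\<Sum>i\<in>J. w i) = b - w i" if nz: "r i y J \<noteq> 0" for J
    proof -
      have "d + (\<Sum>i\<in>insert i J. w i) = b" using y r_supp[OF nz] unfolding gr_N by blast
      then show ?thesis using r_supp[OF nz] by (auto simp: algebra_simps)
    qed
    moreover have "r i y \<in> Kset (j - 1)" using y by (intro r_Kset) (simp add: gr_N)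
    ultimately show ?thesis unfolding e_N gr_N by (auto intro: Kset_scale simp: sg_cancel)
  qed
  show "y = 0" if j: "j > 0" and y: "y \<in> N.KK j" and e: "\<And>i. N.e j i y = 0" for y j
  proof
    fix I
    show "y I = 0 I"
    proof (cases "I = {}")
      case True
      then show ?thesis using KsetD(2)[of y j "{}"] y j by (auto simp: KK_N)
    next
      case False
      then obtain i where i: "i \<in> I" by blast
      have "r i y = 0" using e[of i] unfolding e_N sg_cancel_fun .
      then have "r i y (I - {i}) = 0" by simp
      then show ?thesis using i by (simp add: r_def insert_absorb)
    qed
  qed
  show "y = 0" if "y \<in> N.KK 0" "y {} = 0" for y
    using that KsetD(2)[of y 0] unfolding KK_N by (fastforce simp: fun_eq_iff)
  show "y {} \<in> pt M d" if "y \<in> gr N (d, 0)" for y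
    using that by (auto simp: gr_N dest: KsetD(1))
  show "\<exists>y\<in>gr N (d, 0). y {} = m" if m: "m \<in> pt M d" for m
  proof
    let ?y = "\<lambda>I. if I = {} then m else 0"
    show "?y \<in> gr N (d, 0)"
    proof -
      have "r i ?y = 0" for i by (simp add: r_def fun_eq_iff)
      then have "?y \<in> Kset 0" using m by (intro KsetI) (auto split: if_splits)
      then show ?thesis unfolding gr_N by auto
    qed
  qed simp
  show "(\<Sum>i\<in>UNIV. sc M (Var i) (z i {})) = 0 \<longleftrightarrow> (\<exists>y\<in>N.KK 1. \<forall>i. N.e 1 i y = z i)"
    if z: "\<And>i. z i \<in> N.KK 0" for z
  proof
    have z0: "z i J = 0" if "J \<noteq> {}" for i J
      using KsetD(2)[OF z[of i, unfolded KK_N], of J] that by auto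
    have rz: "r i (z l) = 0" for i l by (auto simp: r_def z0 fun_eq_iff)
    assume s: "(\<Sum>i\<in>UNIV. sc M (Var i) (z i {})) = 0"
    \<comment> \<open>In degree 0 the only nontrivial condition is the one at the empty set, which
      is the given linear syzygy.\<close>
    have "(\<Sum>i\<in>UNIV. sc M (Var i) (z i J)) = 0" for J using s z0 by (cases "J = {}") simp_all
    then have "\<exists>y\<in>Kset (0 + 1). \<forall>i. N.e (0 + 1) i y = z i"
      using z by (intro Kset_integrate) (simp_all add: KK_N rz)
    then show "\<exists>y\<in>N.KK 1. \<forall>i. N.e 1 i y = z i" by (simp add: KK_N)
  next
    assume "\<exists>y\<in>N.KK 1. \<forall>i. N.e 1 i y = z i"
    then obtain y where y: "y \<in> Kset 1" "\<And>i. N.e 1 i y = z i" unfolding KK_N by blast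
    have "(\<Sum>i\<in>UNIV. sc M (Var i) (z i {})) = sc M (Const (sg 1)) (\<Sum>i\<in>UNIV. sc M (Var i) (r i y {}))"
      unfolding y(2)[symmetric] e_N by (simp add: F.scale_sum_right mult.commute)
    then show "(\<Sum>i\<in>UNIV. sc M (Var i) (z i {})) = 0" using KsetD(3)[OF y(1)] by simp
  qed
  show "(\<forall>i. N.e j i (z i) = 0) \<and> (\<forall>i l. N.e j i (z l) + N.e j l (z i) = 0) \<longleftrightarrow>
      (\<exists>y\<in>N.KK (j + 1). \<forall>i. N.e (j + 1) i y = z i)"
    if j: "j > 0" and z: "\<And>i. z i \<in> N.KK j" for j z
  proof
    assume rel: "(\<forall>i. N.e j i (z i) = 0) \<and> (\<forall>i l. N.e j i (z l) + N.e j l (z i) = 0)"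
    have zK: "z i \<in> Kset j" for i using z by (simp add: KK_N)
    have sq: "r i (z i) = 0" for i using rel unfolding e_N sg_cancel_fun by blast
    have anti: "r i (z l) + r l (z i) = 0" for i l
    proof -
      have "N.e j i (z l) + N.e j l (z i) = (\<lambda>J. sc M (Const (sg j)) ((r i (z l) + r l (z i)) J))"
        by (simp add: e_N fun_eq_iff F.scale_right_distrib)
      then show ?thesis using rel sg_cancel_fun by metis
    qed
    \<comment> \<open>For positive \<open>j\<close> the condition follows from the relations: given
      \<open>l\<close> in \<open>J\<close>, exchanging r_l z_i for -r_i z_l turns the sum at
      \<open>J\<close>, up to sign, into the kernel condition of \<open>z l\<close> at
      \<open>J - {l}\<close>. At the empty set all \<open>z i\<close> vanish.\<close>
    have "(\<Sum>i\<in>UNIV. sc M (Var i) (z i J)) = 0" for J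
    proof (cases "J = {}")
      case True
      then have "z i J = 0" for i using KsetD(2)[OF zK, of i J] j by auto
      then show ?thesis by simp
    next
      case False
      then obtain l where l: "l \<in> J" by blast
      let ?J = "J - {l}" and ?c = "Const (ext_sign {l} (J - {l})) :: ('v, 'k) mpol"
      have rl: "r l (z i) ?J = sc M ?c (z i J)" for i using l by (simp add: r_def insert_absorb)
      have neg: "r l (z i) ?J = - r i (z l) ?J" for i
        using fun_cong[OF anti[of l i], of ?J] by (simp add: eq_neg_iff_add_eq_0)
      have "sc M ?c (\<Sum>i\<in>UNIV. sc M (Var i) (z i J)) = (\<Sum>i\<in>UNIV. sc M (Var i) (r l (z i) ?J))"
        unfolding rl by (simp add: F.scale_sum_right mult.commute)
      also have "\<dots> = - (\<Sum>i\<in>UNIV. sc M (Var i) (r i (z l) ?J))" unfolding neg by (simp add: sum_negf)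
      also have "\<dots> = 0" using KsetD(3)[OF zK] by simp
      finally show ?thesis by simp
    qed
    then show "\<exists>y\<in>N.KK (j + 1). \<forall>i. N.e (j + 1) i y = z i"
      unfolding KK_N by (intro Kset_integrate zK sq anti)
  next
    assume "\<exists>y\<in>N.KK (j + 1). \<forall>i. N.e (j + 1) i y = z i"
    then obtain y where y: "\<And>i. z i = N.e (j + 1) i y" by metis
    show "(\<forall>i. N.e j i (z i) = 0) \<and> (\<forall>i l. N.e j i (z l) + N.e j l (z i) = 0)"
    proof (intro conjI allI)
      show "N.e j i (z i) = 0" for i unfolding y ee_N r_sq by (simp add: fun_eq_iff)
      show "N.e j i (z l) + N.e j l (z i) = 0" for i l
        unfolding y ee_N by (subst r_anti) (simp add: fun_eq_iff)
    qed
  qed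
qed

end

theorem theorem4p3:
  fixes Sg :: "'a::ab_group_add \<Rightarrow> ('v::{finite, linorder}, 'k::field) mpol set"
    and w :: "'v \<Rightarrow> 'a"
    and M :: "('a, ('v, 'k) mpol, 'm::ab_group_add) gmod"
    and d :: 'a
    and F :: "('a, ('v, 'k) mpol, 'f::ab_group_add) cplx"
  assumes "positively_graded Sg w"
    and "graded_module Sg M"
    and "generated_in_degree M d"
    and "minimal_free_resolution Sg F M"
  shows
    "(\<exists>F'. slqs Sg F' F \<and> complex_iso (L_complex Sg (K_module w M d)) F')
     \<and> (\<forall>C. slqs Sg C F \<longrightarrow>
          (\<exists>C'. quasi_split Sg C' (L_complex Sg (K_module w M d)) \<and> complex_iso C C'))
     \<and> (\<exists>F'. maximal_slqs Sg F' F \<and> complex_iso (L_complex Sg (K_module w M d)) F')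
     \<and> (\<forall>C. maximal_slqs Sg C F \<longrightarrow> complex_iso C (L_complex Sg (K_module w M d)))
     \<and> (strongly_linear Sg F \<longrightarrow> complex_iso F (L_complex Sg (K_module w M d)))"
proof -
  obtain \<theta> where \<theta>: "additive \<theta>" "\<And>i. \<theta> (w i) > (0 :: int)"
    using assms(1) unfolding positively_graded_def by blast
  have posgr: "posgr Sg w \<theta>"
    using assms(1) \<theta> by unfold_locales (auto simp: positively_graded_def additive_def)
  have gmod: "gmod Sg w \<theta> M" by (intro gmod.intro posgr gmod_axioms.intro assms(2))
  have "strand Sg w \<theta> (K_module w M d) M d (\<lambda>g. g {})"
    by (intro kstrand.strand_N kstrand.intro gmod kstrand_axioms.intro assms(3))
  moreover have "\<exists>BF \<epsilon>. resol_axioms Sg M F BF \<epsilon>"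
    using assms(4) unfolding minimal_free_resolution_def graded_free_def
  proof (elim conjE exE)
    fix \<epsilon>
    assume "\<forall>j. \<exists>B. homogeneous_basis (md F j) B"
    then have "\<exists>BF. \<forall>j. homogeneous_basis (md F j) (BF j)" by (rule choice)
    then obtain BF where BF: "\<forall>j. homogeneous_basis (md F j) (BF j)" ..
    assume a: "graded_complex Sg F" "\<forall>j<0. mcarr (md F j) = {0}"
      "\<forall>j>0. {x \<in> mcarr (md F j). df F j x = 0} = df F (j + 1) ` mcarr (md F (j + 1))"
      "graded_hom (md F 0) M \<epsilon>" "\<epsilon> ` mcarr (md F 0) = mcarr M"
      "{x \<in> mcarr (md F 0). \<epsilon> x = 0} = df F 1 ` mcarr (md F 1)"
      "\<forall>j. df F j ` mcarr (md F j) \<subseteq> module.span (sc (md F (j - 1)))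
        {sc (md F (j - 1)) (Var i) x | i x. x \<in> mcarr (md F (j - 1))}"
    have "resol_axioms Sg M F BF \<epsilon>"
      by (rule resol_axioms.intro[OF a(1) spec[OF BF] a(2,3)[rule_format] a(4-6) spec[OF a(7)]])
    then show ?thesis by blast
  qed
  then obtain BF \<epsilon> where "resol_axioms Sg M F BF \<epsilon>" by blast
  ultimately have "resol Sg w \<theta> (K_module w M d) M d (\<lambda>g. g {}) F BF \<epsilon>"
    by (rule resol.intro)
  then show ?thesis by (rule resol.linear_strand)
qed

end
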